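(* Let $d$ be a metric on $\mathbb{R}^n$ and let $B\subset\mathbb{R}^n$ be a metric ball of $d$ which is a bounded domain in $\mathbb{R}^n$. Let $A$ be a bounded measurable nonnegative semidefinite $n\times n$ matrix function on $B$. Let $\varphi$ be a Young function with convex conjugate $\tilde\varphi$, and define $\phi(t)=\varphi(t^2)$ for all $t\in\mathbb{R}$. Suppose there is a constant $C$ such that for every $f\in L^{\tilde\varphi}(B,d\mu)$ there exists a unique weak solution $u\in(W^{1,2}_A)_0(B)$ of the Dirichlet problem $\nabla\cdot A\nabla u=f$ in $B$, $u|_{\partial B}=0$, and this solution satisfies $$\|u\|_{L^\infty(B,d\mu)}\le C\|f\|_{L^{\tilde\varphi}(B,d\mu)}.$$ Then there is a constant $C'<\infty$ such that $$\|w\|_{L^{\phi}(B,d\mu)}\le C'\left(\int_B|\nabla_A w|^2\,d\mu\right)^{1/2}\quad\text{for all } w\in(W^{1,2}_A)_0(B).$$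
   Context: For the domain $\Omega=B$, it is assumed that $A(x)=S(x)^{\mathrm{tr}}S(x)$, where $S(x)$ is a Lipschitz continuous $n\times n$ real matrix function on $\Omega$. The $A$-gradient is $\nabla_A v=S\nabla v$ (derivatives in the weak sense), so that formally $\nabla u\cdot A\nabla v=\nabla_A u\cdot\nabla_A v$ and $|\nabla_A v|^2=\nabla v^{\mathrm{tr}}A\nabla v$. The space $W^{1,2}_A(\Omega)$ consists of $v\in L^2(\Omega)$ with $\nabla_A v\in L^2(\Omega)$, with norm $\|v\|_{W^{1,2}_A}=\left(\int_\Omega(|v|^2+|\nabla_A v|^2)\,dx\right)^{1/2}$; $(W^{1,2}_A)_0(\Omega)$ is the closure in $W^{1,2}_A(\Omega)$ of the Lipschitz functions with compact support in $\Omega$. Weak solution: $u\in(W^{1,2}_A)_0(\Omega)$ is a weak solution of $\nabla\cdot A\nabla u=f$ in $\Omega$, $u|_{\partial\Omega}=0$, if $\int_\Omega\nabla u\cdot A\nabla\psi=-\int_\Omega f\psi$ for every Lipschitz $\psi$ with compact support in $\Omega$. Measure: $d\mu=dx/|B|$, where $|B|$ is the Lebesgue measure of $B$. A Young function is a convex, lower semicontinuous, even function $\theta:\mathbb{R}\to[0,\infty]$ with $\theta(0)=0$ such that neither $\theta$ nor its convex conjugate $\tilde\theta(t)=\sup_{s\in\mathbb{R}}\{st-\theta(s)\}$ is identically zero. The Luxembourg norm is $\|f\|_{L^\theta(B,d\mu)}=\inf\{k>0:\int_B\theta(f/k)\,d\mu\le 1\}$ (with $\inf\emptyset=+\infty$),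 and $L^\theta(B,d\mu)$ is the set of measurable $f$ on $B$ with $\|f\|_{L^\theta(B,d\mu)}<\infty$. *)

theory Defs
  imports "HOL-Probability.Essential_Supremum"
begin

section \<open>Young functions and Orlicz spaces\<close>

text \<open>
  The supremum is taken in the extended reals. If \<open>\<theta> 0 = 0\<close>, it is nonnegative (take \<open>s = 0\<close>),
  so that \<open>e2ennreal\<close> loses no information.
\<close>

definition convex_conjugate :: "(real \<Rightarrow> ennreal) \<Rightarrow> real \<Rightarrow> ennreal" where
  "convex_conjugate \<theta> t = e2ennreal (SUP s. ereal (s * t) - enn2ereal (\<theta> s))"

definition young_function :: "(real \<Rightarrow> ennreal) \<Rightarrow> bool" where
  "young_function \<theta> \<longleftrightarrow>
     (\<forall>x y t. 0 \<le> t \<and> t \<le> 1 \<longrightarrow>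
        \<theta> (t * x + (1 - t) * y) \<le> ennreal t * \<theta> x + ennreal (1 - t) * \<theta> y) \<and>
     (\<forall>x. \<theta> x \<le> Liminf (at x) \<theta>) \<and>
     (\<forall>x. \<theta> (- x) = \<theta> x) \<and>
     \<theta> 0 = 0 \<and>
     (\<exists>t. \<theta> t \<noteq> 0) \<and>
     (\<exists>t. convex_conjugate \<theta> t \<noteq> 0)"

definition luxemburg_norm :: "'a measure \<Rightarrow> (real \<Rightarrow> ennreal) \<Rightarrow> ('a \<Rightarrow> real) \<Rightarrow> ennreal" where
  "luxemburg_norm M \<theta> f = Inf {ennreal k |k. 0 < k \<and> (\<integral>\<^sup>+x. \<theta> (f x / k) \<partial>M) \<le> 1}"

definition orlicz_space :: "'a measure \<Rightarrow> (real \<Rightarrow> ennreal) \<Rightarrow> ('a \<Rightarrow> real) set" where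
  "orlicz_space M \<theta> = {f \<in> borel_measurable M. luxemburg_norm M \<theta> f < \<infinity>}"


section \<open>Functions on a domain\<close>

text \<open>
  A function on \<open>\<Omega>\<close> is a total function whose values outside \<open>\<Omega>\<close> are irrelevant; accordingly
  measurability and integrals refer to the measure space \<open>lebesgue_on \<Omega>\<close>, whose carrier is \<open>\<Omega>\<close>.
  Elements of the function spaces below are functions, not classes of functions equal almost
  everywhere.
\<close>

definition normalized_lebesgue_on :: "(real ^ 'n) set \<Rightarrow> (real ^ 'n) measure" where
  "normalized_lebesgue_on \<Omega> = uniform_measure (lebesgue_on \<Omega>) \<Omega>"

definition L2_on :: "(real ^ 'n) set \<Rightarrow> (real ^ 'n \<Rightarrow> 'b :: euclidean_space) set" where
  "L2_on \<Omega> = {f \<in> borel_measurable (lebesgue_on \<Omega>).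
               integrable (lebesgue_on \<Omega>) (\<lambda>x. (norm (f x))\<^sup>2)}"

text \<open>
  A Lipschitz function with compact support in the open set \<open>\<Omega>\<close> extends by zero to a Lipschitz
  function on the whole space; test functions are represented by these extensions.
\<close>

definition Lip_compact_support :: "(real ^ 'n) set \<Rightarrow> (real ^ 'n \<Rightarrow> real) set" where
  "Lip_compact_support \<Omega> = {\<psi>. (\<exists>L. L-lipschitz_on UNIV \<psi>) \<and>
     compact (closure {x. \<psi> x \<noteq> 0}) \<and> closure {x. \<psi> x \<noteq> 0} \<subseteq> \<Omega>}"

definition pderiv_at :: "'n \<Rightarrow> (real ^ 'n \<Rightarrow> real) \<Rightarrow> real ^ 'n \<Rightarrow> real" where
  "pderiv_at j f x = deriv (\<lambda>t. f (x + t *\<^sub>R axis j 1)) 0"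


section \<open>Degenerate Sobolev spaces\<close>

text \<open>
  The relation \<open>g = S \<nabla>v\<close> in the weak sense. Row \<open>i\<close> of \<open>S\<close> is the Lipschitz vector field
  \<open>S\<^sub>i\<close>, and the \<open>i\<close>-th component of \<open>g\<close> is the weak derivative of \<open>v\<close> along it:
  \<open>\<integral> g\<^sub>i \<psi> = - \<integral> v div (\<psi> S\<^sub>i)\<close> for all test functions \<open>\<psi>\<close>.
  No weak partial derivatives of \<open>v\<close> itself are required to exist.
  Since \<open>S\<close> and \<open>\<psi>\<close> are Lipschitz, the classical partial derivatives of their products exist
  almost everywhere in \<open>\<Omega>\<close> (Rademacher), so the arbitrary value of \<open>deriv\<close> elsewhere is harmless.
\<close>

definition has_weak_A_gradient ::
  "(real ^ 'n \<Rightarrow> real ^ 'n ^ 'n) \<Rightarrow> (real ^ 'n) set \<Rightarrow> (real ^ 'n \<Rightarrow> real) \<Rightarrow> (real ^ 'n \<Rightarrow> real ^ 'n) \<Rightarrow> bool"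
  where
  "has_weak_A_gradient S \<Omega> v g \<longleftrightarrow>
     (\<forall>i. \<forall>\<psi>\<in>Lip_compact_support \<Omega>.
        (\<integral>x. g x $ i * \<psi> x \<partial>lebesgue_on \<Omega>) =
        - (\<integral>x. v x * (\<Sum>j\<in>UNIV. pderiv_at j (\<lambda>y. S y $ i $ j * \<psi> y) x) \<partial>lebesgue_on \<Omega>))"

definition W12A :: "(real ^ 'n \<Rightarrow> real ^ 'n ^ 'n) \<Rightarrow> (real ^ 'n) set \<Rightarrow> (real ^ 'n \<Rightarrow> real) set" where
  "W12A S \<Omega> = {v \<in> L2_on \<Omega>. \<exists>g\<in>L2_on \<Omega>. has_weak_A_gradient S \<Omega> v g}"

text \<open>A representative of the weak gradient, which is determined up to null sets.\<close>

definition A_gradient ::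
  "(real ^ 'n \<Rightarrow> real ^ 'n ^ 'n) \<Rightarrow> (real ^ 'n) set \<Rightarrow> (real ^ 'n \<Rightarrow> real) \<Rightarrow> real ^ 'n \<Rightarrow> real ^ 'n"
  where
  "A_gradient S \<Omega> v = (SOME g. g \<in> L2_on \<Omega> \<and> has_weak_A_gradient S \<Omega> v g)"

definition W12A_norm :: "(real ^ 'n \<Rightarrow> real ^ 'n ^ 'n) \<Rightarrow> (real ^ 'n) set \<Rightarrow> (real ^ 'n \<Rightarrow> real) \<Rightarrow> real" where
  "W12A_norm S \<Omega> v =
     sqrt (\<integral>x. \<bar>v x\<bar>\<^sup>2 + (norm (A_gradient S \<Omega> v x))\<^sup>2 \<partial>lebesgue_on \<Omega>)"

definition W12A0 :: "(real ^ 'n \<Rightarrow> real ^ 'n ^ 'n) \<Rightarrow> (real ^ 'n) set \<Rightarrow> (real ^ 'n \<Rightarrow> real) set" where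
  "W12A0 S \<Omega> = {v \<in> W12A S \<Omega>.
     \<forall>\<epsilon>>0. \<exists>\<psi>\<in>Lip_compact_support \<Omega>. W12A_norm S \<Omega> (\<lambda>x. v x - \<psi> x) < \<epsilon>}"

text \<open>
  Weak solutions of \<open>\<nabla> \<cdot> A \<nabla>u = f\<close> in \<open>\<Omega>\<close>, \<open>u = 0\<close> on the boundary, where
  \<open>A = S\<^sup>t\<^sup>r S\<close> and \<open>\<nabla>u \<cdot> A \<nabla>\<psi>\<close> is read as \<open>\<nabla>\<^sub>A u \<cdot> \<nabla>\<^sub>A \<psi>\<close>, since a general \<open>u\<close> in the degenerate
  space has no gradient of its own.
\<close>

definition weak_dirichlet_solution ::
  "(real ^ 'n \<Rightarrow> real ^ 'n ^ 'n) \<Rightarrow> (real ^ 'n) set \<Rightarrow> (real ^ 'n \<Rightarrow> real) \<Rightarrow> (real ^ 'n \<Rightarrow> real) \<Rightarrow> bool"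
  where
  "weak_dirichlet_solution S \<Omega> f u \<longleftrightarrow>
     u \<in> W12A0 S \<Omega> \<and>
     (\<forall>\<psi>\<in>Lip_compact_support \<Omega>.
        (\<integral>x. A_gradient S \<Omega> u x \<bullet> A_gradient S \<Omega> \<psi> x \<partial>lebesgue_on \<Omega>) =
        - (\<integral>x. f x * \<psi> x \<partial>lebesgue_on \<Omega>))"

end

theory Submission
  imports Defs
begin

text \<open>
The inequality follows by duality from an energy estimate. Write \<open>\<mu>\<close> for normalised Lebesgue
measure on the domain. The norm of \<open>w\<close> for \<open>t \<mapsto> \<phi> (t\<^sup>2)\<close> is the square root of the \<open>\<phi>\<close>-norm of
\<open>w\<^sup>2\<close>, and that norm is controlled by the integrals \<open>\<integral> f w\<^sup>2 d\<mu>\<close> with bounded \<open>f \<ge> 0\<close> of finite norm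
for the convex conjugate of \<open>\<phi>\<close>. So it is enough to bound \<open>\<integral> f w\<^sup>2 d\<mu>\<close> by a multiple of the norm of \<open>f\<close>
times \<open>\<integral> |\<nabla>\<^sub>A w|\<^sup>2 d\<mu>\<close>.

For this, let \<open>u\<close> be the solution with right-hand side \<open>f\<close> and let \<open>M\<close> bound \<open>|u|\<close>; the hypothesis
makes \<open>M\<close> a multiple of the norm of \<open>f\<close>. For a test function \<open>w\<close>, testing the equation with \<open>w\<^sup>2\<close> and with
\<open>u w\<^sup>2\<close> gives
\<open>\<integral> f w\<^sup>2 = - \<integral> 2 w \<nabla>\<^sub>A u \<bullet> \<nabla>\<^sub>A w\<close> and
\<open>\<integral> w\<^sup>2 |\<nabla>\<^sub>A u|\<^sup>2 = - \<integral> 2 u w \<nabla>\<^sub>A u \<bullet> \<nabla>\<^sub>A w - \<integral> f u w\<^sup>2\<close>.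
Since \<open>|u| \<le> M\<close>, the weighted energy \<open>\<integral> w\<^sup>2 |\<nabla>\<^sub>A u|\<^sup>2\<close> can be absorbed, and
\<open>\<integral> f w\<^sup>2 \<le> 8 M \<integral> |\<nabla>\<^sub>A w|\<^sup>2\<close> remains (\<open>energy_estimate_test\<close>). The function \<open>u w\<^sup>2\<close> is not a test function;
it is the limit of \<open>\<psi> w\<^sup>2\<close> with test functions \<open>\<psi>\<close> approximating \<open>u\<close>. A second limit extends the
estimate to all \<open>w\<close> in the closure of the test functions (\<open>energy_estimate\<close>).

The duality step (\<open>nn_integral_young_le_1_if_dual_bound\<close>) replaces \<open>\<phi>\<close> by the maximum of finitely many
affine minorants \<open>a t - b\<close>. Choosing for \<open>f\<close> the slope of the largest one at \<open>w\<^sup>2 / N\<close> turns Young's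
inequality into an equality, and \<open>f\<close> is automatically bounded.

These arguments use a product rule for \<open>\<nabla>\<^sub>A\<close> on test functions. The weak gradient is defined through
classical partial derivatives of Lipschitz functions, so that rule and the membership of test
functions in the Sobolev space need differentiability almost everywhere along each coordinate
direction. On the line this is Lebesgue's theorem for monotone functions, obtained from Vitali's
covering theorem (\<open>lipschitz_AE_differentiable\<close>); Tonelli's theorem carries it to higher dimensions.
That a partial derivative of a compactly supported Lipschitz function has integral zero
(\<open>integral_directional_deriv_eq_0\<close>) then gives integration by parts.
\<close>

section \<open>Differentiability almost everywhere in one variable\<close>

text \<open>
  The open intervals \<open>(f s, f t)\<close> are pairwise disjoint subsets of \<open>[f a, f b]\<close>, because \<open>f\<close> is monotone.
\<close>

lemma sum_disjoint_increments_le: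
  fixes f :: "real \<Rightarrow> real"
  assumes mono: "mono f" and ab: "a \<le> b"
    and C: "countable C" "disjoint_family_on (\<lambda>(s, t). {s..t}) C"
    and sub: "\<And>s t. (s, t) \<in> C \<Longrightarrow> s < t \<and> {s..t} \<subseteq> {a..b}"
  shows "(\<integral>\<^sup>+(s, t). ennreal (f t - f s) \<partial>count_space C) \<le> ennreal (f b - f a)"
proof -
  let ?J = "\<lambda>(s, t). {f s<..<f t}"
  have disj: "disjoint_family_on ?J C"
  proof (unfold disjoint_family_on_def, intro ballI impI)
    fix i j assume "i \<in> C" "j \<in> C" "i \<noteq> j"
    moreover obtain s t u v where [simp]: "i = (s, t)" "j = (u, v)" by (cases i, cases j)
    ultimately have ij: "(s, t) \<in> C" "(u, v) \<in> C" "(s, t) \<noteq> (u, v)" by auto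
    then have d: "{s..t} \<inter> {u..v} = {}" using C(2) by (fastforce simp: disjoint_family_on_def)
    have r: "s < t" "u < v" using sub ij by auto
    have "t \<le> u \<or> v \<le> s"
    proof (rule ccontr)
      assume "\<not> ?thesis"
      then have "max s u \<in> {s..t} \<inter> {u..v}" using r by auto
      then show False using d by auto
    qed
    then show "?J i \<inter> ?J j = {}"
      using monoD[OF mono, of t u] monoD[OF mono, of v s] by auto
  qed
  have "(\<integral>\<^sup>+(s, t). ennreal (f t - f s) \<partial>count_space C)
      = (\<integral>\<^sup>+i. emeasure lborel (?J i) \<partial>count_space C)"
  proof (intro nn_integral_cong)
    fix i assume "i \<in> space (count_space C)"
    then obtain s t where i: "i = (s, t)" "(s, t) \<in> C" by (cases i) auto
    then have "f s \<le> f t" using sub[of s t] by (intro monoD[OF mono]) auto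
    then show "(case i of (s, t) \<Rightarrow> ennreal (f t - f s)) = emeasure lborel (?J i)" by (simp add: i)
  qed
  also have "\<dots> = emeasure lborel (\<Union>i\<in>C. ?J i)"
    by (rule emeasure_UN_countable[symmetric]) (use C disj in auto)
  also have "\<dots> \<le> emeasure lborel {f a..f b}"
  proof (rule emeasure_mono)
    show "(\<Union>i\<in>C. ?J i) \<subseteq> {f a..f b}"
    proof clarsimp
      fix s t y assume i: "(s, t) \<in> C" "f s < y" "y < f t"
      then have "a \<le> s" "t \<le> b" using sub[of s t] by auto
      then show "f a \<le> y \<and> y \<le> f b"
        using i monoD[OF mono, of a s] monoD[OF mono, of t b] by auto
    qed
  qed auto
  also have "\<dots> = ennreal (f b - f a)" using monoD[OF mono ab] by simp
  finally show ?thesis .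
qed

lemma Vitali_covering_intervals:
  fixes E U :: "real set"
  assumes U: "open U" "E \<subseteq> U"
    and fine: "\<And>x d. x \<in> E \<Longrightarrow> 0 < d \<Longrightarrow> \<exists>s t. s < t \<and> x \<in> {s..t} \<and> t - s < d \<and> P s t"
  obtains C where "countable C" "disjoint_family_on (\<lambda>(s, t). {s..t}) C"
    "negligible (E - (\<Union>(s, t)\<in>C. {s..t}))"
    "\<And>s t. (s, t) \<in> C \<Longrightarrow> s < t \<and> {s..t} \<subseteq> U \<and> P s t"
proof -
  define K where "K = {(s, t). s < t \<and> {s..t} \<subseteq> U \<and> P s t}"
  define c r where "c = (\<lambda>(s, t). (s + t) / 2 :: real)" and "r = (\<lambda>(s, t). (t - s) / 2 :: real)"
  have ball: "cball (c i) (r i) = (case i of (s, t) \<Rightarrow> {s..t})" for i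
    by (auto simp: cball_eq_atLeastAtMost c_def r_def field_simps split: prod.splits)
  obtain C where C: "countable C" "C \<subseteq> K"
     "pairwise (\<lambda>i j. disjnt (cball (c i) (r i)) (cball (c j) (r j))) C"
     "negligible (E - (\<Union>i \<in> C. cball (c i) (r i)))"
  proof (rule Vitali_covering_theorem_cballs[of K r E c])
    fix i assume "i \<in> K" then show "0 < r i" by (auto simp: K_def r_def)
  next
    fix x d :: real assume x: "x \<in> E" "0 < d"
    obtain e where e: "0 < e" "ball x e \<subseteq> U" using x U by (meson open_contains_ball subsetD)
    obtain s t where st: "s < t" "x \<in> {s..t}" "t - s < min d e" "P s t"
      using fine[OF x(1), of "min d e"] x e by auto
    have "{s..t} \<subseteq> ball x e"
      using st by (auto simp: ball_eq_greaterThanLessThan)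
    then have "(s, t) \<in> K" unfolding K_def using st e by auto
    moreover have "r (s, t) < d" using st x by (auto simp: r_def)
    ultimately show "\<exists>i. i \<in> K \<and> x \<in> cball (c i) (r i) \<and> r i < d"
      using st by (intro exI[of _ "(s, t)"]) (auto simp: ball)
  qed auto
  show thesis
  proof (rule that)
    show "disjoint_family_on (\<lambda>(s, t). {s..t}) C"
      using C(3) unfolding ball pairwise_def disjnt_def disjoint_family_on_def by blast
  qed (use C in \<open>auto simp: K_def ball\<close>)
qed

text \<open>
  Almost all of \<open>E\<close> is covered by disjoint intervals in which \<open>f\<close> climbs at slope at least \<open>q\<close>, and
  the climbs of disjoint intervals add up to at most the total increment.
\<close>

lemma steep_set_measure_le_increment:
  fixes f :: "real \<Rightarrow> real"
  assumes mono: "mono f" and ab: "a \<le> b" and q: "0 \<le> q"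
    and E: "E \<in> sets borel" "E \<subseteq> {a<..<b}"
    and fine: "\<And>x d. x \<in> E \<Longrightarrow> 0 < d \<Longrightarrow>
        \<exists>s t. s < t \<and> x \<in> {s..t} \<and> t - s < d \<and> q * (t - s) \<le> f t - f s"
  shows "ennreal q * emeasure lborel E \<le> ennreal (f b - f a)"
proof -
  obtain C where C: "countable C" "disjoint_family_on (\<lambda>(s, t). {s..t}) C"
    "negligible (E - (\<Union>(s, t)\<in>C. {s..t}))"
    and CK: "\<And>s t. (s, t) \<in> C \<Longrightarrow> s < t \<and> {s..t} \<subseteq> {a<..<b} \<and> q * (t - s) \<le> f t - f s"
    using Vitali_covering_intervals[of "{a<..<b}" E "\<lambda>s t. q * (t - s) \<le> f t - f s"] E fine by auto
  let ?U = "\<Union>(s, t)\<in>C. {s..t}"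
  have U: "?U \<in> sets borel" using C(1) by (auto intro!: sets.countable_UN')
  have "E - ?U \<in> null_sets lborel"
    using C(3) E U by (simp add: negligible_iff_null_sets null_sets_completion_iff)
  then have "emeasure lborel E \<le> emeasure lborel ?U"
    using U by (intro emeasure_mono_AE) (auto dest!: AE_not_in elim!: eventually_mono)
  also have "\<dots> = (\<integral>\<^sup>+i. emeasure lborel (case i of (s, t) \<Rightarrow> {s..t}) \<partial>count_space C)"
    by (rule emeasure_UN_countable) (use C in auto)
  also have "\<dots> = (\<integral>\<^sup>+(s, t). ennreal (t - s) \<partial>count_space C)"
    by (intro nn_integral_cong) (use CK in \<open>auto simp: less_imp_le\<close>)
  finally have "ennreal q * emeasure lborel E \<le> ennreal q * (\<integral>\<^sup>+(s, t). ennreal (t - s) \<partial>count_space C)"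
    by (intro mult_left_mono) auto
  also have "\<dots> = (\<integral>\<^sup>+(s, t). ennreal (q * (t - s)) \<partial>count_space C)"
    using q CK by (subst nn_integral_cmult[symmetric]) (auto intro!: nn_integral_cong simp: ennreal_mult less_imp_le)
  also have "\<dots> \<le> (\<integral>\<^sup>+(s, t). ennreal (f t - f s) \<partial>count_space C)"
    by (intro nn_integral_mono) (use CK in \<open>auto intro!: ennreal_leI\<close>)
  also have "\<dots> \<le> ennreal (f b - f a)"
    by (rule sum_disjoint_increments_le[OF mono ab C(1,2)]) (use CK in \<open>fastforce simp: subset_iff less_imp_le\<close>)
  finally show ?thesis .
qed

text \<open>
  Cover \<open>E\<close> first by intervals of slope at most \<open>p\<close> whose total length is hardly more than the measure of
  \<open>E\<close>. Inside each of them the part of \<open>E\<close> still consists of points with slopes at least \<open>q\<close>, so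
  its measure is at most \<open>p / q\<close> times the length of the interval. Hence \<open>q m(E) \<le> p m(E)\<close>.
\<close>

lemma null_set_if_slopes_oscillate:
  fixes f :: "real \<Rightarrow> real"
  assumes mono: "mono f" and pq: "0 \<le> p" "p < q"
    and E: "E \<in> sets borel" "bounded E"
    and small: "\<And>x d. x \<in> E \<Longrightarrow> 0 < d \<Longrightarrow>
        \<exists>s t. s < t \<and> x \<in> {s..t} \<and> t - s < d \<and> f t - f s \<le> p * (t - s)"
    and large: "\<And>x d. x \<in> E \<Longrightarrow> 0 < d \<Longrightarrow>
        \<exists>s t. s < t \<and> x \<in> {s..t} \<and> t - s < d \<and> q * (t - s) \<le> f t - f s"
  shows "E \<in> null_sets lborel"
proof -
  have fin: "emeasure lborel E < \<infinity>" using E(2) by (rule emeasure_bounded_finite)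
  have le: "ennreal q * emeasure lborel E \<le> ennreal p * emeasure lborel E + ennreal p * ennreal e" if e: "0 < e" for e
  proof -
    obtain U where U: "open U" "E \<subseteq> U" "emeasure lborel (U - E) < ennreal e"
      using outer_regular_lborel[of E e] E e by auto
    obtain C where C: "countable C" "disjoint_family_on (\<lambda>(s, t). {s..t}) C"
      "negligible (E - (\<Union>(s, t)\<in>C. {s..t}))"
      and CK: "\<And>s t. (s, t) \<in> C \<Longrightarrow> s < t \<and> {s..t} \<subseteq> U \<and> f t - f s \<le> p * (t - s)"
      using Vitali_covering_intervals[of U E "\<lambda>s t. f t - f s \<le> p * (t - s)"] U small by auto
    let ?I = "\<lambda>(s, t). {s<..<t}"
    \<comment> \<open>Open intervals, since the steep intervals around a point of \<open>E\<close> have to fit inside; only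
      countably many endpoints are lost.\<close>
    have sub: "E - (\<Union>i\<in>C. ?I i) \<subseteq> (E - (\<Union>(s, t)\<in>C. {s..t})) \<union> (fst ` C \<union> snd ` C)"
      by (force simp: image_iff)
    have "negligible (fst ` C \<union> snd ` C)" using C(1)
      by (simp add: negligible_iff_null_sets countable_imp_null_set_lborel null_sets_completionI)
    then have "negligible (E - (\<Union>i\<in>C. ?I i))"
      using C(3) sub by (meson negligible_Un negligible_subset)
    moreover have V: "(\<Union>i\<in>C. ?I i) \<in> sets borel" using C(1) by (auto intro!: sets.countable_UN')
    ultimately have N: "E - (\<Union>i\<in>C. ?I i) \<in> null_sets lborel"
      using E by (simp add: negligible_iff_null_sets null_sets_completion_iff)
    have disj': "disjoint_family_on (\<lambda>i. E \<inter> ?I i) C"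
      using C(2) unfolding disjoint_family_on_def by (fastforce split: prod.splits)
    have EI: "E \<inter> ?I i \<in> sets borel" for i using E by (auto split: prod.splits)
    have "emeasure lborel E \<le> emeasure lborel (\<Union>i\<in>C. E \<inter> ?I i)"
      using AE_not_in[OF N] C(1) EI
      by (intro emeasure_mono_AE) (auto intro!: sets.countable_UN' simp del: UN_simps elim!: eventually_mono)
    also have "\<dots> = (\<integral>\<^sup>+i. emeasure lborel (E \<inter> ?I i) \<partial>count_space C)"
      by (rule emeasure_UN_countable) (use C disj' EI in auto)
    finally have "ennreal q * emeasure lborel E \<le> ennreal q * (\<integral>\<^sup>+i. emeasure lborel (E \<inter> ?I i) \<partial>count_space C)"
      by (intro mult_left_mono) auto
    also have "\<dots> = (\<integral>\<^sup>+i. ennreal q * emeasure lborel (E \<inter> ?I i) \<partial>count_space C)"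
      by (subst nn_integral_cmult[symmetric]) auto
    also have "\<dots> \<le> (\<integral>\<^sup>+i. ennreal p * emeasure lborel (case i of (s, t) \<Rightarrow> {s..t}) \<partial>count_space C)"
    proof (intro nn_integral_mono)
      fix i assume "i \<in> space (count_space C)"
      then obtain s t where i: "i = (s, t)" "(s, t) \<in> C" by (cases i) auto
      have "ennreal q * emeasure lborel (E \<inter> {s<..<t}) \<le> ennreal (f t - f s)"
        by (rule steep_set_measure_le_increment[OF mono]) (use CK[OF i(2)] pq E large in auto)
      also have "\<dots> \<le> ennreal (p * (t - s))" using CK[OF i(2)] by (intro ennreal_leI) auto
      also have "\<dots> = ennreal p * emeasure lborel {s..t}"
        using CK[OF i(2)] pq by (simp add: ennreal_mult less_imp_le)
      finally show "ennreal q * emeasure lborel (E \<inter> ?I i) \<le> ennreal p * emeasure lborel (case i of (s, t) \<Rightarrow> {s..t})"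
        by (simp add: i)
    qed
    also have "\<dots> = ennreal p * emeasure lborel (\<Union>(s, t)\<in>C. {s..t})"
      by (subst emeasure_UN_countable) (use C in \<open>auto simp: nn_integral_cmult\<close>)
    also have "\<dots> \<le> ennreal p * emeasure lborel U"
      using CK U by (intro mult_left_mono emeasure_mono) fastforce+
    also have "\<dots> \<le> ennreal p * (emeasure lborel E + emeasure lborel (U - E))"
    proof (intro mult_left_mono)
      have "U = E \<union> (U - E)" using U by auto
      then show "emeasure lborel U \<le> emeasure lborel E + emeasure lborel (U - E)"
        using emeasure_subadditive[of E lborel "U - E"] E U by auto
    qed auto
    also have "\<dots> \<le> ennreal p * (emeasure lborel E + ennreal e)"
      using U by (intro mult_left_mono add_left_mono) auto
    finally show ?thesis by (simp add: distrib_left)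
  qed
  obtain m where m: "emeasure lborel E = ennreal m" "0 \<le> m"
    using fin by (cases "emeasure lborel E") auto
  have *: "q * m \<le> p * m + p * e" if "0 < e" for e
  proof -
    have "ennreal (q * m) \<le> ennreal (p * m + p * e)"
      using le[OF that] m pq that by (simp add: ennreal_mult ennreal_plus)
    then show ?thesis using pq m that by (subst (asm) ennreal_le_iff) auto
  qed
  have "q * m \<le> p * m"
  proof (rule field_le_epsilon)
    fix e :: real assume "0 < e"
    have "p * (e / (p + 1)) \<le> e" using pq \<open>0 < e\<close> by (auto simp: field_simps)
    moreover have "q * m \<le> p * m + p * (e / (p+1))" using *[of "e / (p+1)"] pq \<open>0 < e\<close> by auto
    ultimately show "q * m \<le> p * m + e" by linarith
  qed
  then have "m = 0" using pq m by (auto simp: mult_le_cancel_right)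
  then show ?thesis using m E by auto
qed


text \<open>
  Slopes are first compared over intervals with \<open>x\<close> in the interior, because these conditions
  define Borel sets; continuity allows \<open>x\<close> as an endpoint, as difference quotients require.
\<close>

lemma slope_ge_closed_interval:
  fixes g :: "real \<Rightarrow> real"
  assumes cont: "continuous_on UNIV g"
    and op: "\<And>s t. s < x \<Longrightarrow> x < t \<Longrightarrow> t - s < d \<Longrightarrow> p * (t - s) \<le> g t - g s"
    and st: "s \<le> x" "x \<le> t" "t - s < d"
  shows "p * (t - s) \<le> g t - g s"
proof (rule tendsto_le)
  show "((\<lambda>e. p * ((t + e) - (s - e))) \<longlongrightarrow> p * (t - s)) (at_right 0)"
    by (auto intro!: tendsto_eq_intros)
  have "isCont g y" for y using cont by (simp add: continuous_on_eq_continuous_at)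
  then show "((\<lambda>e. g (t + e) - g (s - e)) \<longlongrightarrow> g t - g s) (at_right 0)"
    by (intro tendsto_diff isCont_tendsto_compose[where g=g]) (auto intro!: tendsto_eq_intros)
  have "eventually (\<lambda>e. e \<in> {0<..<(d - (t - s)) / 2}) (at_right (0::real))"
    using st by (intro eventually_at_right_real) auto
  then show "eventually (\<lambda>e. p * ((t + e) - (s - e)) \<le> g (t + e) - g (s - e)) (at_right 0)"
  proof eventually_elim
    case (elim e)
    then show ?case using st by (intro op) auto
  qed
qed auto

lemma eventually_slope_ge:
  fixes g :: "real \<Rightarrow> real"
  assumes cont: "continuous_on UNIV g" and d: "0 < d"
    and op: "\<And>s t. s < x \<Longrightarrow> x < t \<Longrightarrow> t - s < d \<Longrightarrow> p * (t - s) \<le> g t - g s"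
  shows "eventually (\<lambda>h. p \<le> (g (x + h) - g x) / h) (at 0)"
proof -
  have "p \<le> (g (x + h) - g x) / h" if "h \<noteq> 0" "\<bar>h\<bar> < d" for h
  proof (cases "h > 0")
    case True
    have "p * ((x + h) - x) \<le> g (x + h) - g x"
      by (rule slope_ge_closed_interval[OF cont op, where d=d]) (use True that in auto)
    then show ?thesis using True by (simp add: field_simps)
  next
    case False
    have "p * (x - (x + h)) \<le> g x - g (x + h)"
      by (rule slope_ge_closed_interval[OF cont op, where d=d]) (use False that in auto)
    then show ?thesis using False that by (simp add: field_simps)
  qed
  then show ?thesis unfolding eventually_at using d by (intro exI[of _ d]) (auto simp: dist_real_def)
qed

text \<open>
  If the limit failed to exist, two rationals would fit between the lower and the upper limit.
\<close>

lemma tendsto_if_no_rational_gap: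
  fixes Q :: "'a \<Rightarrow> real"
  assumes F: "F \<noteq> bot" and bdd: "eventually (\<lambda>h. \<bar>Q h\<bar> \<le> K) F"
    and gap: "\<And>p q. p \<in> \<rat> \<Longrightarrow> q \<in> \<rat> \<Longrightarrow> p < q \<Longrightarrow>
        eventually (\<lambda>h. p \<le> Q h) F \<or> eventually (\<lambda>h. Q h \<le> q) F"
  shows "\<exists>D. (Q \<longlongrightarrow> D) F"
proof -
  define P where "P = {p \<in> \<rat>. eventually (\<lambda>h. p \<le> Q h) F}"
  obtain r where r: "r \<in> \<rat>" "r < - K" using Rats_dense_in_real[of "- K - 1" "- K"] by auto
  have "eventually (\<lambda>h. r \<le> Q h) F" using bdd by eventually_elim (use r in auto)
  then have ne: "r \<in> P" using r by (simp add: P_def)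
  have "p \<le> K" if "p \<in> P" for p
  proof -
    have "eventually (\<lambda>h. p \<le> Q h) F" using that by (simp add: P_def)
    then have "eventually (\<lambda>h. p \<le> K) F" using bdd by eventually_elim auto
    then show ?thesis using F by simp
  qed
  then have bd: "bdd_above P" by (rule bdd_aboveI)
  have "(Q \<longlongrightarrow> Sup P) F"
  proof (rule order_tendstoI)
    fix a assume "a < Sup P"
    then obtain p where "p \<in> P" "a < p" using ne by (metis less_cSupE empty_iff)
    then show "eventually (\<lambda>h. a < Q h) F" by (auto simp: P_def elim: eventually_mono)
  next
    fix a assume "Sup P < a"
    then obtain q where q: "q \<in> \<rat>" "Sup P < q" "q < a" using Rats_dense_in_real by blast
    obtain p where p: "p \<in> \<rat>" "Sup P < p" "p < q" using Rats_dense_in_real q by blast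
    have "p \<notin> P" using cSup_upper[OF _ bd, of p] p by auto
    then have "eventually (\<lambda>h. Q h \<le> q) F" using gap[OF p(1) q(1)] p by (auto simp: P_def)
    then show "eventually (\<lambda>h. Q h < a) F" using q by (auto elim: eventually_mono)
  qed
  then show ?thesis by auto
qed

lemma sets_small_intervals:
  "{x::real. \<forall>d>0. \<exists>s t. s < x \<and> x < t \<and> t - s < d \<and> P s t} \<in> sets borel"
proof -
  have "{x. \<forall>d>0. \<exists>s t. s < x \<and> x < t \<and> t - s < d \<and> P s t} =
      (\<Inter>n::nat. \<Union>(s, t)\<in>{(s, t). t - s < 1 / real (Suc n) \<and> P s t}. {s<..<t})" (is "?A = ?B")
  proof (intro set_eqI iffI)
    fix x assume x: "x \<in> ?B"
    show "x \<in> ?A"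
    proof (clarify)
      fix d :: real assume "0 < d"
      then obtain n where n: "1 / real (Suc n) < d" by (rule nat_approx_posE)
      obtain s t where "t - s < 1 / real (Suc n)" "P s t" "s < x" "x < t"
        using INT_D[OF x, of n] by auto
      then show "\<exists>s t. s < x \<and> x < t \<and> t - s < d \<and> P s t" using n
        by (intro exI[of _ s] exI[of _ t]) auto
    qed
  next
    fix x assume x: "x \<in> ?A"
    show "x \<in> ?B"
    proof
      fix n :: nat
      have "0 < 1 / real (Suc n)" by simp
      then obtain s t where "s < x" "x < t" "t - s < 1 / real (Suc n)" "P s t" using x by blast
      then show "x \<in> (\<Union>(s, t)\<in>{(s, t). t - s < 1 / real (Suc n) \<and> P s t}. {s<..<t})" by auto
    qed
  qed
  also have "\<dots> \<in> sets borel"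
    by (intro sets.countable_INT'' borel_open open_UN) auto
  finally show ?thesis .
qed

text \<open>
  Adding \<open>L x\<close> makes \<open>f\<close> monotone. A point at which the new function is not differentiable lies, for some rationals
  \<open>p < q\<close>, in arbitrarily short intervals of slope below \<open>p\<close> and in others of slope above \<open>q\<close>.
\<close>

theorem lipschitz_AE_differentiable:
  fixes f :: "real \<Rightarrow> real"
  assumes lip: "L-lipschitz_on UNIV f"
  shows "AE x in lborel. \<exists>D. (f has_field_derivative D) (at x)"
proof -
  define g where "g x = f x + L * x" for x
  have L: "0 \<le> L" using lip by (rule lipschitz_on_nonneg)
  have fl: "\<bar>f t - f s\<bar> \<le> L * \<bar>t - s\<bar>" for s t
    using lipschitz_onD[OF lip, of t s] by (simp add: dist_real_def)
  have slope: "0 \<le> g t - g s \<and> g t - g s \<le> 2 * L * (t - s)" if "s \<le> t" for s t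
    using fl[of t s] that by (auto simp: g_def algebra_simps abs_le_iff)
  have mono: "mono g" using slope by (auto intro!: monoI)
  have cont: "continuous_on UNIV g"
    unfolding g_def using lipschitz_on_continuous_on[OF lip] by (auto intro!: continuous_intros)
  define Lo where "Lo p = {x. \<forall>d>0. \<exists>s t. s < x \<and> x < t \<and> t - s < d \<and> g t - g s < p * (t - s)}" for p
  define Hi where "Hi q = {x. \<forall>d>0. \<exists>s t. s < x \<and> x < t \<and> t - s < d \<and> q * (t - s) < g t - g s}" for q
  have null: "Lo p \<inter> Hi q \<inter> {-real k..real k} \<in> null_sets lborel" if "0 \<le> p" "p < q" for p q k
  proof (rule null_set_if_slopes_oscillate[OF mono that])
    show "Lo p \<inter> Hi q \<inter> {-real k..real k} \<in> sets borel"
      unfolding Lo_def Hi_def by (intro sets.Int sets_small_intervals) auto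
    show "bounded (Lo p \<inter> Hi q \<inter> {-real k..real k})" by (meson bounded_closed_interval bounded_subset inf_le2)
    fix x d :: real assume x: "x \<in> Lo p \<inter> Hi q \<inter> {-real k..real k}" "0 < d"
    show "\<exists>s t. s < t \<and> x \<in> {s..t} \<and> t - s < d \<and> g t - g s \<le> p * (t - s)"
    proof -
      obtain s t where "s < x" "x < t" "t - s < d" "g t - g s < p * (t - s)"
        using x unfolding Lo_def by blast
      then show ?thesis by (intro exI[of _ s] exI[of _ t]) auto
    qed
    show "\<exists>s t. s < t \<and> x \<in> {s..t} \<and> t - s < d \<and> q * (t - s) \<le> g t - g s"
    proof -
      obtain s t where "s < x" "x < t" "t - s < d" "q * (t - s) < g t - g s"
        using x unfolding Hi_def by blast
      then show ?thesis by (intro exI[of _ s] exI[of _ t]) auto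
    qed
  qed
  have "AE x in lborel. \<forall>k. \<forall>p\<in>\<rat>. \<forall>q\<in>\<rat>. 0 \<le> p \<longrightarrow> p < q \<longrightarrow> x \<notin> Lo p \<inter> Hi q \<inter> {-real k..real k}"
    unfolding AE_all_countable
    by (intro allI AE_ball_countable' ballI countable_rat AE_impI AE_not_in null)
  then show ?thesis
  proof eventually_elim
    case (elim x)
    obtain k where "\<bar>x\<bar> \<le> real k" using real_arch_simple by blast
    then have k: "x \<in> {-real k..real k}" by auto
    have "\<exists>D. ((\<lambda>h. (g (x + h) - g x) / h) \<longlongrightarrow> D) (at 0)"
    proof (rule tendsto_if_no_rational_gap)
      have Q: "0 \<le> (g (x + h) - g x) / h \<and> (g (x + h) - g x) / h \<le> 2 * L" if "h \<noteq> 0" for h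
        using slope[of x "x + h"] slope[of "x + h" x] that by (cases "h > 0") (auto simp: field_simps)
      have "\<bar>(g (x + h) - g x) / h\<bar> \<le> 2 * L" if "h \<noteq> 0" for h using Q[OF that] by linarith
      then show "eventually (\<lambda>h. \<bar>(g (x + h) - g x) / h\<bar> \<le> 2 * L) (at 0)"
        using eventually_neq_at_within[of 0] by (rule eventually_mono[rotated])
      fix p q :: real assume pq: "p \<in> \<rat>" "q \<in> \<rat>" "p < q"
      then consider "p < 0" | "x \<notin> Lo p" | "x \<notin> Hi q" using elim k by force
      then show "eventually (\<lambda>h. p \<le> (g (x + h) - g x) / h) (at 0) \<or> eventually (\<lambda>h. (g (x + h) - g x) / h \<le> q) (at 0)"
      proof cases
        case 1
        then have "p \<le> (g (x + h) - g x) / h" if "h \<noteq> 0" for h using Q[OF that] by linarith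
        then show ?thesis by (auto simp: eventually_at intro!: exI[of _ 1])
      next
        case 2
        then obtain d where "0 < d" "\<And>s t. s < x \<Longrightarrow> x < t \<Longrightarrow> t - s < d \<Longrightarrow> p * (t - s) \<le> g t - g s"
          unfolding Lo_def mem_Collect_eq by (meson not_less)
        then show ?thesis using eventually_slope_ge[OF cont] by blast
      next
        case 3
        then obtain d where d: "0 < d" "\<And>s t. s < x \<Longrightarrow> x < t \<Longrightarrow> t - s < d \<Longrightarrow> g t - g s \<le> q * (t - s)"
          unfolding Hi_def mem_Collect_eq by (meson not_less)
        have "eventually (\<lambda>h. - q \<le> (- g (x + h) - (- g x)) / h) (at 0)"
        proof (rule eventually_slope_ge[OF _ d(1)])
          show "continuous_on UNIV (\<lambda>x. - g x)" using cont by (intro continuous_intros)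
          show "- q * (t - s) \<le> - g t - - g s" if "s < x" "x < t" "t - s < d" for s t
            using d(2)[OF that] by auto
        qed
        moreover have "(- g (x + h) - (- g x)) / h = - ((g (x + h) - g x) / h)" for h
          by (simp add: diff_divide_distrib)
        ultimately show ?thesis by (auto elim: eventually_mono)
      qed
    qed simp
    then obtain D where D: "(g has_field_derivative D) (at x)" by (auto simp: DERIV_def)
    have "((\<lambda>x. g x - L * x) has_field_derivative D - L) (at x)"
      by (auto intro!: derivative_eq_intros D)
    then show ?case by (auto simp: g_def)
  qed
qed

section \<open>Directional derivatives of Lipschitz functions\<close>

text \<open>
  A form of differentiability that shows measurability: only countably many operations are applied
  to sets that are closed when \<open>f\<close> depends continuously on a parameter.
\<close>

lemma differentiable_at_0_iff_no_rational_gap: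
  fixes f :: "real \<Rightarrow> real"
  assumes bdd: "\<And>h. \<bar>f h - f 0\<bar> \<le> K * \<bar>h\<bar>"
  shows "(\<exists>D. (f has_field_derivative D) (at 0)) \<longleftrightarrow>
    (\<forall>p\<in>\<rat>. \<forall>q\<in>\<rat>. p < q \<longrightarrow>
      (\<exists>n::nat. \<forall>h. h \<noteq> 0 \<and> \<bar>h\<bar> < 1 / real (Suc n) \<longrightarrow> p \<le> (f h - f 0) / h) \<or>
      (\<exists>n::nat. \<forall>h. h \<noteq> 0 \<and> \<bar>h\<bar> < 1 / real (Suc n) \<longrightarrow> (f h - f 0) / h \<le> q))"
proof -
  define Q where "Q h = (f h - f 0) / h" for h
  have ev: "eventually P (at 0) \<longleftrightarrow> (\<exists>n::nat. \<forall>h. h \<noteq> 0 \<and> \<bar>h\<bar> < 1 / real (Suc n) \<longrightarrow> P h)" for P :: "real \<Rightarrow> bool"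
  proof
    assume "eventually P (at 0)"
    then obtain d where d: "0 < d" "\<And>h. h \<noteq> 0 \<Longrightarrow> \<bar>h\<bar> < d \<Longrightarrow> P h"
      by (auto simp: eventually_at dist_real_def)
    obtain n where n: "1 / real (Suc n) < d" using d(1) by (rule nat_approx_posE)
    then show "\<exists>n::nat. \<forall>h. h \<noteq> 0 \<and> \<bar>h\<bar> < 1 / real (Suc n) \<longrightarrow> P h"
      using d(2) by (intro exI[of _ n]) auto
  next
    assume "\<exists>n::nat. \<forall>h. h \<noteq> 0 \<and> \<bar>h\<bar> < 1 / real (Suc n) \<longrightarrow> P h"
    then obtain n :: nat where n: "\<And>h. h \<noteq> 0 \<Longrightarrow> \<bar>h\<bar> < 1 / real (Suc n) \<Longrightarrow> P h" by blast
    show "eventually P (at 0)"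
      unfolding eventually_at by (intro exI[of _ "1 / real (Suc n)"]) (auto simp: dist_real_def intro!: n)
  qed
  have "(\<exists>D. (Q \<longlongrightarrow> D) (at 0)) \<longleftrightarrow> (\<forall>p\<in>\<rat>. \<forall>q\<in>\<rat>. p < q \<longrightarrow>
      eventually (\<lambda>h. p \<le> Q h) (at 0) \<or> eventually (\<lambda>h. Q h \<le> q) (at 0))" (is "?l \<longleftrightarrow> ?r")
  proof
    assume ?l
    then obtain D where D: "(Q \<longlongrightarrow> D) (at 0)" by auto
    show ?r
    proof (intro ballI impI)
      fix p q :: real assume "p < q"
      show "eventually (\<lambda>h. p \<le> Q h) (at 0) \<or> eventually (\<lambda>h. Q h \<le> q) (at 0)"
      proof (cases "p < D")
        case True
        then show ?thesis using order_tendstoD(1)[OF D True] by (auto elim: eventually_mono)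
      next
        case False
        then have "D < q" using \<open>p < q\<close> by auto
        then have "eventually (\<lambda>h. Q h \<le> q) (at 0)"
          by (rule eventually_mono[OF order_tendstoD(2)[OF D]]) simp
        then show ?thesis ..
      qed
    qed
  next
    assume ?r
    have "\<bar>Q h\<bar> \<le> K" if "h \<noteq> 0" for h
      using bdd[of h] that by (auto simp: Q_def abs_divide field_simps)
    then have "eventually (\<lambda>h. \<bar>Q h\<bar> \<le> K) (at 0)" by (auto simp: eventually_at intro!: exI[of _ 1])
    then show ?l using \<open>?r\<close> by (intro tendsto_if_no_rational_gap[of _ Q K]) auto
  qed
  moreover have "(f has_field_derivative D) (at 0) \<longleftrightarrow> (Q \<longlongrightarrow> D) (at 0)" for D
    by (simp add: DERIV_def Q_def[abs_def])
  ultimately show ?thesis unfolding ev Q_def by simp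
qed

lemma lipschitz_along_line:
  fixes F :: "'a::euclidean_space \<Rightarrow> real"
  assumes "L-lipschitz_on UNIV F"
  shows "(L * norm e)-lipschitz_on UNIV (\<lambda>t. F (x + t *\<^sub>R e))"
proof (rule lipschitz_onI)
  fix s t :: real
  have "dist (F (x + s *\<^sub>R e)) (F (x + t *\<^sub>R e)) \<le> L * dist (x + s *\<^sub>R e) (x + t *\<^sub>R e)"
    using assms by (rule lipschitz_onD) auto
  also have "dist (x + s *\<^sub>R e) (x + t *\<^sub>R e) = \<bar>s - t\<bar> * norm e"
    by (simp add: dist_norm flip: scaleR_diff_left)
  finally show "dist (F (x + s *\<^sub>R e)) (F (x + t *\<^sub>R e)) \<le> L * norm e * dist s t"
    by (simp add: dist_real_def mult_ac)
qed (use lipschitz_on_nonneg[OF assms] in simp)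

lemma sets_directionally_differentiable:
  fixes F :: "'a::euclidean_space \<Rightarrow> real"
  assumes lip: "L-lipschitz_on UNIV F"
  shows "{x. \<exists>D. ((\<lambda>t. F (x + t *\<^sub>R e)) has_field_derivative D) (at 0)} \<in> sets borel"
proof -
  define Q where "Q x h = (F (x + h *\<^sub>R e) - F x) / h" for x h
  have cont: "continuous_on UNIV F" using lip by (rule lipschitz_on_continuous_on)
  have contQ: "continuous_on UNIV (\<lambda>x. Q x h)" for h
    unfolding Q_def by (cases "h = 0") (auto intro!: continuous_intros continuous_on_compose2[OF cont])
  have 1: "closed (\<Inter>h\<in>{h. h \<noteq> 0 \<and> \<bar>h\<bar> < d}. {x. p \<le> Q x h})" for p d
    by (intro closed_INT ballI closed_Collect_le contQ continuous_on_const)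
  have 2: "closed (\<Inter>h\<in>{h. h \<noteq> 0 \<and> \<bar>h\<bar> < d}. {x. Q x h \<le> q})" for q d
    by (intro closed_INT ballI closed_Collect_le contQ continuous_on_const)
  have "\<bar>F (x + h *\<^sub>R e) - F (x + 0 *\<^sub>R e)\<bar> \<le> (L * norm e) * \<bar>h\<bar>" for x h
    using lipschitz_onD[OF lipschitz_along_line[OF lip, of e x], of h 0] by (simp add: dist_real_def)
  then have iff: "(\<exists>D. ((\<lambda>t. F (x + t *\<^sub>R e)) has_field_derivative D) (at 0)) \<longleftrightarrow>
    (\<forall>p\<in>\<rat>. \<forall>q\<in>\<rat>. p < q \<longrightarrow>
      (\<exists>n::nat. \<forall>h. h \<noteq> 0 \<and> \<bar>h\<bar> < 1 / real (Suc n) \<longrightarrow> p \<le> Q x h) \<or>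
      (\<exists>n::nat. \<forall>h. h \<noteq> 0 \<and> \<bar>h\<bar> < 1 / real (Suc n) \<longrightarrow> Q x h \<le> q))" for x
    using differentiable_at_0_iff_no_rational_gap[of "\<lambda>t. F (x + t *\<^sub>R e)" "L * norm e"]
    by (simp add: Q_def)
  have "{x. \<exists>D. ((\<lambda>t. F (x + t *\<^sub>R e)) has_field_derivative D) (at 0)} =
    (\<Inter>p\<in>\<rat>. \<Inter>q\<in>{q\<in>\<rat>. p < q}.
      (\<Union>n::nat. \<Inter>h\<in>{h. h \<noteq> 0 \<and> \<bar>h\<bar> < 1 / real (Suc n)}. {x. p \<le> Q x h}) \<union>
      (\<Union>n::nat. \<Inter>h\<in>{h. h \<noteq> 0 \<and> \<bar>h\<bar> < 1 / real (Suc n)}. {x. Q x h \<le> q}))"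
    unfolding iff
    by (simp only: set_eq_iff INT_iff UN_iff Un_iff mem_Collect_eq Ball_def Bex_def UNIV_I simp_thms imp_conjL)
  also have "\<dots> \<in> sets borel"
  proof (intro sets.countable_INT')
    show "countable (\<rat>::real set)" "\<rat> \<noteq> ({}::real set)" by (auto simp: countable_rat)
    have "(\<Inter>q\<in>{q\<in>\<rat>. p < q}.
      (\<Union>n::nat. \<Inter>h\<in>{h. h \<noteq> 0 \<and> \<bar>h\<bar> < 1 / real (Suc n)}. {x. p \<le> Q x h}) \<union>
      (\<Union>n::nat. \<Inter>h\<in>{h. h \<noteq> 0 \<and> \<bar>h\<bar> < 1 / real (Suc n)}. {x. Q x h \<le> q})) \<in> sets borel" for p
    proof (intro sets.countable_INT')
      show "countable {q\<in>\<rat>. p < q}" by (rule countable_subset[OF _ countable_rat]) auto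
      show "{q\<in>\<rat>. p < q} \<noteq> {}" using Rats_dense_in_real[of p "p + 1"] by auto
      have "(\<Union>n::nat. \<Inter>h\<in>{h. h \<noteq> 0 \<and> \<bar>h\<bar> < 1 / real (Suc n)}. {x. p \<le> Q x h}) \<union>
        (\<Union>n::nat. \<Inter>h\<in>{h. h \<noteq> 0 \<and> \<bar>h\<bar> < 1 / real (Suc n)}. {x. Q x h \<le> q}) \<in> sets borel" for q
        by (intro sets.Un sets.countable_UN'' borel_closed 1 2) auto
      then show "(\<lambda>q. (\<Union>n::nat. \<Inter>h\<in>{h. h \<noteq> 0 \<and> \<bar>h\<bar> < 1 / real (Suc n)}. {x. p \<le> Q x h}) \<union>
        (\<Union>n::nat. \<Inter>h\<in>{h. h \<noteq> 0 \<and> \<bar>h\<bar> < 1 / real (Suc n)}. {x. Q x h \<le> q})) ` {q\<in>\<rat>. p < q} \<subseteq> sets borel"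
        by blast
    qed
    then show "(\<lambda>p. \<Inter>q\<in>{q\<in>\<rat>. p < q}.
      (\<Union>n::nat. \<Inter>h\<in>{h. h \<noteq> 0 \<and> \<bar>h\<bar> < 1 / real (Suc n)}. {x. p \<le> Q x h}) \<union>
      (\<Union>n::nat. \<Inter>h\<in>{h. h \<noteq> 0 \<and> \<bar>h\<bar> < 1 / real (Suc n)}. {x. Q x h \<le> q})) ` \<rat> \<subseteq> sets borel"
      by blast
  qed
  finally show ?thesis .
qed

text \<open>
  Integrating \<open>1\<^sub>N (x + t e)\<close> over \<open>x\<close> in the whole space and \<open>t\<close> in the unit interval gives the measure of
  \<open>N\<close> by translation invariance, and \<open>0\<close> in the other order. This avoids splitting off a coordinate.
\<close>

lemma null_set_if_null_on_parallel_lines: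
  fixes N :: "'a::euclidean_space set"
  assumes N: "N \<in> sets borel" and lines: "\<And>x. AE t in lborel. x + t *\<^sub>R e \<notin> N"
  shows "N \<in> null_sets lborel"
proof -
  have meas: "(\<lambda>(x, t). indicator {0..1::real} t * indicator N (x + t *\<^sub>R e) :: ennreal) \<in> borel_measurable (lborel \<Otimes>\<^sub>M lborel)"
    using N by measurable
  have tr: "(\<integral>\<^sup>+x. indicator N (x + c) \<partial>lborel) = emeasure lborel N" for c
  proof -
    have "emeasure lborel N = (\<integral>\<^sup>+x. indicator N x \<partial>distr lborel borel ((+) c))"
      using N by (simp add: lborel_distr_plus)
    also have "\<dots> = (\<integral>\<^sup>+x. indicator N (c + x) \<partial>lborel)"
      using N by (subst nn_integral_distr) auto
    finally show ?thesis by (simp add: add.commute)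
  qed
  have "emeasure lborel N = (\<integral>\<^sup>+t. indicator {0..1::real} t * emeasure lborel N \<partial>lborel)"
    by (simp add: nn_integral_multc)
  also have "\<dots> = (\<integral>\<^sup>+t. (\<integral>\<^sup>+x. indicator {0..1::real} t * indicator N (x + t *\<^sub>R e) \<partial>lborel) \<partial>lborel)"
    using N by (subst nn_integral_cmult) (auto simp: tr)
  also have "\<dots> = (\<integral>\<^sup>+x. (\<integral>\<^sup>+t. indicator {0..1::real} t * indicator N (x + t *\<^sub>R e) \<partial>lborel) \<partial>lborel)"
    by (rule lborel_pair.Fubini'[OF meas])
  also have "\<dots> = (\<integral>\<^sup>+x. 0 \<partial>(lborel :: 'a measure))"
  proof (rule nn_integral_cong)
    fix x :: 'a
    have "(\<integral>\<^sup>+t. indicator {0..1::real} t * indicator N (x + t *\<^sub>R e) \<partial>lborel) = (\<integral>\<^sup>+t. 0 \<partial>(lborel :: real measure))"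
      using lines[of x] by (intro nn_integral_cong_AE) (auto elim!: eventually_mono)
    then show "(\<integral>\<^sup>+t. indicator {0..1::real} t * indicator N (x + t *\<^sub>R e) \<partial>lborel) = 0" by simp
  qed
  finally show ?thesis using N by auto
qed

theorem lipschitz_AE_directionally_differentiable:
  fixes F :: "'a::euclidean_space \<Rightarrow> real"
  assumes lip: "L-lipschitz_on UNIV F"
  shows "AE x in lborel. \<exists>D. ((\<lambda>t. F (x + t *\<^sub>R e)) has_field_derivative D) (at 0)"
proof -
  let ?G = "{x. \<exists>D. ((\<lambda>t. F (x + t *\<^sub>R e)) has_field_derivative D) (at 0)}"
  have "- ?G \<in> null_sets lborel"
  proof (rule null_set_if_null_on_parallel_lines[where e=e])
    show "- ?G \<in> sets borel" using sets_directionally_differentiable[OF lip] by (rule borel_comp)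
    fix x
    have "AE t in lborel. \<exists>D. ((\<lambda>t. F (x + t *\<^sub>R e)) has_field_derivative D) (at t)"
      by (rule lipschitz_AE_differentiable[OF lipschitz_along_line[OF lip]])
    then show "AE t in lborel. x + t *\<^sub>R e \<notin> - ?G"
    proof eventually_elim
      case (elim t)
      then obtain D where "((\<lambda>t. F (x + t *\<^sub>R e)) has_field_derivative D) (at (t + 0))" by auto
      then have "((\<lambda>s. F (x + (t + s) *\<^sub>R e)) has_field_derivative D) (at 0)"
        by (subst (asm) add.commute, subst (asm) DERIV_shift) (simp add: add.commute)
      then show ?case by (auto simp: scaleR_add_left add.assoc)
    qed
  qed
  then show ?thesis using AE_not_in by fastforce
qed

lemma directional_deriv_tendsto:
  fixes F :: "'a::euclidean_space \<Rightarrow> real"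
  assumes "\<exists>D. ((\<lambda>t. F (x + t *\<^sub>R e)) has_field_derivative D) (at 0)"
  shows "(\<lambda>n. real (Suc n) * (F (x + (1 / real (Suc n)) *\<^sub>R e) - F x)) \<longlonglongrightarrow> deriv (\<lambda>t. F (x + t *\<^sub>R e)) 0"
proof -
  have "((\<lambda>t. F (x + t *\<^sub>R e)) has_field_derivative deriv (\<lambda>t. F (x + t *\<^sub>R e)) 0) (at 0)"
    using assms DERIV_imp_deriv by metis
  then have "((\<lambda>h. (F (x + h *\<^sub>R e) - F x) / h) \<longlongrightarrow> deriv (\<lambda>t. F (x + t *\<^sub>R e)) 0) (at 0)"
    by (simp add: DERIV_def)
  moreover have "filterlim (\<lambda>n. 1 / real (Suc n)) (at 0) sequentially"
    using LIMSEQ_Suc[OF lim_1_over_n] by (auto simp: filterlim_at)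
  ultimately have "(\<lambda>n. (F (x + (1 / real (Suc n)) *\<^sub>R e) - F x) / (1 / real (Suc n))) \<longlonglongrightarrow> deriv (\<lambda>t. F (x + t *\<^sub>R e)) 0"
    by (rule filterlim_compose)
  then show ?thesis by (simp add: mult.commute)
qed

text \<open>
  Where the derivative does not exist, \<open>deriv\<close> has one fixed value, so the function is
  measurable everywhere and not only up to a null set.
\<close>

lemma borel_measurable_directional_deriv:
  fixes F :: "'a::euclidean_space \<Rightarrow> real"
  assumes lip: "L-lipschitz_on UNIV F"
  shows "(\<lambda>x. deriv (\<lambda>t. F (x + t *\<^sub>R e)) 0) \<in> borel_measurable borel"
proof -
  let ?G = "{x. \<exists>D. ((\<lambda>t. F (x + t *\<^sub>R e)) has_field_derivative D) (at 0)}"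
  let ?D = "\<lambda>x. deriv (\<lambda>t. F (x + t *\<^sub>R e)) 0"
  have G: "?G \<in> sets borel" using lip by (rule sets_directionally_differentiable)
  have cont: "continuous_on UNIV F" using lip by (rule lipschitz_on_continuous_on)
  have q: "(\<lambda>x. real (Suc n) * (F (x + (1 / real (Suc n)) *\<^sub>R e) - F x)) \<in> borel_measurable borel" for n
    by (intro borel_measurable_continuous_onI continuous_intros continuous_on_compose2[OF cont]) auto
  have "?D x = (if x \<in> ?G then ?D x else (SOME D. False))" for x
    by (auto simp: deriv_def)
  moreover have "(\<lambda>x. if x \<in> ?G then ?D x else (SOME D. False)) \<in> borel_measurable borel"
  proof (rule borel_measurable_LIMSEQ_real)
    fix x
    show "(\<lambda>n. if x \<in> ?G then real (Suc n) * (F (x + (1 / real (Suc n)) *\<^sub>R e) - F x) else (SOME D. False))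
      \<longlonglongrightarrow> (if x \<in> ?G then ?D x else (SOME D. False))"
      using directional_deriv_tendsto[of F x e] by (cases "x \<in> ?G") auto
  next
    fix n
    show "(\<lambda>x. if x \<in> ?G then real (Suc n) * (F (x + (1 / real (Suc n)) *\<^sub>R e) - F x) else (SOME D. False)) \<in> borel_measurable borel"
      using q[of n] G by (intro measurable_If) auto
  qed
  ultimately show ?thesis by (simp cong: measurable_cong)
qed

lemma difference_quotient_bound:
  fixes F :: "'a::euclidean_space \<Rightarrow> real"
  assumes lip: "L-lipschitz_on UNIV F"
  shows "\<bar>real (Suc n) * (F (x + (1 / real (Suc n)) *\<^sub>R e) - F x)\<bar> \<le> L * norm e"
proof -
  have "\<bar>F (x + (1 / real (Suc n)) *\<^sub>R e) - F x\<bar> \<le> L * norm e * (1 / real (Suc n))"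
    using lipschitz_onD[OF lipschitz_along_line[OF lip, of e x], of "1 / real (Suc n)" 0]
    by (simp add: dist_real_def del: of_nat_Suc)
  then have "real (Suc n) * \<bar>F (x + (1 / real (Suc n)) *\<^sub>R e) - F x\<bar> \<le> L * norm e"
    by (simp add: field_simps del: of_nat_Suc)
  then show ?thesis unfolding abs_mult by simp
qed

lemma directional_deriv_bound:
  fixes F :: "'a::euclidean_space \<Rightarrow> real"
  assumes lip: "L-lipschitz_on UNIV F"
    and D: "\<exists>D. ((\<lambda>t. F (x + t *\<^sub>R e)) has_field_derivative D) (at 0)"
  shows "\<bar>deriv (\<lambda>t. F (x + t *\<^sub>R e)) 0\<bar> \<le> L * norm e"
proof (rule tendsto_upperbound[OF tendsto_rabs[OF directional_deriv_tendsto[OF D]]])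
  show "\<forall>\<^sub>F n in sequentially. \<bar>real (Suc n) * (F (x + (1 / real (Suc n)) *\<^sub>R e) - F x)\<bar> \<le> L * norm e"
    using difference_quotient_bound[OF lip] by (intro always_eventually allI)
qed simp

text \<open>
  Each difference quotient has integral zero by translation invariance, and the quotients are
  dominated by a multiple of the indicator of a ball.
\<close>

theorem integral_directional_deriv_eq_0:
  fixes F :: "'a::euclidean_space \<Rightarrow> real"
  assumes lip: "L-lipschitz_on UNIV F" and supp: "bounded {x. F x \<noteq> 0}"
  shows "(\<integral>x. deriv (\<lambda>t. F (x + t *\<^sub>R e)) 0 \<partial>lborel) = 0"
proof -
  obtain R where R: "\<And>x. F x \<noteq> 0 \<Longrightarrow> norm x \<le> R" using supp by (auto simp: bounded_iff)
  have cont: "continuous_on UNIV F" using lip by (rule lipschitz_on_continuous_on)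
  have L: "0 \<le> L" using lip by (rule lipschitz_on_nonneg)
  have "F \<in> borel_measurable borel" using cont by (rule borel_measurable_continuous_onI)
  have "bounded (F ` cball 0 R)"
    by (intro compact_imp_bounded compact_continuous_image continuous_on_subset[OF cont]) auto
  then obtain M where M: "\<And>x. x \<in> cball 0 R \<Longrightarrow> \<bar>F x\<bar> \<le> M" unfolding bounded_iff by fastforce
  have intF: "integrable lborel F"
  proof (rule Bochner_Integration.integrable_bound)
    show "integrable lborel (\<lambda>x. M * indicator (cball 0 R) x :: real)"
      by (intro integrable_mult_right integrable_real_indicator emeasure_bounded_finite) auto
    show "AE x in lborel. norm (F x) \<le> norm (M * indicator (cball 0 R) x :: real)"
      using M R by (intro AE_I2) (fastforce simp: indicator_def)
  qed (use \<open>F \<in> borel_measurable borel\<close> in simp)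
  have shift: "integrable lborel (\<lambda>x. F (x + c))" "(\<integral>x. F (x + c) \<partial>lborel) = (\<integral>x. F x \<partial>lborel)" for c
  proof -
    have d: "distr lborel borel (\<lambda>x. x + c) = lborel"
      using lborel_distr_plus[of c] by (simp add: add.commute[of _ c] fun_eq_iff)
    show "integrable lborel (\<lambda>x. F (x + c))"
      using integrable_distr[of "\<lambda>x. x + c" lborel borel F] intF by (simp add: d)
    show "(\<integral>x. F (x + c) \<partial>lborel) = (\<integral>x. F x \<partial>lborel)"
      using integral_distr[of "\<lambda>x. x + c" lborel borel F] \<open>F \<in> borel_measurable borel\<close> by (simp add: d)
  qed
  let ?q = "\<lambda>n x. real (Suc n) * (F (x + (1 / real (Suc n)) *\<^sub>R e) - F x)"
  have "(\<lambda>n. \<integral>x. ?q n x \<partial>lborel) \<longlonglongrightarrow> (\<integral>x. deriv (\<lambda>t. F (x + t *\<^sub>R e)) 0 \<partial>lborel)"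
  proof (rule integral_dominated_convergence)
    show "(\<lambda>x. deriv (\<lambda>t. F (x + t *\<^sub>R e)) 0) \<in> borel_measurable lborel"
      using borel_measurable_directional_deriv[OF lip] by simp
    show "?q n \<in> borel_measurable lborel" for n
      using shift(1) intF by (intro borel_measurable_times borel_measurable_diff) auto
    show "integrable lborel (\<lambda>x. L * norm e * indicator (cball 0 (R + norm e)) x :: real)"
      by (intro integrable_mult_right integrable_real_indicator emeasure_bounded_finite) auto
    show "AE x in lborel. (\<lambda>n. ?q n x) \<longlonglongrightarrow> deriv (\<lambda>t. F (x + t *\<^sub>R e)) 0"
      using lipschitz_AE_directionally_differentiable[OF lip, of e]
      by eventually_elim (rule directional_deriv_tendsto)
    show "AE x in lborel. norm (?q n x) \<le> L * norm e * indicator (cball 0 (R + norm e)) x" for n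
    proof (rule AE_I2)
      fix x :: 'a
      have *: "\<bar>?q n x\<bar> \<le> L * norm e"
        by (rule difference_quotient_bound[OF lip])
      show "norm (?q n x) \<le> L * norm e * indicator (cball 0 (R + norm e)) x"
      proof (cases "x \<in> cball 0 (R + norm e)")
        case True then show ?thesis using * by simp
      next
        case False
        have "norm ((1 / real (Suc n)) *\<^sub>R e) \<le> norm e"
          by (simp add: divide_le_eq mult_left_le field_simps)
        moreover have "norm x \<le> norm (x + (1 / real (Suc n)) *\<^sub>R e) + norm ((1 / real (Suc n)) *\<^sub>R e)"
          by (metis add_diff_cancel_right' norm_triangle_ineq4)
        moreover have "R + norm e < norm x" using False by simp
        ultimately have "R < norm (x + (1 / real (Suc n)) *\<^sub>R e)" by linarith
        moreover have "R < norm x" using \<open>R + norm e < norm x\<close> norm_ge_zero[of e] by linarith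
        ultimately have "F x = 0" "F (x + (1 / real (Suc n)) *\<^sub>R e) = 0" using R by (meson not_le)+
        then show ?thesis using False by (simp del: of_nat_Suc)
      qed
    qed
  qed
  moreover have "(\<integral>x. ?q n x \<partial>lborel) = 0" for n
    using shift intF by (simp del: of_nat_Suc)
  ultimately show ?thesis by (simp add: LIMSEQ_const_iff)
qed

section \<open>Lipschitz test functions\<close>

lemma Lip_compact_supportE:
  assumes "\<psi> \<in> Lip_compact_support \<Omega>"
  obtains L M where "L-lipschitz_on UNIV \<psi>" "0 \<le> M" "\<And>x. \<bar>\<psi> x\<bar> \<le> M"
    "bounded {x. \<psi> x \<noteq> 0}" "\<And>x. x \<notin> \<Omega> \<Longrightarrow> \<psi> x = 0"
proof -
  let ?K = "closure {x. \<psi> x \<noteq> 0}"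
  obtain L where L: "L-lipschitz_on UNIV \<psi>" and K: "compact ?K" "?K \<subseteq> \<Omega>"
    using assms by (auto simp: Lip_compact_support_def)
  have "bounded (\<psi> ` ?K)"
    using K by (intro compact_imp_bounded compact_continuous_image
        continuous_on_subset[OF lipschitz_on_continuous_on[OF L]]) auto
  then obtain M where M: "\<And>x. x \<in> ?K \<Longrightarrow> \<bar>\<psi> x\<bar> \<le> M" unfolding bounded_iff by fastforce
  have sub: "{x. \<psi> x \<noteq> 0} \<subseteq> ?K" by (rule closure_subset)
  show thesis
  proof (rule that[OF L])
    show "\<bar>\<psi> x\<bar> \<le> max 0 M" for x using M[of x] sub by (cases "\<psi> x = 0") auto
    show "bounded {x. \<psi> x \<noteq> 0}" using K(1) sub by (meson bounded_subset compact_imp_bounded)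
    show "\<psi> x = 0" if "x \<notin> \<Omega>" for x using that K(2) sub by auto
  qed auto
qed

lemma Lip_compact_supportI:
  assumes "L-lipschitz_on UNIV \<eta>" "\<psi> \<in> Lip_compact_support \<Omega>" "{x. \<eta> x \<noteq> 0} \<subseteq> closure {x. \<psi> x \<noteq> 0}"
  shows "\<eta> \<in> Lip_compact_support \<Omega>"
proof -
  have sub: "closure {x. \<eta> x \<noteq> 0} \<subseteq> closure {x. \<psi> x \<noteq> 0}"
    using assms(3) by (metis closure_closure closure_mono)
  have K: "compact (closure {x. \<psi> x \<noteq> 0})" "closure {x. \<psi> x \<noteq> 0} \<subseteq> \<Omega>"
    using assms(2) by (auto simp: Lip_compact_support_def)
  have "compact (closure {x. \<eta> x \<noteq> 0})"
    using compact_Int_closed[OF K(1) closed_closure[of "{x. \<eta> x \<noteq> 0}"]] sub by (simp add: Int_absorb1)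
  then show ?thesis using assms(1) K sub by (auto simp: Lip_compact_support_def)
qed

text \<open>A coefficient that is Lipschitz only on the domain may be multiplied into a test function.\<close>

lemma Lip_compact_support_mult_left:
  assumes h: "K-lipschitz_on \<Omega> h" "\<And>x. x \<in> \<Omega> \<Longrightarrow> \<bar>h x\<bar> \<le> H"
    and \<psi>: "\<psi> \<in> Lip_compact_support \<Omega>"
  shows "(\<lambda>x. h x * \<psi> x) \<in> Lip_compact_support \<Omega>"
proof -
  obtain L M where L: "L-lipschitz_on UNIV \<psi>" and M: "0 \<le> M" "\<And>x. \<bar>\<psi> x\<bar> \<le> M"
    and zero: "\<And>x. x \<notin> \<Omega> \<Longrightarrow> \<psi> x = 0"
    using \<psi> by (rule Lip_compact_supportE) blast
  have L0: "0 \<le> L" using L by (rule lipschitz_on_nonneg)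
  have K0: "0 \<le> K" using h(1) by (rule lipschitz_on_nonneg)
  have \<psi>d: "\<bar>\<psi> x - \<psi> y\<bar> \<le> L * dist x y" for x y using lipschitz_onD[OF L, of x y] by (simp add: dist_real_def)
  let ?C = "\<bar>H\<bar> * L + K * M"
  have in_out: "\<bar>h x * \<psi> x - h y * \<psi> y\<bar> \<le> ?C * dist x y" if x: "x \<in> \<Omega>" for x y
  proof (cases "y \<in> \<Omega>")
    case True
    have "h x * \<psi> x - h y * \<psi> y = h x * (\<psi> x - \<psi> y) + (h x - h y) * \<psi> y" by (simp add: algebra_simps)
    also have "\<bar>\<dots>\<bar> \<le> \<bar>h x\<bar> * \<bar>\<psi> x - \<psi> y\<bar> + \<bar>h x - h y\<bar> * \<bar>\<psi> y\<bar>"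
      by (metis abs_mult abs_triangle_ineq)
    also have "\<dots> \<le> \<bar>H\<bar> * (L * dist x y) + (K * dist x y) * M"
    proof (intro add_mono mult_mono)
      show "\<bar>h x - h y\<bar> \<le> K * dist x y" using lipschitz_onD[OF h(1) x True] by (simp add: dist_real_def)
    qed (use h(2)[OF x] \<psi>d M K0 in auto)
    finally show ?thesis by (simp add: algebra_simps)
  next
    case False
    then have "\<bar>h x * \<psi> x - h y * \<psi> y\<bar> = \<bar>h x\<bar> * \<bar>\<psi> x - \<psi> y\<bar>" by (simp add: zero abs_mult)
    also have "\<dots> \<le> \<bar>H\<bar> * (L * dist x y)" using h(2)[OF x] \<psi>d by (intro mult_mono) auto
    also have "\<dots> \<le> ?C * dist x y" using K0 M by (simp add: algebra_simps)
    finally show ?thesis .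
  qed
  have "?C-lipschitz_on UNIV (\<lambda>x. h x * \<psi> x)"
  proof (rule lipschitz_onI)
    fix x y
    consider "x \<in> \<Omega>" | "y \<in> \<Omega>" | "x \<notin> \<Omega>" "y \<notin> \<Omega>" by blast
    then show "dist (h x * \<psi> x) (h y * \<psi> y) \<le> ?C * dist x y"
    proof cases
      case 1 then show ?thesis using in_out by (simp add: dist_real_def)
    next
      case 2 then show ?thesis using in_out[of y x] by (simp add: dist_real_def abs_minus_commute dist_commute)
    next
      case 3 then show ?thesis using zero L0 K0 M by simp
    qed
  qed (use L0 K0 M in simp)
  then show ?thesis
    by (rule Lip_compact_supportI[OF _ \<psi>]) (use closure_subset in fastforce)
qed

lemma Lip_compact_support_mult:
  assumes "\<psi> \<in> Lip_compact_support \<Omega>" "\<eta> \<in> Lip_compact_support \<Omega>"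
  shows "(\<lambda>x. \<psi> x * \<eta> x) \<in> Lip_compact_support \<Omega>"
proof -
  obtain L M where L: "L-lipschitz_on UNIV \<psi>" and M: "0 \<le> M" "\<And>x. \<bar>\<psi> x\<bar> \<le> M"
    using assms(1) by (rule Lip_compact_supportE) blast
  show ?thesis
    by (rule Lip_compact_support_mult_left[OF _ _ assms(2)])
      (use lipschitz_on_subset[OF L] M in auto)
qed

text \<open>Truncated multiples of the distance to the complement increase to the indicator function.\<close>

lemma Lip_compact_support_approx_open:
  assumes "open U" "U \<subseteq> \<Omega>" "bounded \<Omega>"
  obtains \<psi> :: "nat \<Rightarrow> real ^ 'n \<Rightarrow> real" where "\<And>k. \<psi> k \<in> Lip_compact_support \<Omega>"
    "\<And>k x. 0 \<le> \<psi> k x \<and> \<psi> k x \<le> 1" "\<And>x. (\<lambda>k. \<psi> k x) \<longlonglongrightarrow> indicator U x"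
proof -
  define \<psi> where "\<psi> k x = min 1 (max 0 (real k * infdist x (- U) - 1))" for k :: nat and x
  have "bounded U" using assms by (meson bounded_subset)
  then have ne: "- U \<noteq> {}" using not_bounded_UNIV by (metis Compl_empty_eq double_compl)
  have cl: "closed (- U)" using assms by auto
  show thesis
  proof (rule that)
    fix k
    have "(real k)-lipschitz_on UNIV (\<psi> k)"
    proof (rule lipschitz_onI)
      fix x y :: "real ^ 'n"
      have "dist (\<psi> k x) (\<psi> k y) \<le> \<bar>real k * infdist x (- U) - real k * infdist y (- U)\<bar>"
        unfolding \<psi>_def dist_real_def by (auto simp: min_def max_def)
      also have "\<dots> = real k * \<bar>infdist x (- U) - infdist y (- U)\<bar>"
        by (simp add: abs_mult flip: right_diff_distrib)
      also have "\<dots> \<le> real k * dist x y" by (intro mult_left_mono infdist_triangle_abs) auto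
      finally show "dist (\<psi> k x) (\<psi> k y) \<le> real k * dist x y" .
    qed auto
    moreover have sub: "closure {x. \<psi> k x \<noteq> 0} \<subseteq> {x. 1 \<le> real k * infdist x (- U)}"
    proof (rule closure_minimal)
      show "closed {x. 1 \<le> real k * infdist x (- U)}"
        by (intro closed_Collect_le continuous_intros)
    qed (auto simp: \<psi>_def)
    moreover have sub2: "{x. 1 \<le> real k * infdist x (- U)} \<subseteq> U"
    proof
      fix x assume x: "x \<in> {x. 1 \<le> real k * infdist x (- U)}"
      show "x \<in> U"
      proof (rule ccontr)
        assume "x \<notin> U"
        then have "infdist x (- U) = 0" by (intro infdist_zero) auto
        then show False using x by auto
      qed
    qed
    moreover have "compact (closure {x. \<psi> k x \<noteq> 0})"
      using sub sub2 \<open>bounded U\<close> by (meson bounded_subset closed_closure compact_eq_bounded_closed order_trans)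
    ultimately show "\<psi> k \<in> Lip_compact_support \<Omega>"
      unfolding Lip_compact_support_def using assms(2) by blast
  next
    fix k x show "0 \<le> \<psi> k x \<and> \<psi> k x \<le> 1" by (auto simp: \<psi>_def)
  next
    fix x :: "real ^ 'n"
    show "(\<lambda>k. \<psi> k x) \<longlonglongrightarrow> indicator U x"
    proof (cases "x \<in> U")
      case True
      then have pos: "0 < infdist x (- U)" using infdist_pos_not_in_closed[OF cl ne] by simp
      obtain k0 where k0: "2 / infdist x (- U) \<le> real k0" using real_arch_simple by blast
      have "\<psi> k x = 1" if "k \<ge> k0" for k
      proof -
        have "2 / infdist x (- U) \<le> real k" using k0 that by linarith
        then have "2 \<le> real k * infdist x (- U)" using pos by (simp add: field_simps)
        then show ?thesis by (simp add: \<psi>_def)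
      qed
      then show ?thesis using True by (intro tendsto_eventually) (auto simp: eventually_sequentially)
    next
      case False
      then have "\<psi> k x = 0" for k by (simp add: \<psi>_def)
      then show ?thesis using False by simp
    qed
  qed
qed

section \<open>Test functions determine integrable functions\<close>

locale bounded_domain =
  fixes \<Omega> :: "(real ^ 'n) set"
  assumes open_domain: "open \<Omega>" and bounded_domain: "bounded \<Omega>"
begin

abbreviation "leb \<equiv> lebesgue_on \<Omega>"

lemma sets_domain: "\<Omega> \<in> sets lebesgue" using open_domain by auto

lemma finite_measure_domain: "finite_measure leb"
  using open_domain bounded_domain
  by (intro finite_measure_lebesgue_on) (auto simp: bounded_set_imp_lmeasurable)

sublocale finite_measure leb by (rule finite_measure_domain)

lemma AE_lebesgue_on_domain: "AE x in lborel. P x \<Longrightarrow> AE x in leb. P x"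
  using AE_completion[of P lborel] sets_domain by (subst AE_restrict_space_iff) auto

lemma borel_measurable_domain: "f \<in> borel_measurable borel \<Longrightarrow> f \<in> borel_measurable leb"
  by (intro measurable_restrict_space1 measurable_completion) simp

lemma borel_measurable_test: "\<psi> \<in> Lip_compact_support \<Omega> \<Longrightarrow> \<psi> \<in> borel_measurable leb"
  by (elim Lip_compact_supportE)
    (intro borel_measurable_domain borel_measurable_continuous_onI lipschitz_on_continuous_on)

lemma integral_domain_eq_lborel:
  fixes f :: "real ^ 'n \<Rightarrow> real"
  assumes "f \<in> borel_measurable borel" "\<And>x. x \<notin> \<Omega> \<Longrightarrow> f x = 0"
  shows "(\<integral>x. f x \<partial>leb) = (\<integral>x. f x \<partial>lborel)"
proof -
  have "(\<integral>x. f x \<partial>leb) = (\<integral>x. indicator \<Omega> x *\<^sub>R f x \<partial>lebesgue)"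
    using sets_domain by (intro integral_restrict_space) auto
  also have "\<dots> = (\<integral>x. f x \<partial>lebesgue)"
    using assms(2) by (intro Bochner_Integration.integral_cong) (auto simp: indicator_def)
  also have "\<dots> = (\<integral>x. f x \<partial>lborel)" using assms(1) by (intro integral_completion) simp
  finally show ?thesis .
qed

text \<open>
  Test functions increase to the indicators of open subsets, so \<open>f\<close> has integral zero over open
  sets, then over closed sets by complementation, over countable unions of compact sets by
  dominated convergence, and finally over all measurable sets, which are such unions up to null sets.
\<close>

lemma AE_eq_0_if_orthogonal_to_tests:
  fixes f :: "real ^ 'n \<Rightarrow> real"
  assumes f: "integrable leb f"
    and orth: "\<And>\<psi>. \<psi> \<in> Lip_compact_support \<Omega> \<Longrightarrow> (\<integral>x. f x * \<psi> x \<partial>leb) = 0"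
  shows "AE x in leb. f x = 0"
proof -
  have fm: "f \<in> borel_measurable leb" using f by auto
  have ind: "(indicator A :: _ \<Rightarrow> real) \<in> borel_measurable leb" if "A \<in> sets borel" for A :: "(real ^ 'n) set"
    using that by (intro borel_measurable_domain) auto
  have lim: "(\<lambda>k. \<integral>x. f x * g k x \<partial>leb) \<longlonglongrightarrow> (\<integral>x. f x * g' x \<partial>leb)"
    if "\<And>k. g k \<in> borel_measurable leb" "g' \<in> borel_measurable leb" "\<And>k x. 0 \<le> g k x \<and> g k x \<le> (1::real)"
      "\<And>x. x \<in> \<Omega> \<Longrightarrow> (\<lambda>k. g k x) \<longlonglongrightarrow> g' x" for g g'
  proof (rule integral_dominated_convergence[where w="\<lambda>x. \<bar>f x\<bar>"])
    show "AE x in leb. (\<lambda>k. f x * g k x) \<longlonglongrightarrow> f x * g' x"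
      using that(4) by (intro AE_I2 tendsto_mult_left) auto
    show "AE x in leb. norm (f x * g k x) \<le> \<bar>f x\<bar>" for k
      using that(3) by (intro AE_I2) (auto simp: abs_mult intro!: mult_left_le)
  qed (use that fm f in auto)
  have op: "(\<integral>x. f x * indicator U x \<partial>leb) = 0" if U: "open U" "U \<subseteq> \<Omega>" for U
  proof -
    obtain \<psi> :: "nat \<Rightarrow> real ^ 'n \<Rightarrow> real" where \<psi>: "\<And>k. \<psi> k \<in> Lip_compact_support \<Omega>"
      "\<And>k x. 0 \<le> \<psi> k x \<and> \<psi> k x \<le> 1" "\<And>x. (\<lambda>k. \<psi> k x) \<longlonglongrightarrow> indicator U x"
      using Lip_compact_support_approx_open[OF U bounded_domain] by blast
    have "(\<lambda>k. \<integral>x. f x * \<psi> k x \<partial>leb) \<longlonglongrightarrow> (\<integral>x. f x * indicator U x \<partial>leb)"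
      by (rule lim) (use \<psi> U ind borel_measurable_test in auto)
    then show ?thesis using orth[OF \<psi>(1)] by (simp add: LIMSEQ_const_iff)
  qed
  have all: "(\<integral>x. f x \<partial>leb) = 0"
  proof -
    have "(\<integral>x. f x \<partial>leb) = (\<integral>x. f x * indicator \<Omega> x \<partial>leb)"
      by (intro Bochner_Integration.integral_cong) auto
    then show ?thesis using op[OF open_domain] by simp
  qed
  have cl: "(\<integral>x. f x * indicator K x \<partial>leb) = 0" if K: "closed K" for K
  proof -
    have "(\<integral>x. f x * indicator K x \<partial>leb) = (\<integral>x. f x - f x * indicator (\<Omega> - K) x \<partial>leb)"
      by (intro Bochner_Integration.integral_cong) (auto simp: indicator_def)
    also have "\<dots> = (\<integral>x. f x \<partial>leb) - (\<integral>x. f x * indicator (\<Omega> - K) x \<partial>leb)"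
      using f ind open_domain K by (intro Bochner_Integration.integral_diff integrable_real_mult_indicator)
        (auto simp: sets_restrict_space_iff sets_domain)
    finally show ?thesis using all op[of "\<Omega> - K"] open_domain K by auto
  qed
  have "(\<integral>x\<in>A. f x \<partial>leb) = (\<integral>x\<in>A. 0 \<partial>leb)" if A: "A \<in> sets leb" for A
  proof -
    have "A \<in> sets lebesgue" using A sets_domain by (simp add: sets_restrict_space_iff)
    then obtain C T where CT: "fsigma C" "T \<in> null_sets lebesgue" "C \<union> T = A" "disjnt C T"
      by (rule lebesgue_set_almost_fsigma)
    obtain F :: "nat \<Rightarrow> (real ^ 'n) set" where F: "range F \<subseteq> Collect compact" "C = \<Union>(range F)"
      using CT(1) fsigma_Union_compact by metis
    define G where "G k = (\<Union>i\<le>k. F i)" for k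
    have clG: "closed (G k)" for k using F(1) unfolding G_def
      by (intro closed_UN) (auto intro: compact_imp_closed)
    have Cb: "C \<in> sets borel" unfolding F(2) using F(1)
      by (intro sets.countable_UN) (auto intro!: borel_closed compact_imp_closed)
    have "(\<lambda>k. \<integral>x. f x * indicator (G k) x \<partial>leb) \<longlonglongrightarrow> (\<integral>x. f x * indicator C x \<partial>leb)"
    proof (rule lim)
      show "(\<lambda>k. indicator (G k) x) \<longlonglongrightarrow> (indicator C x :: real)" for x
      proof (cases "x \<in> C")
        case True
        then obtain i where "x \<in> F i" using F(2) by auto
        then have "indicator (G k) x = (1::real)" if "k \<ge> i" for k using that by (auto simp: G_def indicator_def)
        then show ?thesis using True by (intro tendsto_eventually) (auto simp: eventually_sequentially)
      next
        case False
        then have "indicator (G k) x = (0::real)" for k using F(2) by (auto simp: G_def indicator_def)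
        then show ?thesis using False by simp
      qed
    qed (use clG ind Cb in auto)
    then have "(\<integral>x. f x * indicator C x \<partial>leb) = 0" using cl[OF clG] by (simp add: LIMSEQ_const_iff)
    moreover have "(\<integral>x\<in>A. f x \<partial>leb) = (\<integral>x. f x * indicator C x \<partial>leb)"
      unfolding set_lebesgue_integral_def
    proof (rule integral_cong_AE)
      have "AE x in leb. x \<notin> T" using AE_not_in[OF CT(2)] sets_domain by (subst AE_restrict_space_iff) auto
      then show "AE x in leb. indicator A x *\<^sub>R f x = f x * indicator C x"
        by eventually_elim (use CT(3) in \<open>auto simp: indicator_def\<close>)
    qed (use A fm ind Cb in auto)
    ultimately show ?thesis by simp
  qed
  then show ?thesis using density_unique_real[OF f, of "\<lambda>_. 0"] by simp
qed

end

section \<open>Square integrable functions and derivatives of test functions\<close>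

context bounded_domain
begin

lemma L2_onD:
  assumes "f \<in> L2_on \<Omega>"
  shows "f \<in> borel_measurable leb" "integrable leb (\<lambda>x. (norm (f x))\<^sup>2)"
  using assms by (auto simp: L2_on_def)

lemma L2_on_bounded:
  fixes f :: "real ^ 'n \<Rightarrow> 'b :: euclidean_space"
  assumes "f \<in> borel_measurable leb" "AE x in leb. norm (f x) \<le> G"
  shows "f \<in> L2_on \<Omega>"
proof -
  have "AE x in leb. norm ((norm (f x))\<^sup>2) \<le> G\<^sup>2"
    using assms(2) by eventually_elim (auto intro!: power_mono)
  then show ?thesis using assms(1) by (auto simp: L2_on_def intro!: integrable_const_bound)
qed

lemma L2_on_inner:
  assumes f: "f \<in> L2_on \<Omega>" and g: "g \<in> L2_on \<Omega>"
  shows "integrable leb (\<lambda>x. f x \<bullet> g x)"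
proof (rule Bochner_Integration.integrable_bound)
  show "integrable leb (\<lambda>x. (norm (f x))\<^sup>2 + (norm (g x))\<^sup>2)"
    using L2_onD(2)[OF f] L2_onD(2)[OF g] by auto
  show "(\<lambda>x. f x \<bullet> g x) \<in> borel_measurable leb" using L2_onD(1)[OF f] L2_onD(1)[OF g] by measurable
  have "\<bar>f x \<bullet> g x\<bar> \<le> (norm (f x))\<^sup>2 + (norm (g x))\<^sup>2" for x
  proof -
    have "\<bar>f x \<bullet> g x\<bar> \<le> norm (f x) * norm (g x)" by (rule Cauchy_Schwarz_ineq2)
    also have "\<dots> \<le> (norm (f x))\<^sup>2 + (norm (g x))\<^sup>2"
    proof -
      have "2 * norm (f x) * norm (g x) \<le> (norm (f x))\<^sup>2 + (norm (g x))\<^sup>2" by (rule sum_squares_bound)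
      moreover have "0 \<le> norm (f x) * norm (g x)" by simp
      ultimately show ?thesis by linarith
    qed
    finally show ?thesis .
  qed
  then show "AE x in leb. norm (f x \<bullet> g x) \<le> norm ((norm (f x))\<^sup>2 + (norm (g x))\<^sup>2)" by (intro AE_I2) auto
qed

lemma L2_on_mult: "f \<in> L2_on \<Omega> \<Longrightarrow> g \<in> L2_on \<Omega> \<Longrightarrow> integrable leb (\<lambda>x. f x * g x :: real)"
  using L2_on_inner[of f g] by simp

lemma L2_on_integrable: "f \<in> L2_on \<Omega> \<Longrightarrow> integrable leb (f :: _ \<Rightarrow> real)"
  using L2_on_mult[of f "\<lambda>_. 1"] L2_on_bounded[of "\<lambda>_. 1 :: real" 1] by simp

lemma L2_on_diff:
  assumes f: "f \<in> L2_on \<Omega>" and g: "g \<in> L2_on \<Omega>"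
  shows "(\<lambda>x. f x - g x) \<in> L2_on \<Omega>"
proof -
  have "(norm (f x - g x))\<^sup>2 = (norm (f x))\<^sup>2 - 2 * (f x \<bullet> g x) + (norm (g x))\<^sup>2" for x
    by (simp add: power2_norm_eq_inner inner_diff inner_commute)
  then show ?thesis using L2_onD[OF f] L2_onD[OF g] L2_on_inner[OF f g] by (simp add: L2_on_def)
qed

lemma L2_on_scaleR_bounded:
  assumes h: "h \<in> borel_measurable leb" "AE x in leb. \<bar>h x\<bar> \<le> H" and f: "f \<in> L2_on \<Omega>"
  shows "(\<lambda>x. h x *\<^sub>R f x) \<in> L2_on \<Omega>"
proof -
  have "integrable leb (\<lambda>x. (norm (h x *\<^sub>R f x))\<^sup>2)"
  proof (rule Bochner_Integration.integrable_bound)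
    show "integrable leb (\<lambda>x. H\<^sup>2 * (norm (f x))\<^sup>2)" using L2_onD(2)[OF f] by auto
    show "(\<lambda>x. (norm (h x *\<^sub>R f x))\<^sup>2) \<in> borel_measurable leb" using h(1) L2_onD(1)[OF f] by measurable
    show "AE x in leb. norm ((norm (h x *\<^sub>R f x))\<^sup>2) \<le> norm (H\<^sup>2 * (norm (f x))\<^sup>2)"
      using h(2)
    proof eventually_elim
      case (elim x)
      then have "(h x)\<^sup>2 \<le> H\<^sup>2" by (metis abs_le_square_iff abs_ge_self order_trans)
      then show ?case by (simp add: power_mult_distrib mult_right_mono)
    qed
  qed
  moreover have "(\<lambda>x. h x *\<^sub>R f x) \<in> borel_measurable leb" using h(1) L2_onD(1)[OF f] by measurable
  ultimately show ?thesis by (simp add: L2_on_def)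
qed

lemma L2_on_nth: "g \<in> L2_on \<Omega> \<Longrightarrow> (\<lambda>x. g x $ i) \<in> L2_on \<Omega>" for g :: "real ^ 'n \<Rightarrow> real ^ 'm"
proof -
  assume g: "g \<in> L2_on \<Omega>"
  have m: "(\<lambda>x. g x $ i) \<in> borel_measurable leb"
    using L2_onD(1)[OF g] by (rule measurable_compose) (intro borel_measurable_continuous_onI continuous_intros)
  have "integrable leb (\<lambda>x. (g x $ i)\<^sup>2)"
  proof (rule Bochner_Integration.integrable_bound[OF L2_onD(2)[OF g]])
    show "AE x in leb. norm ((g x $ i)\<^sup>2) \<le> norm ((norm (g x))\<^sup>2)"
      by (intro AE_I2) (simp add: abs_le_square_iff[symmetric] component_le_norm_cart)
  qed (use m in measurable)
  then show ?thesis using m by (simp add: L2_on_def)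
qed

lemma L2_on_test: "\<psi> \<in> Lip_compact_support \<Omega> \<Longrightarrow> \<psi> \<in> L2_on \<Omega>"
  by (erule Lip_compact_supportE, rule L2_on_bounded)
    (auto intro!: borel_measurable_domain borel_measurable_continuous_onI lipschitz_on_continuous_on)

lemma borel_measurable_pderiv_test:
  assumes "\<psi> \<in> Lip_compact_support \<Omega>"
  shows "pderiv_at j \<psi> \<in> borel_measurable borel"
  using assms by (elim Lip_compact_supportE) (simp add: pderiv_at_def[abs_def] borel_measurable_directional_deriv)

lemma AE_pderiv_test:
  assumes "\<psi> \<in> Lip_compact_support \<Omega>"
  shows "AE x in leb. ((\<lambda>t. \<psi> (x + t *\<^sub>R axis j 1)) has_field_derivative pderiv_at j \<psi> x) (at 0)"
proof -
  obtain L where "L-lipschitz_on UNIV \<psi>" using assms by (rule Lip_compact_supportE) blast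
  then have "AE x in leb. \<exists>D. ((\<lambda>t. \<psi> (x + t *\<^sub>R axis j 1)) has_field_derivative D) (at 0)"
    by (intro AE_lebesgue_on_domain lipschitz_AE_directionally_differentiable)
  then show ?thesis unfolding pderiv_at_def by eventually_elim (metis DERIV_imp_deriv)
qed

lemma pderiv_test_mult:
  assumes "\<psi> \<in> Lip_compact_support \<Omega>" "\<eta> \<in> Lip_compact_support \<Omega>"
  shows "AE x in leb. pderiv_at j (\<lambda>x. \<psi> x * \<eta> x) x = \<psi> x * pderiv_at j \<eta> x + \<eta> x * pderiv_at j \<psi> x"
  using AE_pderiv_test[OF assms(1), of j] AE_pderiv_test[OF assms(2), of j]
proof eventually_elim
  case (elim x)
  have "((\<lambda>t. \<psi> (x + t *\<^sub>R axis j 1) * \<eta> (x + t *\<^sub>R axis j 1)) has_field_derivative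
      \<psi> x * pderiv_at j \<eta> x + \<eta> x * pderiv_at j \<psi> x) (at 0)"
    using DERIV_mult[OF elim] by (simp add: mult.commute add.commute)
  then show ?case by (subst pderiv_at_def) (rule DERIV_imp_deriv)
qed

lemma pderiv_test_bounded:
  assumes "\<psi> \<in> Lip_compact_support \<Omega>"
  shows "\<exists>L. AE x in leb. \<bar>pderiv_at j \<psi> x\<bar> \<le> L"
proof -
  obtain L where L: "L-lipschitz_on UNIV \<psi>" using assms by (rule Lip_compact_supportE) blast
  have "AE x in leb. \<bar>pderiv_at j \<psi> x\<bar> \<le> L"
    using AE_pderiv_test[OF assms, of j]
  proof eventually_elim
    case (elim x)
    then show ?case using directional_deriv_bound[OF L, of x "axis j 1"] by (auto simp: pderiv_at_def norm_axis_1)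
  qed
  then show ?thesis ..
qed

lemma L2_on_pderiv_test: "\<psi> \<in> Lip_compact_support \<Omega> \<Longrightarrow> pderiv_at j \<psi> \<in> L2_on \<Omega>"
  using pderiv_test_bounded[of \<psi> j] borel_measurable_pderiv_test[of \<psi> j]
  by (auto intro!: L2_on_bounded borel_measurable_domain)

text \<open>
  The derivative vanishes off the closed support, so the integral over the domain is the
  one over the whole space.
\<close>

lemma integral_pderiv_test_eq_0:
  assumes "\<psi> \<in> Lip_compact_support \<Omega>"
  shows "(\<integral>x. pderiv_at j \<psi> x \<partial>leb) = 0"
proof -
  have zero: "pderiv_at j \<psi> x = 0" if "x \<notin> \<Omega>" for x
  proof -
    let ?K = "closure {x. \<psi> x \<noteq> 0}"
    have "x \<notin> ?K" using assms that by (auto simp: Lip_compact_support_def)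
    then obtain e where e: "e > 0" "ball x e \<subseteq> - ?K"
      by (metis Compl_iff closed_closure open_Compl open_contains_ball)
    have "((\<lambda>t. \<psi> (x + t *\<^sub>R axis j 1)) has_field_derivative 0) (at 0)"
    proof (rule has_field_derivative_transform_within[OF DERIV_const[of 0] e(1)])
      fix t :: real assume "dist t 0 < e"
      then have "x + t *\<^sub>R axis j 1 \<in> ball x e" by (simp add: dist_norm norm_axis_1)
      then have "x + t *\<^sub>R axis j 1 \<notin> ?K" using e(2) by blast
      then have "x + t *\<^sub>R axis j 1 \<notin> {x. \<psi> x \<noteq> 0}" by (rule contra_subsetD[OF closure_subset])
      then show "0 = \<psi> (x + t *\<^sub>R axis j 1)" by simp
    qed simp
    then show ?thesis unfolding pderiv_at_def by (rule DERIV_imp_deriv)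
  qed
  obtain L where "L-lipschitz_on UNIV \<psi>" "bounded {x. \<psi> x \<noteq> 0}"
    using assms by (rule Lip_compact_supportE) blast
  then have "(\<integral>x. pderiv_at j \<psi> x \<partial>lborel) = 0"
    unfolding pderiv_at_def by (rule integral_directional_deriv_eq_0)
  then show ?thesis
    using integral_domain_eq_lborel[OF borel_measurable_pderiv_test[OF assms] zero] by metis
qed

end

section \<open>The degenerate gradient\<close>

locale degenerate_domain = bounded_domain \<Omega> for \<Omega> :: "(real ^ 'n) set" +
  fixes S :: "real ^ 'n \<Rightarrow> real ^ 'n ^ 'n"
  assumes Lipschitz_matrix: "\<exists>L. L-lipschitz_on \<Omega> S"
begin

definition classical_A_gradient :: "(real ^ 'n \<Rightarrow> real) \<Rightarrow> real ^ 'n \<Rightarrow> real ^ 'n" where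
  "classical_A_gradient \<psi> x = (\<chi> i. \<Sum>j\<in>UNIV. S x $ i $ j * pderiv_at j \<psi> x)"

lemma matrix_entry:
  obtains K H where "\<And>i j. K-lipschitz_on \<Omega> (\<lambda>x. S x $ i $ j)" "\<And>i j x. x \<in> \<Omega> \<Longrightarrow> \<bar>S x $ i $ j\<bar> \<le> H"
proof -
  obtain L where L: "L-lipschitz_on \<Omega> S" using Lipschitz_matrix by blast
  have entry: "\<bar>M $ i $ j\<bar> \<le> norm M" for M :: "real ^ 'n ^ 'n" and i j
    using component_le_norm_cart[of "M $ i" j] Finite_Cartesian_Product.norm_nth_le[of M i] by linarith
  have "bounded (S ` \<Omega>)"
    using lipschitz_on_uniformly_continuous[OF L] bounded_domain by (rule bounded_uniformly_continuous_image)
  then obtain H where H: "\<And>x. x \<in> \<Omega> \<Longrightarrow> norm (S x) \<le> H" by (auto simp: bounded_iff)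
  show thesis
  proof (rule that)
    show "L-lipschitz_on \<Omega> (\<lambda>x. S x $ i $ j)" for i j
    proof (rule lipschitz_onI)
      fix x y assume "x \<in> \<Omega>" "y \<in> \<Omega>"
      then have "norm (S x - S y) \<le> L * dist x y" using lipschitz_onD[OF L] by (simp add: dist_norm)
      then show "dist (S x $ i $ j) (S y $ i $ j) \<le> L * dist x y"
        using entry[of "S x - S y" i j] by (simp add: dist_real_def)
    qed (rule lipschitz_on_nonneg[OF L])
    show "\<bar>S x $ i $ j\<bar> \<le> H" if "x \<in> \<Omega>" for i j x using entry[of "S x" i j] H[OF that] by linarith
  qed
qed

lemma borel_measurable_matrix_entry: "(\<lambda>x. S x $ i $ j) \<in> borel_measurable leb"
proof -
  obtain K where "\<And>i j. K-lipschitz_on \<Omega> (\<lambda>x. S x $ i $ j)" by (rule matrix_entry) blast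
  then show ?thesis
    by (intro continuous_imp_measurable_on_sets_lebesgue lipschitz_on_continuous_on sets_domain)
qed

lemma matrix_entry_mult_test:
  "\<psi> \<in> Lip_compact_support \<Omega> \<Longrightarrow> (\<lambda>x. S x $ i $ j * \<psi> x) \<in> Lip_compact_support \<Omega>"
proof -
  assume \<psi>: "\<psi> \<in> Lip_compact_support \<Omega>"
  obtain K H where "\<And>i j. K-lipschitz_on \<Omega> (\<lambda>x. S x $ i $ j)" "\<And>i j x. x \<in> \<Omega> \<Longrightarrow> \<bar>S x $ i $ j\<bar> \<le> H"
    by (rule matrix_entry) blast
  then show ?thesis by (intro Lip_compact_support_mult_left \<psi>)
qed

lemma bounded_classical_A_gradient:
  assumes "\<psi> \<in> Lip_compact_support \<Omega>"
  obtains G where "0 \<le> G" "AE x in leb. norm (classical_A_gradient \<psi> x) \<le> G"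
proof -
  obtain H where H: "\<And>i j x. x \<in> \<Omega> \<Longrightarrow> \<bar>S x $ i $ j\<bar> \<le> H" by (rule matrix_entry) blast
  obtain L where L: "\<And>j. AE x in leb. \<bar>pderiv_at j \<psi> x\<bar> \<le> L j" using pderiv_test_bounded[OF assms] by metis
  define G where "G = (\<Sum>i\<in>(UNIV::'n set). \<Sum>j\<in>(UNIV::'n set). \<bar>H\<bar> * \<bar>L j\<bar>)"
  have "AE x in leb. \<forall>j. \<bar>pderiv_at j \<psi> x\<bar> \<le> L j" using L by (simp add: AE_all_countable)
  then have "AE x in leb. x \<in> \<Omega> \<and> (\<forall>j. \<bar>pderiv_at j \<psi> x\<bar> \<le> L j)" using AE_space by eventually_elim auto
  then have "AE x in leb. norm (classical_A_gradient \<psi> x) \<le> G"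
  proof eventually_elim
    case (elim x)
    have "norm (classical_A_gradient \<psi> x) \<le> (\<Sum>i\<in>UNIV. \<bar>classical_A_gradient \<psi> x $ i\<bar>)" by (rule norm_le_l1_cart)
    also have "\<dots> \<le> G" unfolding G_def
    proof (rule sum_mono)
      fix i
      have "\<bar>classical_A_gradient \<psi> x $ i\<bar> \<le> (\<Sum>j\<in>UNIV. \<bar>S x $ i $ j * pderiv_at j \<psi> x\<bar>)"
        unfolding classical_A_gradient_def by simp
      also have "\<dots> \<le> (\<Sum>j\<in>UNIV. \<bar>H\<bar> * \<bar>L j\<bar>)"
        unfolding abs_mult using elim H[of x i]
        by (intro sum_mono mult_mono) (auto intro: order_trans[OF _ abs_ge_self])
      finally show "\<bar>classical_A_gradient \<psi> x $ i\<bar> \<le> (\<Sum>j\<in>UNIV. \<bar>H\<bar> * \<bar>L j\<bar>)" .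
    qed
    finally show ?case .
  qed
  moreover have "0 \<le> G" unfolding G_def by (intro sum_nonneg) auto
  ultimately show thesis using that by blast
qed

lemma borel_measurable_classical_A_gradient:
  assumes "\<psi> \<in> Lip_compact_support \<Omega>"
  shows "classical_A_gradient \<psi> \<in> borel_measurable leb"
proof (subst borel_measurable_euclidean_space, rule ballI)
  fix b :: "real ^ 'n" assume "b \<in> Basis"
  then obtain i where b: "b = axis i 1" by (auto simp: Basis_vec_def)
  have "(\<lambda>x. \<Sum>j\<in>UNIV. S x $ i $ j * pderiv_at j \<psi> x) \<in> borel_measurable leb"
    by (intro borel_measurable_sum borel_measurable_times borel_measurable_matrix_entry
        borel_measurable_domain borel_measurable_pderiv_test assms)
  then show "(\<lambda>x. classical_A_gradient \<psi> x \<bullet> b) \<in> borel_measurable leb"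
    by (simp add: b inner_axis classical_A_gradient_def)
qed

lemma L2_on_classical_A_gradient:
  assumes "\<psi> \<in> Lip_compact_support \<Omega>" shows "classical_A_gradient \<psi> \<in> L2_on \<Omega>"
  using bounded_classical_A_gradient[OF assms] borel_measurable_classical_A_gradient[OF assms]
  by (metis L2_on_bounded)

lemma classical_A_gradient_mult:
  assumes "\<psi> \<in> Lip_compact_support \<Omega>" "\<eta> \<in> Lip_compact_support \<Omega>"
  shows "AE x in leb. classical_A_gradient (\<lambda>x. \<psi> x * \<eta> x) x =
    \<psi> x *\<^sub>R classical_A_gradient \<eta> x + \<eta> x *\<^sub>R classical_A_gradient \<psi> x"
proof -
  have "AE x in leb. \<forall>j. pderiv_at j (\<lambda>x. \<psi> x * \<eta> x) x = \<psi> x * pderiv_at j \<eta> x + \<eta> x * pderiv_at j \<psi> x"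
    unfolding AE_all_countable using pderiv_test_mult[OF assms] ..
  then show ?thesis
    by eventually_elim
      (simp add: classical_A_gradient_def vec_eq_iff sum_distrib_left sum.distrib distrib_left mult_ac)
qed

text \<open>
  With \<open>h\<^sub>j = S\<^sub>i\<^sub>j \<eta>\<close>, the difference of the two sides of the defining identity is the integral of the sum over
  \<open>j\<close> of \<open>\<partial>\<^sub>j (h\<^sub>j \<psi>)\<close>, and every \<open>h\<^sub>j \<psi>\<close> is again a test function.
\<close>

lemma has_weak_A_gradient_test:
  assumes \<psi>: "\<psi> \<in> Lip_compact_support \<Omega>"
  shows "has_weak_A_gradient S \<Omega> \<psi> (classical_A_gradient \<psi>)"
  unfolding has_weak_A_gradient_def
proof (intro allI ballI)
  fix i and \<eta> :: "real ^ 'n \<Rightarrow> real" assume \<eta>: "\<eta> \<in> Lip_compact_support \<Omega>"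
  let ?h = "\<lambda>j y. S y $ i $ j * \<eta> y"
  have h: "?h j \<in> Lip_compact_support \<Omega>" for j using \<eta> by (rule matrix_entry_mult_test)
  have "AE x in leb. \<forall>j. pderiv_at j (\<lambda>y. ?h j y * \<psi> y) x = ?h j x * pderiv_at j \<psi> x + \<psi> x * pderiv_at j (?h j) x"
    unfolding AE_all_countable using pderiv_test_mult[OF h \<psi>] ..
  then have AE: "AE x in leb. classical_A_gradient \<psi> x $ i * \<eta> x + \<psi> x * (\<Sum>j\<in>UNIV. pderiv_at j (?h j) x)
      = (\<Sum>j\<in>UNIV. pderiv_at j (\<lambda>y. ?h j y * \<psi> y) x)"
    by eventually_elim
      (simp add: classical_A_gradient_def sum_distrib_left sum_distrib_right sum.distrib mult_ac)
  have hp: "(\<lambda>y. ?h j y * \<psi> y) \<in> Lip_compact_support \<Omega>" for j by (intro Lip_compact_support_mult h \<psi>)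
  have int1: "integrable leb (\<lambda>x. classical_A_gradient \<psi> x $ i * \<eta> x)"
    by (intro L2_on_mult L2_on_nth L2_on_classical_A_gradient L2_on_test \<psi> \<eta>)
  have int2: "integrable leb (\<lambda>x. \<psi> x * (\<Sum>j\<in>UNIV. pderiv_at j (?h j) x))"
    unfolding sum_distrib_left by (intro Bochner_Integration.integrable_sum L2_on_mult L2_on_test L2_on_pderiv_test \<psi> h)
  have "(\<integral>x. classical_A_gradient \<psi> x $ i * \<eta> x \<partial>leb) + (\<integral>x. \<psi> x * (\<Sum>j\<in>UNIV. pderiv_at j (?h j) x) \<partial>leb)
    = (\<integral>x. classical_A_gradient \<psi> x $ i * \<eta> x + \<psi> x * (\<Sum>j\<in>UNIV. pderiv_at j (?h j) x) \<partial>leb)"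
    using int1 int2 by simp
  also have "\<dots> = (\<integral>x. (\<Sum>j\<in>UNIV. pderiv_at j (\<lambda>y. ?h j y * \<psi> y) x) \<partial>leb)"
  proof (rule integral_cong_AE[OF _ _ AE])
    show "(\<lambda>x. classical_A_gradient \<psi> x $ i * \<eta> x + \<psi> x * (\<Sum>j\<in>UNIV. pderiv_at j (?h j) x)) \<in> borel_measurable leb"
      using int1 int2 by (intro borel_measurable_add) auto
    show "(\<lambda>x. \<Sum>j\<in>UNIV. pderiv_at j (\<lambda>y. ?h j y * \<psi> y) x) \<in> borel_measurable leb"
      using borel_measurable_domain[OF borel_measurable_pderiv_test[OF hp]] by (rule borel_measurable_sum)
  qed
  also have "\<dots> = (\<Sum>j\<in>UNIV. \<integral>x. pderiv_at j (\<lambda>y. ?h j y * \<psi> y) x \<partial>leb)"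
    by (intro Bochner_Integration.integral_sum L2_on_integrable L2_on_pderiv_test hp)
  also have "\<dots> = 0" using integral_pderiv_test_eq_0[OF hp] by simp
  finally show "(\<integral>x. classical_A_gradient \<psi> x $ i * \<eta> x \<partial>leb) =
      - (\<integral>x. \<psi> x * (\<Sum>j\<in>UNIV. pderiv_at j (?h j) x) \<partial>leb)" by linarith
qed

lemma weak_A_gradient_unique:
  assumes g: "g \<in> L2_on \<Omega>" "has_weak_A_gradient S \<Omega> v g"
    and g': "g' \<in> L2_on \<Omega>" "has_weak_A_gradient S \<Omega> v g'"
  shows "AE x in leb. g x = g' x"
proof -
  have "AE x in leb. \<forall>i. g x $ i - g' x $ i = 0"
    unfolding AE_all_countable
  proof (intro allI AE_eq_0_if_orthogonal_to_tests)
    fix i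
    show "integrable leb (\<lambda>x. g x $ i - g' x $ i)"
      by (intro Bochner_Integration.integrable_diff L2_on_integrable L2_on_nth g g')
    fix \<psi> :: "real ^ 'n \<Rightarrow> real" assume \<psi>: "\<psi> \<in> Lip_compact_support \<Omega>"
    have "(\<integral>x. (g x $ i - g' x $ i) * \<psi> x \<partial>leb) = (\<integral>x. g x $ i * \<psi> x \<partial>leb) - (\<integral>x. g' x $ i * \<psi> x \<partial>leb)"
      unfolding left_diff_distrib
      by (intro Bochner_Integration.integral_diff L2_on_mult L2_on_nth L2_on_test g g' \<psi>)
    also have "\<dots> = 0" 
      using g(2)[unfolded has_weak_A_gradient_def, rule_format, OF \<psi>]
        g'(2)[unfolded has_weak_A_gradient_def, rule_format, OF \<psi>] by simp
    finally show "(\<integral>x. (g x $ i - g' x $ i) * \<psi> x \<partial>leb) = 0" .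
  qed
  then show ?thesis by eventually_elim (simp add: vec_eq_iff)
qed

lemma A_gradient_W12A:
  assumes "v \<in> W12A S \<Omega>"
  shows "A_gradient S \<Omega> v \<in> L2_on \<Omega>" "has_weak_A_gradient S \<Omega> v (A_gradient S \<Omega> v)"
proof -
  have "\<exists>g. g \<in> L2_on \<Omega> \<and> has_weak_A_gradient S \<Omega> v g" using assms by (auto simp: W12A_def)
  from someI_ex[OF this] show "A_gradient S \<Omega> v \<in> L2_on \<Omega>" "has_weak_A_gradient S \<Omega> v (A_gradient S \<Omega> v)"
    by (auto simp: A_gradient_def)
qed

lemma W12A_I:
  assumes "v \<in> L2_on \<Omega>" "g \<in> L2_on \<Omega>" "has_weak_A_gradient S \<Omega> v g"
  shows "v \<in> W12A S \<Omega>" "AE x in leb. A_gradient S \<Omega> v x = g x"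
proof -
  show v: "v \<in> W12A S \<Omega>" using assms by (auto simp: W12A_def)
  show "AE x in leb. A_gradient S \<Omega> v x = g x"
    by (rule weak_A_gradient_unique[OF A_gradient_W12A[OF v] assms(2,3)])
qed

lemma W12A_L2: "v \<in> W12A S \<Omega> \<Longrightarrow> v \<in> L2_on \<Omega>" by (simp add: W12A_def)

lemma A_gradient_test:
  assumes "\<psi> \<in> Lip_compact_support \<Omega>"
  shows "\<psi> \<in> W12A S \<Omega>" "AE x in leb. A_gradient S \<Omega> \<psi> x = classical_A_gradient \<psi> x"
  by (rule W12A_I[OF L2_on_test[OF assms] L2_on_classical_A_gradient[OF assms] has_weak_A_gradient_test[OF assms]])+

text \<open>
  The chosen representatives of the gradients are additive only almost everywhere, because they
  come from a choice operator; uniqueness of the weak gradient is what relates them.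
\<close>

lemma A_gradient_diff:
  assumes v: "v \<in> W12A S \<Omega>" and w: "w \<in> W12A S \<Omega>"
  shows "(\<lambda>x. v x - w x) \<in> W12A S \<Omega>"
    "AE x in leb. A_gradient S \<Omega> (\<lambda>x. v x - w x) x = A_gradient S \<Omega> v x - A_gradient S \<Omega> w x"
proof -
  have "has_weak_A_gradient S \<Omega> (\<lambda>x. v x - w x) (\<lambda>x. A_gradient S \<Omega> v x - A_gradient S \<Omega> w x)"
    unfolding has_weak_A_gradient_def
  proof (intro allI ballI)
    fix i and \<eta> :: "real ^ 'n \<Rightarrow> real" assume \<eta>: "\<eta> \<in> Lip_compact_support \<Omega>"
    let ?d = "\<lambda>x. \<Sum>j\<in>UNIV. pderiv_at j (\<lambda>y. S y $ i $ j * \<eta> y) x"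
    have int: "integrable leb (\<lambda>x. u x * ?d x)" if "u \<in> W12A S \<Omega>" for u
    proof -
      have "integrable leb (\<lambda>x. u x * pderiv_at j (\<lambda>y. S y $ i $ j * \<eta> y) x)" for j
        by (rule L2_on_mult[OF W12A_L2[OF that] L2_on_pderiv_test[OF matrix_entry_mult_test[OF \<eta>]]])
      then show ?thesis unfolding sum_distrib_left by (intro Bochner_Integration.integrable_sum)
    qed
    have int': "integrable leb (\<lambda>x. A_gradient S \<Omega> u x $ i * \<eta> x)" if "u \<in> W12A S \<Omega>" for u
      by (rule L2_on_mult[OF L2_on_nth[OF A_gradient_W12A(1)[OF that]] L2_on_test[OF \<eta>]])
    have weak: "(\<integral>x. A_gradient S \<Omega> u x $ i * \<eta> x \<partial>leb) = - (\<integral>x. u x * ?d x \<partial>leb)" if "u \<in> W12A S \<Omega>" for u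
      by (rule A_gradient_W12A(2)[OF that, unfolded has_weak_A_gradient_def, rule_format, OF \<eta>])
    have "(\<integral>x. (A_gradient S \<Omega> v x - A_gradient S \<Omega> w x) $ i * \<eta> x \<partial>leb)
      = (\<integral>x. A_gradient S \<Omega> v x $ i * \<eta> x \<partial>leb) - (\<integral>x. A_gradient S \<Omega> w x $ i * \<eta> x \<partial>leb)"
      unfolding vector_minus_component left_diff_distrib
      using int'[OF v] int'[OF w] by (rule Bochner_Integration.integral_diff)
    also have "\<dots> = - ((\<integral>x. v x * ?d x \<partial>leb) - (\<integral>x. w x * ?d x \<partial>leb))" unfolding weak[OF v] weak[OF w] by simp
    also have "\<dots> = - (\<integral>x. (v x - w x) * ?d x \<partial>leb)"
      unfolding left_diff_distrib by (subst Bochner_Integration.integral_diff[OF int[OF v] int[OF w]]) (rule refl)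
    finally show "(\<integral>x. (A_gradient S \<Omega> v x - A_gradient S \<Omega> w x) $ i * \<eta> x \<partial>leb) = - (\<integral>x. (v x - w x) * ?d x \<partial>leb)" .
  qed
  note W12A_I[OF L2_on_diff[OF W12A_L2[OF v] W12A_L2[OF w]]
      L2_on_diff[OF A_gradient_W12A(1)[OF v] A_gradient_W12A(1)[OF w]] this]
  then show "(\<lambda>x. v x - w x) \<in> W12A S \<Omega>"
    "AE x in leb. A_gradient S \<Omega> (\<lambda>x. v x - w x) x = A_gradient S \<Omega> v x - A_gradient S \<Omega> w x" by blast+
qed

text \<open>
  Both representatives agree almost everywhere with the classical gradient, which obeys the product rule.
\<close>

lemma A_gradient_mult_test:
  assumes "\<psi> \<in> Lip_compact_support \<Omega>" "\<eta> \<in> Lip_compact_support \<Omega>"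
  shows "AE x in leb. A_gradient S \<Omega> (\<lambda>x. \<psi> x * \<eta> x) x =
    \<psi> x *\<^sub>R A_gradient S \<Omega> \<eta> x + \<eta> x *\<^sub>R A_gradient S \<Omega> \<psi> x"
  using classical_A_gradient_mult[OF assms] A_gradient_test(2)[OF assms(1)] A_gradient_test(2)[OF assms(2)]
    A_gradient_test(2)[OF Lip_compact_support_mult[OF assms]]
  by eventually_elim simp

lemma bounded_A_gradient_test:
  assumes "\<psi> \<in> Lip_compact_support \<Omega>"
  obtains G where "0 \<le> G" "AE x in leb. norm (A_gradient S \<Omega> \<psi> x) \<le> G"
proof -
  obtain G where G: "0 \<le> G" "AE x in leb. norm (classical_A_gradient \<psi> x) \<le> G"
    using assms by (rule bounded_classical_A_gradient)
  have "AE x in leb. norm (A_gradient S \<Omega> \<psi> x) \<le> G"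
    using G(2) A_gradient_test(2)[OF assms] by eventually_elim simp
  then show thesis using that G(1) by blast
qed

end

section \<open>Luxemburg norms by duality\<close>

text \<open>
  Since \<open>ennreal\<close> sends negative numbers to \<open>0\<close>, the inequality says that the positive part of the affine
  function lies below \<open>\<phi>\<close>.
\<close>

definition affine_minorant :: "(real \<Rightarrow> ennreal) \<Rightarrow> real \<Rightarrow> real \<Rightarrow> bool" where
  "affine_minorant \<phi> a b \<longleftrightarrow> 0 \<le> a \<and> 0 \<le> b \<and> (\<forall>s. ennreal (a * s - b) \<le> \<phi> s)"

lemma convex_conjugate_le_if_affine_minorant:
  assumes "affine_minorant \<phi> a b"
  shows "convex_conjugate \<phi> a \<le> ennreal b"
proof -
  have "ereal (s * a) - enn2ereal (\<phi> s) \<le> ereal b" for s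
  proof (cases "\<phi> s")
    case (real c)
    have "ennreal (a * s - b) \<le> ennreal c" using assms real unfolding affine_minorant_def by metis
    then have "a * s - b \<le> c" using real by (cases "0 \<le> a * s - b") (auto simp: ennreal_le_iff)
    then show ?thesis using real by (simp add: enn2ereal_ennreal mult.commute)
  qed simp
  then have "(SUP s. ereal (s * a) - enn2ereal (\<phi> s)) \<le> ereal b" by (rule SUP_least)
  then show ?thesis unfolding convex_conjugate_def
    using e2ennreal_mono[of _ "ereal b"] by (simp add: ennreal.abs_eq[symmetric] e2ennreal_ereal)
qed

text \<open>
  Used to normalise a density whose conjugate integral exceeds \<open>1\<close>.
\<close>

lemma affine_minorant_scale:
  assumes "affine_minorant \<phi> a b" "1 \<le> \<rho>"
  shows "affine_minorant \<phi> (a / \<rho>) (b / \<rho>)"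
  unfolding affine_minorant_def
proof (intro conjI allI)
  fix s
  have "a / \<rho> * s - b / \<rho> = (a * s - b) / \<rho>" by (simp add: diff_divide_distrib)
  also have "\<dots> \<le> max 0 (a * s - b)" using assms(2)
    by (cases "0 \<le> a * s - b") (auto simp: divide_le_eq mult_le_cancel_left1 divide_nonpos_pos max_def)
  finally have "ennreal (a / \<rho> * s - b / \<rho>) \<le> ennreal (max 0 (a * s - b))" by (rule ennreal_leI)
  also have "\<dots> = ennreal (a * s - b)" by (auto simp: max_def ennreal_neg)
  also have "\<dots> \<le> \<phi> s" using assms(1) by (simp add: affine_minorant_def)
  finally show "ennreal (a / \<rho> * s - b / \<rho>) \<le> \<phi> s" .
qed (use assms in \<open>auto simp: affine_minorant_def\<close>)

lemma young_function_convex: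
  assumes "young_function \<phi>" "0 \<le> t" "t \<le> 1"
  shows "\<phi> (t * x + (1 - t) * y) \<le> ennreal t * \<phi> x + ennreal (1 - t) * \<phi> y"
  using assms unfolding young_function_def by blast

lemma young_function_scale:
  assumes "young_function \<phi>" "0 \<le> t" "t \<le> 1"
  shows "\<phi> (t * x) \<le> ennreal t * \<phi> x"
  using young_function_convex[OF assms, of x 0] assms(1) by (simp add: young_function_def)

lemma young_function_mono:
  assumes "young_function \<phi>" "0 \<le> x" "x \<le> y"
  shows "\<phi> x \<le> \<phi> y"
proof (cases "y = 0")
  case False
  then have y: "0 < y" using assms by simp
  have "\<phi> (x / y * y) \<le> ennreal (x / y) * \<phi> y" using assms y by (intro young_function_scale) auto
  also have "\<dots> \<le> 1 * \<phi> y" using assms y by (intro mult_right_mono) (auto simp: ennreal_le_1)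
  finally show ?thesis using y by simp
qed (use assms in simp)

text \<open>
  Where \<open>\<phi>\<close> is infinite, arbitrarily steep lines through \<open>(q, 0)\<close> lie below it.
\<close>

lemma affine_minorant_vertical:
  assumes \<phi>: "young_function \<phi>" and q: "0 < q" "\<phi> q = \<infinity>"
  shows "affine_minorant \<phi> (real n) (real n * q)"
  unfolding affine_minorant_def
proof (intro conjI allI)
  fix s
  show "ennreal (real n * s - real n * q) \<le> \<phi> s"
  proof (cases "q \<le> s")
    case True
    then have "\<phi> s = \<infinity>" using young_function_mono[OF \<phi>, of q s] q by (simp add: top_unique)
    then show ?thesis by simp
  next
    case False
    then have "real n * s - real n * q \<le> 0" by (simp add: mult_left_mono)
    then show ?thesis by (simp add: ennreal_neg)
  qed
qed (use q in auto)

text \<open>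
  A supporting line at \<open>q\<close>. Its slope is the supremum of the chord slopes to the left, which is finite
  because \<open>\<phi>\<close> is finite at some point \<open>r\<close> to the right of \<open>q\<close>.
\<close>

lemma affine_minorant_support:
  assumes \<phi>: "young_function \<phi>" and q: "0 < q" "q < r" "\<phi> r \<noteq> \<infinity>"
  shows "\<exists>a b. affine_minorant \<phi> a b \<and> \<phi> q = ennreal (a * q - b)"
proof -
  define h where "h s = enn2real (\<phi> s)" for s
  have fin: "\<phi> s = ennreal (h s)" if "0 \<le> s" "s \<le> t" "\<phi> t \<noteq> \<infinity>" for s t
  proof -
    have "\<phi> s \<le> \<phi> t" using that by (intro young_function_mono[OF \<phi>]) auto
    then have "\<phi> s < \<infinity>" using that(3) by (simp add: less_top[symmetric] top_unique neq_top_trans)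
    then show ?thesis by (simp add: h_def)
  qed
  have h0: "0 \<le> h s" for s by (simp add: h_def)
  have slopes: "(h q - h s) / (q - s) \<le> (h t - h q) / (t - q)"
    if s: "0 \<le> s" "s < q" and t: "q < t" "\<phi> t \<noteq> \<infinity>" for s t
  proof -
    let ?l = "(t - q) / (t - s)"
    have l: "0 \<le> ?l" "?l \<le> 1" "1 - ?l = (q - s) / (t - s)" using s t by (auto simp: field_simps)
    have "?l * s + (1 - ?l) * t = ((t - q) * s + (q - s) * t) / (t - s)" unfolding l(3) by (simp add: add_divide_distrib)
    also have "(t - q) * s + (q - s) * t = q * (t - s)" by (simp add: algebra_simps)
    finally have "?l * s + (1 - ?l) * t = q" using s t by simp
    then have "\<phi> q \<le> ennreal ?l * \<phi> s + ennreal (1 - ?l) * \<phi> t"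
      using young_function_convex[OF \<phi> l(1,2), of s t] by simp
    moreover have "\<phi> q = ennreal (h q)" "\<phi> s = ennreal (h s)" "\<phi> t = ennreal (h t)"
      using fin[of q t] fin[of s t] fin[of t t] s t q by auto
    moreover have "ennreal ?l * ennreal (h s) + ennreal (1 - ?l) * ennreal (h t) = ennreal (?l * h s + (1 - ?l) * h t)"
    proof -
      have "0 \<le> 1 - ?l" using l by linarith
      then show ?thesis using l(1) h0[of s] h0[of t]
        by (simp only: ennreal_mult ennreal_plus mult_nonneg_nonneg)
    qed
    ultimately have "ennreal (h q) \<le> ennreal (?l * h s + (1 - ?l) * h t)" by simp
    then have "h q \<le> ?l * h s + (1 - ?l) * h t"
    proof -
      have "0 \<le> ?l * h s + (1 - ?l) * h t"
        using l(2) by (intro add_nonneg_nonneg mult_nonneg_nonneg l(1) h0) simp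
      with \<open>ennreal (h q) \<le> _\<close> show ?thesis by (simp only: ennreal_le_iff)
    qed
    also have "\<dots> = ((t - q) * h s + (q - s) * h t) / (t - s)" unfolding l(3) by (simp add: add_divide_distrib)
    finally have "(t - s) * h q \<le> (t - q) * h s + (q - s) * h t" using s t by (simp add: field_simps)
    then have "(h q - h s) * (t - q) \<le> (h t - h q) * (q - s)" by (simp add: algebra_simps)
    moreover have "0 < t - q" "0 < q - s" using s t by auto
    ultimately show ?thesis by (simp only: pos_divide_le_eq times_divide_eq_left pos_le_divide_eq)
  qed
  let ?A = "(\<lambda>s. (h q - h s) / (q - s)) ` {0..<q}"
  define a where "a = Sup ?A"
  have bdd: "bdd_above ?A" using slopes[OF _ _ q(2,3)] by (intro bdd_aboveI2[where M="(h r - h q) / (r - q)"]) auto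
  have low: "(h q - h s) / (q - s) \<le> a" if "0 \<le> s" "s < q" for s
    unfolding a_def using that bdd by (intro cSup_upper) auto
  have up: "a \<le> (h t - h q) / (t - q)" if "q < t" "\<phi> t \<noteq> \<infinity>" for t
    unfolding a_def using slopes[OF _ _ that] q by (intro cSup_least) auto
  have "h 0 = 0" using \<phi> by (simp add: h_def young_function_def)
  then have aq: "h q \<le> a * q" using low[of 0] q by (simp add: field_simps)
  have a0: "0 \<le> a" using low[of 0] \<open>h 0 = 0\<close> h0[of q] q by (simp add: order_trans[OF divide_nonneg_pos])
  define b where "b = a * q - h q"
  have "affine_minorant \<phi> a b"
    unfolding affine_minorant_def
  proof (intro conjI allI)
    fix s
    show "ennreal (a * s - b) \<le> \<phi> s"
    proof (cases "s < 0 \<or> \<phi> s = \<infinity>")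
      case True
      have "a * s - b \<le> 0" if "s < 0" using that a0 aq by (auto simp: b_def intro: order_trans[OF mult_nonneg_nonpos])
      then show ?thesis using True by (auto simp: ennreal_neg)
    next
      case False
      then have s: "0 \<le> s" "\<phi> s = ennreal (h s)" using fin[of s s] by auto
      consider "s < q" | "s = q" | "q < s" by linarith
      then have "a * s - b \<le> h s"
      proof cases
        case 1 then show ?thesis using low[OF s(1) 1] by (simp add: b_def field_simps)
      next
        case 2 then show ?thesis by (simp add: b_def)
      next
        case 3 then show ?thesis using up[OF 3] False by (simp add: b_def field_simps)
      qed
      then show ?thesis unfolding s(2) by (rule ennreal_leI)
    qed
  qed (use a0 aq in \<open>auto simp: b_def\<close>)
  moreover have "\<phi> q = ennreal (a * q - b)" using fin[of q r] q by (simp add: b_def)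
  ultimately show ?thesis by blast
qed

text \<open>
  Halving the argument leaves room for rationals \<open>t / 2 < q < r < t\<close>. If \<open>\<phi> r\<close> is finite, the
  supporting line at \<open>q\<close> exceeds \<open>\<phi> q \<ge> \<phi> (t / 2)\<close> at \<open>t\<close>; otherwise the steep lines through
  \<open>(r, 0)\<close> are unbounded at \<open>t\<close>. Countably many lines therefore suffice.
\<close>

lemma countable_affine_minorants:
  assumes \<phi>: "young_function \<phi>"
  obtains C where "countable C" "C \<noteq> {}" "\<And>a b. (a, b) \<in> C \<Longrightarrow> affine_minorant \<phi> a b"
    "\<And>t. 0 \<le> t \<Longrightarrow> \<phi> (t / 2) \<le> (SUP (a, b)\<in>C. ennreal (a * t - b))"
proof -
  define m where "m q r = (SOME p. affine_minorant \<phi> (fst p) (snd p) \<and> \<phi> q = ennreal (fst p * q - snd p))" for q r :: real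
  have m: "affine_minorant \<phi> (fst (m q r)) (snd (m q r)) \<and> \<phi> q = ennreal (fst (m q r) * q - snd (m q r))"
    if qr: "0 < q" "q < r" "\<phi> r \<noteq> \<infinity>" for q r
  proof -
    have "\<exists>p. affine_minorant \<phi> (fst p) (snd p) \<and> \<phi> q = ennreal (fst p * q - snd p)"
      using affine_minorant_support[OF \<phi> qr] by auto
    from someI_ex[OF this] show ?thesis by (simp add: m_def)
  qed
  define C1 where "C1 = (\<lambda>(n::nat, q). (real n, real n * q)) ` (UNIV \<times> {q \<in> \<rat>. 0 < q \<and> \<phi> q = \<infinity>})"
  define C2 where "C2 = (\<lambda>(q, r). m q r) ` {(q, r) \<in> \<rat> \<times> \<rat>. 0 < q \<and> q < r \<and> \<phi> r \<noteq> \<infinity>}"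
  have cQ: "countable {x \<in> \<rat>. P x}" for P :: "real \<Rightarrow> bool" by (rule countable_subset[OF _ countable_rat]) auto
  have "countable C1" unfolding C1_def by (intro countable_image countable_SIGMA cQ) auto
  moreover have "countable C2" unfolding C2_def
    by (intro countable_image countable_subset[OF _ countable_SIGMA[OF countable_rat countable_rat]]) auto
  ultimately have cC: "countable (insert (0, 0) (C1 \<union> C2))" by simp
  have minor: "affine_minorant \<phi> a b" if ab: "(a, b) \<in> insert (0, 0) (C1 \<union> C2)" for a b
  proof -
    consider "a = 0" "b = 0" | "(a, b) \<in> C1" | "(a, b) \<in> C2" using ab by auto
    then show ?thesis
    proof cases
      case 1 then show ?thesis by (simp add: affine_minorant_def)
    next
      case 2 then show ?thesis unfolding C1_def using affine_minorant_vertical[OF \<phi>] by auto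
    next
      case 3
      then obtain q r where "(a, b) = m q r" "0 < q" "q < r" "\<phi> r \<noteq> \<infinity>" unfolding C2_def by auto
      then show ?thesis using m[of q r] by (metis fst_conv snd_conv)
    qed
  qed
  show thesis
  proof (rule that[OF cC _ minor])
    fix t :: real assume t: "0 \<le> t"
    let ?S = "SUP (a, b)\<in>insert (0, 0) (C1 \<union> C2). ennreal (a * t - b)"
    show "\<phi> (t / 2) \<le> ?S"
    proof (cases "t = 0")
      case True then show ?thesis using \<phi> by (simp add: young_function_def)
    next
      case False
      then have t: "0 < t" using t by simp
      obtain r where r: "r \<in> \<rat>" "t / 2 < r" "r < t" using Rats_dense_in_real[of "t / 2" t] t by auto
      obtain q where q: "q \<in> \<rat>" "t / 2 < q" "q < r" using Rats_dense_in_real[of "t / 2" r] r by auto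
      show ?thesis
      proof (cases "\<phi> r = \<infinity>")
        case True
        have "ennreal (real n) \<le> ?S" for n
        proof -
          obtain k :: nat where k: "real n / (t - r) \<le> real k" using real_arch_simple by blast
          have "real n \<le> real k * t - real k * r" using k r by (simp add: field_simps)
          then have "ennreal (real n) \<le> ennreal (real k * t - real k * r)" by (rule ennreal_leI)
          also have "\<dots> \<le> ?S"
            using True r t by (intro SUP_upper2[of "(real k, real k * r)"]) (auto simp: C1_def)
          finally show ?thesis .
        qed
        then have "?S = top" using ennreal_SUP_of_nat_eq_top by (metis SUP_least top_unique ennreal_of_nat_eq_real_of_nat)
        then show ?thesis by simp
      next
        case False
        have q0: "0 < q" using q t by linarith
        have "\<phi> (t / 2) \<le> \<phi> q" using t q by (intro young_function_mono[OF \<phi>]) auto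
        also have "\<dots> = ennreal (fst (m q r) * q - snd (m q r))" using m[OF q0 q(3) False] by simp
        also have "\<dots> \<le> ennreal (fst (m q r) * t - snd (m q r))"
          using m[OF q0 q(3) False] q r by (intro ennreal_leI) (auto simp: affine_minorant_def intro!: mult_left_mono)
        also have "\<dots> \<le> ?S"
          using q r q0 False by (intro SUP_upper2[of "m q r"]) (auto simp: C2_def split: prod.splits)
        finally show ?thesis .
      qed
    qed
  qed auto
qed

text \<open>
  The running maximiser at \<open>t\<close> of \<open>a t - b\<close> over the zero line and the first \<open>m\<close> lines. Recursion selects it in
  a way that is visibly measurable in \<open>t\<close>.
\<close>

primrec best_minorant :: "(nat \<Rightarrow> real \<times> real) \<Rightarrow> nat \<Rightarrow> real \<Rightarrow> real \<times> real" where
  "best_minorant c 0 t = (0, 0)"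
| "best_minorant c (Suc m) t =
    (if fst (best_minorant c m t) * t - snd (best_minorant c m t) < fst (c m) * t - snd (c m)
     then c m else best_minorant c m t)"

lemma best_minorant_value_mono:
  "m \<le> n \<Longrightarrow> fst (best_minorant c m t) * t - snd (best_minorant c m t)
    \<le> fst (best_minorant c n t) * t - snd (best_minorant c n t)"
  by (induction n rule: dec_induct) auto

lemma best_minorant_value_ge:
  "fst (c m) * t - snd (c m) \<le> fst (best_minorant c (Suc m) t) * t - snd (best_minorant c (Suc m) t)"
  by auto

lemma borel_measurable_best_minorant:
  "(\<lambda>t. fst (best_minorant c m t)) \<in> borel_measurable borel \<and>
   (\<lambda>t. snd (best_minorant c m t)) \<in> borel_measurable borel"
proof (induction m)
  case (Suc m)
  then have [measurable]: "(\<lambda>t. fst (best_minorant c m t)) \<in> borel_measurable borel"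
    "(\<lambda>t. snd (best_minorant c m t)) \<in> borel_measurable borel" by auto
  show ?case unfolding best_minorant.simps if_distrib[of fst] if_distrib[of snd] by measurable
qed simp

lemma best_minorant_bounded:
  "\<exists>K. \<forall>t. fst (best_minorant c m t) \<le> K \<and> snd (best_minorant c m t) \<le> K"
proof (induction m)
  case 0 show ?case by (intro exI[of _ 0]) simp
next
  case (Suc m)
  then obtain K where "\<And>t. fst (best_minorant c m t) \<le> K \<and> snd (best_minorant c m t) \<le> K" by blast
  then show ?case by (intro exI[of _ "max K (max (fst (c m)) (snd (c m)))"]) (auto simp: le_max_iff_disj)
qed

text \<open>
  The Luxemburg norm is at most twice the dual norm. Let \<open>a t - b\<close> be the largest of the first \<open>m\<close> minorants
  at \<open>t = g / N\<close>, and use the slope \<open>a\<close> as density \<open>f\<close>. Its norm is at most \<open>\<rho> = max 1 (\<integral> b)\<close>, so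
  \<open>\<integral> a t \<le> \<rho>\<close> by the hypothesis, and \<open>\<integral> (a t - b) \<le> \<rho> - \<integral> b \<le> 1\<close>. Now let \<open>m\<close> tend to infinity.
\<close>

theorem nn_integral_young_le_1_if_dual_bound:
  assumes M: "finite_measure M" and \<phi>: "young_function \<phi>"
    and g: "g \<in> borel_measurable M" "\<And>x. 0 \<le> g x" and N: "0 < N"
    and dual: "\<And>f K. f \<in> borel_measurable M \<Longrightarrow> (\<And>x. 0 \<le> f x \<and> f x \<le> K) \<Longrightarrow>
      luxemburg_norm M (convex_conjugate \<phi>) f < \<infinity> \<Longrightarrow>
      (\<integral>\<^sup>+x. ennreal (f x * g x) \<partial>M) \<le> ennreal N * luxemburg_norm M (convex_conjugate \<phi>) f"
  shows "(\<integral>\<^sup>+x. \<phi> (g x / (2 * N)) \<partial>M) \<le> 1"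
proof -
  interpret finite_measure M by (rule M)
  obtain C where C: "countable C" "C \<noteq> {}" and minor: "\<And>a b. (a, b) \<in> C \<Longrightarrow> affine_minorant \<phi> a b"
    and sup: "\<And>t. 0 \<le> t \<Longrightarrow> \<phi> (t / 2) \<le> (SUP (a, b)\<in>C. ennreal (a * t - b))"
    using countable_affine_minorants[OF \<phi>] by metis
  define c where "c = from_nat_into C"
  have c: "range c = C" unfolding c_def using C by (rule range_from_nat_into[rotated])
  define t where "t x = g x / N" for x
  have t: "t \<in> borel_measurable M" "\<And>x. 0 \<le> t x" using g N by (auto simp: t_def[abs_def])
  define f where "f m x = fst (best_minorant c m (t x))" for m x
  define \<beta> where "\<beta> m x = snd (best_minorant c m (t x))" for m x
  define V where "V m x = f m x * t x - \<beta> m x" for m x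
  have fm: "f m \<in> borel_measurable M" "\<beta> m \<in> borel_measurable M" for m
    unfolding f_def \<beta>_def using borel_measurable_best_minorant t(1)
    by (auto intro: measurable_compose[OF t(1)])
  have Vm: "V m \<in> borel_measurable M" for m unfolding V_def using fm[of m] t(1) by measurable
  have best: "affine_minorant \<phi> (fst (best_minorant c m s)) (snd (best_minorant c m s))" for m s
  proof (induction m)
    case 0 show ?case by (simp add: affine_minorant_def)
  next
    case (Suc m)
    have "affine_minorant \<phi> (fst (c m)) (snd (c m))" using minor[of "fst (c m)" "snd (c m)"] c by auto
    then show ?case using Suc by simp
  qed
  then have aff: "affine_minorant \<phi> (f m x) (\<beta> m x)" for m x by (simp add: f_def \<beta>_def)
  have fb0: "0 \<le> f m x" "0 \<le> \<beta> m x" for m x using aff[of m x] by (auto simp: affine_minorant_def)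
  have V0: "0 \<le> V m x" for m x
    using best_minorant_value_mono[of 0 m c "t x"] by (simp add: V_def f_def \<beta>_def)
  have V1: "(\<integral>\<^sup>+x. ennreal (V m x) \<partial>M) \<le> 1" for m
  proof -
    obtain K where K: "\<And>x. f m x \<le> K" "\<And>x. \<beta> m x \<le> K"
      using best_minorant_bounded[of c m] unfolding f_def \<beta>_def by metis
    have "integrable M (\<beta> m)" using fb0 K fm by (intro integrable_const_bound[of _ K]) auto
    then have \<beta>: "(\<integral>\<^sup>+x. ennreal (\<beta> m x) \<partial>M) = ennreal (\<integral>x. \<beta> m x \<partial>M)"
      using fb0 by (intro nn_integral_eq_integral) auto
    define \<rho>0 where "\<rho>0 = (\<integral>x. \<beta> m x \<partial>M)"
    define \<rho> where "\<rho> = max 1 \<rho>0"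
    have \<rho>0: "0 \<le> \<rho>0" unfolding \<rho>0_def using fb0 by (intro Bochner_Integration.integral_nonneg) auto
    have \<rho>: "1 \<le> \<rho>" "\<rho>0 \<le> \<rho>" by (auto simp: \<rho>_def)
    have "(\<integral>\<^sup>+x. convex_conjugate \<phi> (f m x / \<rho>) \<partial>M) \<le> (\<integral>\<^sup>+x. ennreal (1 / \<rho>) * ennreal (\<beta> m x) \<partial>M)"
    proof (rule nn_integral_mono)
      fix x
      have "convex_conjugate \<phi> (f m x / \<rho>) \<le> ennreal (\<beta> m x / \<rho>)"
        by (rule convex_conjugate_le_if_affine_minorant[OF affine_minorant_scale[OF aff \<rho>(1)]])
      then show "convex_conjugate \<phi> (f m x / \<rho>) \<le> ennreal (1 / \<rho>) * ennreal (\<beta> m x)"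
        using \<rho>(1) fb0 by (simp add: ennreal_mult[symmetric])
    qed
    also have "\<dots> = ennreal (1 / \<rho>) * ennreal \<rho>0"
      using fm \<beta> by (simp add: nn_integral_cmult \<rho>0_def)
    also have "\<dots> \<le> 1" using \<rho> \<rho>0 by (simp add: ennreal_mult[symmetric] divide_le_eq ennreal_le_1)
    finally have norm: "luxemburg_norm M (convex_conjugate \<phi>) (f m) \<le> ennreal \<rho>"
      unfolding luxemburg_norm_def using \<rho>(1) by (intro Inf_lower) auto
    then have "luxemburg_norm M (convex_conjugate \<phi>) (f m) < \<infinity>" by (rule le_less_trans) simp
    then have "(\<integral>\<^sup>+x. ennreal (f m x * g x) \<partial>M) \<le> ennreal N * luxemburg_norm M (convex_conjugate \<phi>) (f m)"
      using fb0 K fm by (intro dual[of "f m" K]) auto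
    also have "\<dots> \<le> ennreal N * ennreal \<rho>" by (intro mult_left_mono norm) simp
    finally have fg: "(\<integral>\<^sup>+x. ennreal (f m x * g x) \<partial>M) \<le> ennreal N * ennreal \<rho>" .
    have "(\<integral>\<^sup>+x. ennreal (V m x) \<partial>M) + ennreal \<rho>0 = (\<integral>\<^sup>+x. ennreal (V m x) + ennreal (\<beta> m x) \<partial>M)"
      using Vm fm \<beta> by (subst nn_integral_add) (auto simp: \<rho>0_def)
    also have "\<dots> = (\<integral>\<^sup>+x. ennreal (1 / N) * ennreal (f m x * g x) \<partial>M)"
    proof (rule nn_integral_cong)
      fix x
      have "V m x + \<beta> m x = 1 / N * (f m x * g x)" by (simp add: V_def t_def)
      then show "ennreal (V m x) + ennreal (\<beta> m x) = ennreal (1 / N) * ennreal (f m x * g x)"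
        using V0 fb0 N g(2) by (simp add: ennreal_plus[symmetric] ennreal_mult[symmetric] del: ennreal_plus)
    qed
    also have "\<dots> = ennreal (1 / N) * (\<integral>\<^sup>+x. ennreal (f m x * g x) \<partial>M)"
      using fm g by (intro nn_integral_cmult) auto
    also have "\<dots> \<le> ennreal (1 / N) * (ennreal N * ennreal \<rho>)" by (intro mult_left_mono fg) simp
    also have "\<dots> = ennreal \<rho>" using N \<rho> by (simp add: ennreal_mult[symmetric])
    finally have le: "(\<integral>\<^sup>+x. ennreal (V m x) \<partial>M) + ennreal \<rho>0 \<le> ennreal \<rho>" .
    then obtain v where v: "0 \<le> v" "(\<integral>\<^sup>+x. ennreal (V m x) \<partial>M) = ennreal v"
      by (cases "\<integral>\<^sup>+x. ennreal (V m x) \<partial>M") (auto simp: top_unique)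
    have "v + \<rho>0 \<le> \<rho>" using le v \<rho>0 \<rho> by (simp add: ennreal_plus[symmetric] del: ennreal_plus)
    then have "v \<le> 1" using \<rho>0 v by (auto simp: \<rho>_def max_def split: if_splits)
    then show ?thesis using v by (simp add: ennreal_le_1)
  qed
  have "(\<integral>\<^sup>+x. \<phi> (g x / (2 * N)) \<partial>M) \<le> (\<integral>\<^sup>+x. (SUP m. ennreal (V m x)) \<partial>M)"
  proof (rule nn_integral_mono)
    fix x
    have "\<phi> (g x / (2 * N)) = \<phi> (t x / 2)" by (simp add: t_def mult.commute)
    also have "\<dots> \<le> (SUP (a, b)\<in>C. ennreal (a * t x - b))" using sup t(2) by blast
    also have "\<dots> \<le> (SUP m. ennreal (V m x))"
    proof (rule SUP_least, clarify)
      fix a b assume "(a, b) \<in> C"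
      then obtain m where m: "c m = (a, b)" using c by (metis rangeE)
      have "ennreal (a * t x - b) \<le> ennreal (V (Suc m) x)"
        using best_minorant_value_ge[of c m "t x"] m
        by (intro ennreal_leI) (simp add: V_def f_def \<beta>_def)
      also have "\<dots> \<le> (SUP m. ennreal (V m x))" by (rule SUP_upper) simp
      finally show "ennreal (a * t x - b) \<le> (SUP m. ennreal (V m x))" .
    qed
    finally show "\<phi> (g x / (2 * N)) \<le> (SUP m. ennreal (V m x))" .
  qed
  also have "\<dots> = (SUP m. \<integral>\<^sup>+x. ennreal (V m x) \<partial>M)"
  proof (rule nn_integral_monotone_convergence_SUP)
    show "incseq (\<lambda>m x. ennreal (V m x))"
      unfolding incseq_def le_fun_def V_def f_def \<beta>_def
      by (intro allI impI ennreal_leI best_minorant_value_mono)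
    show "(\<lambda>x. ennreal (V m x)) \<in> borel_measurable M" for m using Vm by measurable
  qed
  also have "\<dots> \<le> 1" by (rule SUP_least) (rule V1)
  finally show ?thesis .
qed

section \<open>The energy estimate\<close>

context bounded_domain
begin

text \<open>
  The inequality \<open>2 |h \<bullet> d| \<le> s |h|\<^sup>2 + |d|\<^sup>2 / s\<close> with a small \<open>s\<close> takes the place of the Cauchy-Schwarz
  inequality for integrals.
\<close>

lemma tendsto_integral_inner_L2:
  assumes h: "h \<in> L2_on \<Omega>" and p: "p \<in> L2_on \<Omega>" "\<And>k. q k \<in> L2_on \<Omega>"
    and lim: "(\<lambda>k. \<integral>x. (norm (p x - q k x))\<^sup>2 \<partial>leb) \<longlonglongrightarrow> 0"
  shows "(\<lambda>k. \<integral>x. h x \<bullet> q k x \<partial>leb) \<longlonglongrightarrow> (\<integral>x. h x \<bullet> p x \<partial>leb)"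
proof (rule LIMSEQ_I)
  fix e :: real assume e: "0 < e"
  define H where "H = (\<integral>x. (norm (h x))\<^sup>2 \<partial>leb)"
  have H: "0 \<le> H" unfolding H_def by (intro Bochner_Integration.integral_nonneg) auto
  define s where "s = e / (H + 1)"
  have s: "0 < s" using e H by (simp add: s_def)
  obtain k0 where k0: "\<And>k. k \<ge> k0 \<Longrightarrow> (\<integral>x. (norm (p x - q k x))\<^sup>2 \<partial>leb) < s * e"
    using order_tendstoD(2)[OF lim, of "s * e"] s e by (auto simp: eventually_sequentially)
  show "\<exists>n0. \<forall>n\<ge>n0. norm ((\<integral>x. h x \<bullet> q n x \<partial>leb) - (\<integral>x. h x \<bullet> p x \<partial>leb)) < e"
  proof (intro exI[of _ k0] allI impI)
    fix k assume "k \<ge> k0"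
    have d: "(\<lambda>x. p x - q k x) \<in> L2_on \<Omega>" using p by (intro L2_on_diff)
    have "(\<integral>x. h x \<bullet> q k x \<partial>leb) - (\<integral>x. h x \<bullet> p x \<partial>leb) = - (\<integral>x. h x \<bullet> (p x - q k x) \<partial>leb)"
      using L2_on_inner[OF h p(1)] L2_on_inner[OF h p(2)] by (simp add: inner_diff_right)
    then have "norm ((\<integral>x. h x \<bullet> q k x \<partial>leb) - (\<integral>x. h x \<bullet> p x \<partial>leb)) \<le> (\<integral>x. \<bar>h x \<bullet> (p x - q k x)\<bar> \<partial>leb)"
      by simp
    also have "\<dots> \<le> (\<integral>x. (s * (norm (h x))\<^sup>2 + (norm (p x - q k x))\<^sup>2 / s) / 2 \<partial>leb)"
    proof (rule integral_mono)
      show "integrable leb (\<lambda>x. \<bar>h x \<bullet> (p x - q k x)\<bar>)" using L2_on_inner[OF h d] by simp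
      show "integrable leb (\<lambda>x. (s * (norm (h x))\<^sup>2 + (norm (p x - q k x))\<^sup>2 / s) / 2)"
        using L2_onD(2)[OF h] L2_onD(2)[OF d] by auto
      fix x
      have "\<bar>h x \<bullet> (p x - q k x)\<bar> \<le> norm (h x) * norm (p x - q k x)" by (rule Cauchy_Schwarz_ineq2)
      also have "\<dots> \<le> (s * (norm (h x))\<^sup>2 + (norm (p x - q k x))\<^sup>2 / s) / 2"
      proof -
        let ?a = "norm (h x)" and ?b = "norm (p x - q k x)"
        have "0 \<le> (s * ?a - ?b)\<^sup>2" by simp
        then have "2 * s * (?a * ?b) \<le> s * (s * ?a\<^sup>2) + ?b\<^sup>2" by (simp add: power2_eq_square algebra_simps)
        then have "2 * s * (?a * ?b) \<le> s * (s * ?a\<^sup>2 + ?b\<^sup>2 / s)" using s by (simp add: distrib_left)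
        then show ?thesis using s by (simp add: mult.assoc mult.left_commute[of 2 s] mult_le_cancel_left_pos)
      qed
      finally show "\<bar>h x \<bullet> (p x - q k x)\<bar> \<le> (s * (norm (h x))\<^sup>2 + (norm (p x - q k x))\<^sup>2 / s) / 2" .
    qed
    also have "\<dots> = (s * H + (\<integral>x. (norm (p x - q k x))\<^sup>2 \<partial>leb) / s) / 2"
      using L2_onD(2)[OF h] L2_onD(2)[OF d] by (simp add: H_def)
    also have "\<dots> < (e + e) / 2"
    proof -
      have "s * H \<le> e" using e H by (simp add: s_def field_simps)
      moreover have "(\<integral>x. (norm (p x - q k x))\<^sup>2 \<partial>leb) / s < e"
        using k0[OF \<open>k \<ge> k0\<close>] s by (simp add: pos_divide_less_eq mult.commute)
      ultimately show ?thesis by simp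
    qed
    finally show "norm ((\<integral>x. h x \<bullet> q k x \<partial>leb) - (\<integral>x. h x \<bullet> p x \<partial>leb)) < e" by simp
  qed
qed

lemma tendsto_integral_weighted_norm_L2:
  fixes p :: "real ^ 'n \<Rightarrow> 'b :: euclidean_space" and q :: "nat \<Rightarrow> real ^ 'n \<Rightarrow> 'b"
  assumes b: "b \<in> borel_measurable leb" "\<And>x. 0 \<le> b x \<and> b x \<le> K"
    and p: "p \<in> L2_on \<Omega>" "\<And>k. q k \<in> L2_on \<Omega>"
    and lim: "(\<lambda>k. \<integral>x. (norm (p x - q k x))\<^sup>2 \<partial>leb) \<longlonglongrightarrow> 0"
  shows "(\<lambda>k. \<integral>x. b x * (norm (q k x))\<^sup>2 \<partial>leb) \<longlonglongrightarrow> (\<integral>x. b x * (norm (p x))\<^sup>2 \<partial>leb)"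
proof -
  have bf: "(\<lambda>x. b x *\<^sub>R f x) \<in> L2_on \<Omega>" if "f \<in> L2_on \<Omega>" for f :: "_ \<Rightarrow> 'b"
    by (rule L2_on_scaleR_bounded[OF b(1) _ that, of K]) (use b(2) in \<open>auto intro!: AE_I2\<close>)
  have bi: "integrable leb (\<lambda>x. b x * (f x \<bullet> g x))" if "f \<in> L2_on \<Omega>" "g \<in> L2_on \<Omega>" for f g :: "_ \<Rightarrow> 'b"
    using L2_on_inner[OF bf[OF that(1)] that(2)] by simp
  have d: "(\<lambda>x. p x - q k x) \<in> L2_on \<Omega>" for k using p by (intro L2_on_diff)
  have eq: "(\<integral>x. b x * (norm (q k x))\<^sup>2 \<partial>leb) = 2 * (\<integral>x. (b x *\<^sub>R p x) \<bullet> q k x \<partial>leb)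
      - (\<integral>x. b x * (p x \<bullet> p x) \<partial>leb) + (\<integral>x. b x * (norm (p x - q k x))\<^sup>2 \<partial>leb)" for k
  proof -
    have "b x * (norm (q k x))\<^sup>2 = 2 * (b x * (p x \<bullet> q k x)) - b x * (p x \<bullet> p x) + b x * ((p x - q k x) \<bullet> (p x - q k x))" for x
      by (simp add: power2_norm_eq_inner inner_diff inner_commute algebra_simps)
    then show ?thesis
      using bi[OF p(1) p(2)[of k]] bi[OF p(1) p(1)] bi[OF d d] by (simp add: power2_norm_eq_inner)
  qed
  have small: "(\<lambda>k. \<integral>x. b x * (norm (p x - q k x))\<^sup>2 \<partial>leb) \<longlonglongrightarrow> 0"
  proof (rule tendsto_sandwich[of "\<lambda>_. 0" _ _ "\<lambda>k. K * (\<integral>x. (norm (p x - q k x))\<^sup>2 \<partial>leb)"])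
    show "(\<lambda>k. K * (\<integral>x. (norm (p x - q k x))\<^sup>2 \<partial>leb)) \<longlonglongrightarrow> 0"
      using tendsto_mult_right_zero[OF lim] by simp
    show "eventually (\<lambda>k. (\<integral>x. b x * (norm (p x - q k x))\<^sup>2 \<partial>leb) \<le> K * (\<integral>x. (norm (p x - q k x))\<^sup>2 \<partial>leb)) sequentially"
    proof (intro always_eventually allI)
      fix k
      have "(\<integral>x. b x * (norm (p x - q k x))\<^sup>2 \<partial>leb) \<le> (\<integral>x. K * (norm (p x - q k x))\<^sup>2 \<partial>leb)"
        using bi[OF d d, of k k] L2_onD(2)[OF d, of k] b(2)
        by (intro integral_mono) (auto simp: power2_norm_eq_inner intro!: mult_right_mono)
      then show "(\<integral>x. b x * (norm (p x - q k x))\<^sup>2 \<partial>leb) \<le> K * (\<integral>x. (norm (p x - q k x))\<^sup>2 \<partial>leb)" by simp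
    qed
    show "eventually (\<lambda>k. 0 \<le> (\<integral>x. b x * (norm (p x - q k x))\<^sup>2 \<partial>leb)) sequentially"
      using b(2) by (intro always_eventually allI Bochner_Integration.integral_nonneg) auto
  qed auto
  have "(\<lambda>k. 2 * (\<integral>x. (b x *\<^sub>R p x) \<bullet> q k x \<partial>leb) - (\<integral>x. b x * (p x \<bullet> p x) \<partial>leb)
      + (\<integral>x. b x * (norm (p x - q k x))\<^sup>2 \<partial>leb)) \<longlonglongrightarrow>
      2 * (\<integral>x. (b x *\<^sub>R p x) \<bullet> p x \<partial>leb) - (\<integral>x. b x * (p x \<bullet> p x) \<partial>leb) + 0"
    by (intro tendsto_add tendsto_diff tendsto_mult tendsto_const small
        tendsto_integral_inner_L2[OF bf[OF p(1)] p lim])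
  then show ?thesis unfolding eq by (simp add: power2_norm_eq_inner)
qed

end

context degenerate_domain
begin

lemma W12A0_approx:
  assumes v: "v \<in> W12A0 S \<Omega>"
  obtains \<psi> :: "nat \<Rightarrow> real ^ 'n \<Rightarrow> real" where "\<And>k. \<psi> k \<in> Lip_compact_support \<Omega>"
    "(\<lambda>k. \<integral>x. (norm (v x - \<psi> k x))\<^sup>2 \<partial>leb) \<longlonglongrightarrow> 0"
    "(\<lambda>k. \<integral>x. (norm (A_gradient S \<Omega> v x - A_gradient S \<Omega> (\<psi> k) x))\<^sup>2 \<partial>leb) \<longlonglongrightarrow> 0"
proof -
  have vW: "v \<in> W12A S \<Omega>" using v by (simp add: W12A0_def)
  have "\<forall>k. \<exists>\<psi>\<in>Lip_compact_support \<Omega>. W12A_norm S \<Omega> (\<lambda>x. v x - \<psi> x) < 1 / real (Suc k)"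
    using v unfolding W12A0_def by simp
  then obtain \<psi> where \<psi>: "\<And>k. \<psi> k \<in> Lip_compact_support \<Omega>"
    and lt: "\<And>k. W12A_norm S \<Omega> (\<lambda>x. v x - \<psi> k x) < 1 / real (Suc k)" by metis
  let ?a = "\<lambda>k. \<integral>x. (norm (v x - \<psi> k x))\<^sup>2 \<partial>leb"
  let ?b = "\<lambda>k. \<integral>x. (norm (A_gradient S \<Omega> v x - A_gradient S \<Omega> (\<psi> k) x))\<^sup>2 \<partial>leb"
  have ab0: "0 \<le> ?a k" "0 \<le> ?b k" for k by (auto intro!: Bochner_Integration.integral_nonneg)
  have ab: "?a k + ?b k \<le> (1 / real (Suc k))\<^sup>2" for k
  proof -
    have \<psi>W: "\<psi> k \<in> W12A S \<Omega>" using A_gradient_test(1)[OF \<psi>] .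
    note D = A_gradient_diff[OF vW \<psi>W]
    have i1: "integrable leb (\<lambda>x. (norm (v x - \<psi> k x))\<^sup>2)" using L2_onD(2)[OF W12A_L2[OF D(1)]] .
    have i2: "integrable leb (\<lambda>x. (norm (A_gradient S \<Omega> (\<lambda>x. v x - \<psi> k x) x))\<^sup>2)"
      using L2_onD(2)[OF A_gradient_W12A(1)[OF D(1)]] .
    have i3: "integrable leb (\<lambda>x. (norm (A_gradient S \<Omega> v x - A_gradient S \<Omega> (\<psi> k) x))\<^sup>2)"
      by (rule L2_onD(2)[OF L2_on_diff[OF A_gradient_W12A(1)[OF vW] A_gradient_W12A(1)[OF \<psi>W]]])
    have "?b k = (\<integral>x. (norm (A_gradient S \<Omega> (\<lambda>x. v x - \<psi> k x) x))\<^sup>2 \<partial>leb)"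
      using D(2) i2 i3 by (intro integral_cong_AE) (auto elim: eventually_mono)
    then have "?a k + ?b k = (\<integral>x. \<bar>v x - \<psi> k x\<bar>\<^sup>2 + (norm (A_gradient S \<Omega> (\<lambda>x. v x - \<psi> k x) x))\<^sup>2 \<partial>leb)"
      using i1 i2 by simp
    then have "W12A_norm S \<Omega> (\<lambda>x. v x - \<psi> k x) = sqrt (?a k + ?b k)" by (simp only: W12A_norm_def)
    then have "sqrt (?a k + ?b k) \<le> 1 / real (Suc k)" using lt[of k] by simp
    then have "(sqrt (?a k + ?b k))\<^sup>2 \<le> (1 / real (Suc k))\<^sup>2" using ab0[of k] by (intro power_mono) auto
    then show ?thesis using ab0[of k] by simp
  qed
  have lim0: "(\<lambda>k. (1 / real (Suc k))\<^sup>2) \<longlonglongrightarrow> 0"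
  proof -
    have "(\<lambda>k. (1 / real (Suc k))\<^sup>2) \<longlonglongrightarrow> 0\<^sup>2" by (intro tendsto_power LIMSEQ_Suc[OF lim_1_over_n])
    then show ?thesis by (simp only: power_zero_numeral)
  qed
  show thesis
  proof (rule that[OF \<psi>])
    have "?a k \<le> (1 / real (Suc k))\<^sup>2" "?b k \<le> (1 / real (Suc k))\<^sup>2" for k
      using ab[of k] ab0[of k] by linarith+
    then show "?a \<longlonglongrightarrow> 0" "?b \<longlonglongrightarrow> 0"
      using ab0 by (intro tendsto_sandwich[OF _ _ tendsto_const lim0] always_eventually allI; simp)+
  qed
qed

text \<open>
  With \<open>F = \<integral> f w\<^sup>2\<close>, \<open>X = \<integral> w\<^sup>2 |\<nabla>\<^sub>A u|\<^sup>2\<close>, \<open>Y = \<integral> |\<nabla>\<^sub>A w|\<^sup>2\<close> and \<open>Z = \<integral> |h|\<close>, where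
  \<open>h = 2 w \<nabla>\<^sub>A u \<bullet> \<nabla>\<^sub>A w\<close>, testing with \<open>w\<^sup>2\<close> gives \<open>F \<le> Z\<close> and testing with \<open>u w\<^sup>2\<close> gives
  \<open>X \<le> M Z + M F \<le> 2 M Z\<close>. By the inequality of the means \<open>Z \<le> X / (4 M) + 4 M Y\<close>; the weight \<open>4 M\<close>
  makes the first term at most \<open>Z / 2\<close>.
\<close>

lemma energy_estimate_test:
  assumes f: "f \<in> borel_measurable leb" "\<And>x. 0 \<le> f x \<and> f x \<le> K"
    and u: "weak_dirichlet_solution S \<Omega> f u"
    and M: "0 < M" "AE x in leb. \<bar>u x\<bar> \<le> M"
    and w: "w \<in> Lip_compact_support \<Omega>"
  shows "(\<integral>x. f x * (w x)\<^sup>2 \<partial>leb) \<le> 8 * M * (\<integral>x. (norm (A_gradient S \<Omega> w x))\<^sup>2 \<partial>leb)"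
proof -
  define U where "U = A_gradient S \<Omega> u"
  define W where "W = A_gradient S \<Omega> w"
  define w2 where "w2 x = w x * w x" for x
  define h where "h x = U x \<bullet> (2 *\<^sub>R w x *\<^sub>R W x)" for x
  have u0: "u \<in> W12A0 S \<Omega>" and sol: "\<And>\<psi>. \<psi> \<in> Lip_compact_support \<Omega> \<Longrightarrow>
      (\<integral>x. U x \<bullet> A_gradient S \<Omega> \<psi> x \<partial>leb) = - (\<integral>x. f x * \<psi> x \<partial>leb)"
    using u by (auto simp: weak_dirichlet_solution_def U_def)
  then have uW: "u \<in> W12A S \<Omega>" by (simp add: W12A0_def)
  have UL: "U \<in> L2_on \<Omega>" unfolding U_def by (rule A_gradient_W12A(1)[OF uW])
  have WL: "W \<in> L2_on \<Omega>" unfolding W_def by (rule A_gradient_W12A(1)[OF A_gradient_test(1)[OF w]])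
  have w2: "w2 \<in> Lip_compact_support \<Omega>" unfolding w2_def[abs_def] by (rule Lip_compact_support_mult[OF w w])
  obtain H where H: "\<And>x. \<bar>w x\<bar> \<le> H" using w by (rule Lip_compact_supportE) blast
  obtain H2 where H2: "\<And>x. \<bar>w2 x\<bar> \<le> H2" using w2 by (rule Lip_compact_supportE) blast
  obtain G where G: "0 \<le> G" "AE x in leb. norm (W x) \<le> G" using bounded_A_gradient_test[OF w] unfolding W_def by blast
  have meas: "w \<in> borel_measurable leb" "w2 \<in> borel_measurable leb" "U \<in> borel_measurable leb" "W \<in> borel_measurable leb"
    using borel_measurable_test[OF w] borel_measurable_test[OF w2] L2_onD(1)[OF UL] L2_onD(1)[OF WL] by auto
  have hm: "h \<in> borel_measurable leb" unfolding h_def using meas by measurable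
  have gw2: "AE x in leb. A_gradient S \<Omega> w2 x = 2 *\<^sub>R w x *\<^sub>R W x"
    using A_gradient_mult_test[OF w w] unfolding w2_def[symmetric, abs_def] W_def
    by eventually_elim (simp only: scaleR_2)
  have Uw: "(\<lambda>x. w x *\<^sub>R U x) \<in> L2_on \<Omega>"
    by (rule L2_on_scaleR_bounded[OF meas(1) _ UL, of H]) (use H in auto)
  have Uw2: "(\<lambda>x. w2 x *\<^sub>R U x) \<in> L2_on \<Omega>"
    by (rule L2_on_scaleR_bounded[OF meas(2) _ UL, of H2]) (use H2 in auto)
  have hL: "h \<in> L2_on \<Omega>"
  proof -
    have "integrable leb (\<lambda>x. (norm (h x))\<^sup>2)"
    proof (rule Bochner_Integration.integrable_bound)
      show "integrable leb (\<lambda>x. (2 * G)\<^sup>2 * (norm (w x *\<^sub>R U x))\<^sup>2)" using L2_onD(2)[OF Uw] by auto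
      show "AE x in leb. norm ((norm (h x))\<^sup>2) \<le> norm ((2 * G)\<^sup>2 * (norm (w x *\<^sub>R U x))\<^sup>2)"
        using G(2)
      proof eventually_elim
        case (elim x)
        have "\<bar>h x\<bar> = 2 * \<bar>(w x *\<^sub>R U x) \<bullet> W x\<bar>" by (simp add: h_def abs_mult)
        also have "\<dots> \<le> 2 * (norm (w x *\<^sub>R U x) * norm (W x))" by (intro mult_left_mono Cauchy_Schwarz_ineq2) auto
        also have "\<dots> \<le> 2 * (norm (w x *\<^sub>R U x) * G)" using elim by (intro mult_left_mono) auto
        finally have "\<bar>h x\<bar> \<le> 2 * G * norm (w x *\<^sub>R U x)" by (simp add: mult_ac)
        then have "\<bar>h x\<bar>\<^sup>2 \<le> (2 * G * norm (w x *\<^sub>R U x))\<^sup>2" by (intro power_mono) auto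
        then show ?case by (simp add: power_mult_distrib)
      qed
    qed (use hm in measurable)
    then show ?thesis using hm by (simp add: L2_on_def)
  qed
  have fw2: "(\<lambda>x. f x * w2 x) \<in> L2_on \<Omega>"
  proof (rule L2_on_bounded[of _ "K * H2"])
    have "norm (f x * w2 x) \<le> K * H2" for x
      unfolding real_norm_def abs_mult using f(2)[of x] H2[of x] by (intro mult_mono) auto
    then show "AE x in leb. norm (f x * w2 x) \<le> K * H2" by simp
  qed (use f meas in measurable)
  define F where "F = (\<integral>x. f x * w2 x \<partial>leb)"
  define X where "X = (\<integral>x. (norm (w x *\<^sub>R U x))\<^sup>2 \<partial>leb)"
  define Y where "Y = (\<integral>x. (norm (W x))\<^sup>2 \<partial>leb)"
  define Z where "Z = (\<integral>x. \<bar>h x\<bar> \<partial>leb)"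
  have hi: "integrable leb h" using hL by (rule L2_on_integrable)
  have fi: "integrable leb (\<lambda>x. f x * w2 x)" using fw2 by (rule L2_on_integrable)
  have F: "F = - (\<integral>x. h x \<partial>leb)"
  proof -
    have "(\<integral>x. U x \<bullet> A_gradient S \<Omega> w2 x \<partial>leb) = (\<integral>x. h x \<partial>leb)"
    proof (rule integral_cong_AE[OF _ hm])
      show "(\<lambda>x. U x \<bullet> A_gradient S \<Omega> w2 x) \<in> borel_measurable leb"
        using L2_on_inner[OF UL A_gradient_W12A(1)[OF A_gradient_test(1)[OF w2]]] by auto
      show "AE x in leb. U x \<bullet> A_gradient S \<Omega> w2 x = h x" using gw2 by eventually_elim (simp add: h_def)
    qed
    then show ?thesis using sol[OF w2] by (simp add: F_def)
  qed
  have FZ: "F \<le> Z" unfolding F Z_def using integral_abs_bound[of leb h] by linarith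
  \<comment> \<open>The equation tested with \<open>u w\<^sup>2\<close>, as the limit of \<open>\<psi> k * w\<^sup>2\<close> for test functions \<open>\<psi> k\<close> tending to \<open>u\<close>.
    Each of the three integrals is linear in \<open>\<psi> k\<close> with a square integrable factor.\<close>
  have X: "X = - (\<integral>x. h x * u x \<partial>leb) - (\<integral>x. f x * w2 x * u x \<partial>leb)"
  proof -
    obtain \<psi> where \<psi>: "\<And>k. \<psi> k \<in> Lip_compact_support \<Omega>"
      and lim1: "(\<lambda>k. \<integral>x. (norm (u x - \<psi> k x))\<^sup>2 \<partial>leb) \<longlonglongrightarrow> 0"
      and lim2: "(\<lambda>k. \<integral>x. (norm (U x - A_gradient S \<Omega> (\<psi> k) x))\<^sup>2 \<partial>leb) \<longlonglongrightarrow> 0"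
      using W12A0_approx[OF u0] unfolding U_def by blast
    have \<psi>L: "\<psi> k \<in> L2_on \<Omega>" for k using \<psi> by (rule L2_on_test)
    have g\<psi>L: "A_gradient S \<Omega> (\<psi> k) \<in> L2_on \<Omega>" for k by (rule A_gradient_W12A(1)[OF A_gradient_test(1)[OF \<psi>]])
    have uL: "u \<in> L2_on \<Omega>" using uW by (rule W12A_L2)
    have eq: "(\<integral>x. (w2 x *\<^sub>R U x) \<bullet> A_gradient S \<Omega> (\<psi> k) x \<partial>leb) = - (\<integral>x. h x \<bullet> \<psi> k x \<partial>leb) - (\<integral>x. (f x * w2 x) \<bullet> \<psi> k x \<partial>leb)" for k
    proof -
      have \<psi>w: "(\<lambda>x. \<psi> k x * w2 x) \<in> Lip_compact_support \<Omega>" by (rule Lip_compact_support_mult[OF \<psi> w2])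
      have i1: "integrable leb (\<lambda>x. (w2 x *\<^sub>R U x) \<bullet> A_gradient S \<Omega> (\<psi> k) x)" by (rule L2_on_inner[OF Uw2 g\<psi>L])
      have i2: "integrable leb (\<lambda>x. h x * \<psi> k x)" by (rule L2_on_mult[OF hL \<psi>L])
      have "- (\<integral>x. f x * (\<psi> k x * w2 x) \<partial>leb) = (\<integral>x. U x \<bullet> A_gradient S \<Omega> (\<lambda>x. \<psi> k x * w2 x) x \<partial>leb)"
        using sol[OF \<psi>w] by simp
      also have "\<dots> = (\<integral>x. (w2 x *\<^sub>R U x) \<bullet> A_gradient S \<Omega> (\<psi> k) x + h x * \<psi> k x \<partial>leb)"
      proof (rule integral_cong_AE)
        show "AE x in leb. U x \<bullet> A_gradient S \<Omega> (\<lambda>x. \<psi> k x * w2 x) x = (w2 x *\<^sub>R U x) \<bullet> A_gradient S \<Omega> (\<psi> k) x + h x * \<psi> k x"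
          using A_gradient_mult_test[OF \<psi> w2, of k] gw2
          by eventually_elim (simp add: h_def inner_add_right)
      qed (use i1 i2 L2_on_inner[OF UL A_gradient_W12A(1)[OF A_gradient_test(1)[OF \<psi>w]]] in \<open>auto intro!: borel_measurable_add\<close>)
      also have "\<dots> = (\<integral>x. (w2 x *\<^sub>R U x) \<bullet> A_gradient S \<Omega> (\<psi> k) x \<partial>leb) + (\<integral>x. h x * \<psi> k x \<partial>leb)"
        using i1 i2 by (rule Bochner_Integration.integral_add)
      finally show ?thesis by (simp add: mult_ac)
    qed
    have "(\<lambda>k. \<integral>x. (w2 x *\<^sub>R U x) \<bullet> A_gradient S \<Omega> (\<psi> k) x \<partial>leb) \<longlonglongrightarrow> (\<integral>x. (w2 x *\<^sub>R U x) \<bullet> U x \<partial>leb)"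
      by (rule tendsto_integral_inner_L2[OF Uw2 UL g\<psi>L lim2])
    moreover have "(\<lambda>k. - (\<integral>x. h x \<bullet> \<psi> k x \<partial>leb) - (\<integral>x. (f x * w2 x) \<bullet> \<psi> k x \<partial>leb)) \<longlonglongrightarrow>
        - (\<integral>x. h x \<bullet> u x \<partial>leb) - (\<integral>x. (f x * w2 x) \<bullet> u x \<partial>leb)"
      by (intro tendsto_diff tendsto_minus tendsto_integral_inner_L2[OF hL uL \<psi>L lim1]
          tendsto_integral_inner_L2[OF fw2 uL \<psi>L lim1])
    ultimately have "(\<integral>x. (w2 x *\<^sub>R U x) \<bullet> U x \<partial>leb) = - (\<integral>x. h x \<bullet> u x \<partial>leb) - (\<integral>x. (f x * w2 x) \<bullet> u x \<partial>leb)"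
      unfolding eq by (rule LIMSEQ_unique)
    moreover have "(\<integral>x. (w2 x *\<^sub>R U x) \<bullet> U x \<partial>leb) = X"
      unfolding X_def power2_norm_eq_inner by (simp add: w2_def mult.assoc)
    ultimately show ?thesis by simp
  qed
  have XZ: "X \<le> 2 * M * Z"
  proof -
    have uL: "u \<in> L2_on \<Omega>" using uW by (rule W12A_L2)
    have "- (\<integral>x. h x * u x \<partial>leb) \<le> (\<integral>x. M * \<bar>h x\<bar> \<partial>leb)"
    proof -
      have "- (\<integral>x. h x * u x \<partial>leb) = (\<integral>x. - (h x * u x) \<partial>leb)" by simp
      also have "\<dots> \<le> (\<integral>x. M * \<bar>h x\<bar> \<partial>leb)"
      proof (rule integral_mono_AE)
        show "AE x in leb. - (h x * u x) \<le> M * \<bar>h x\<bar>" using M(2)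
        proof eventually_elim
          case (elim x)
          have "- (h x * u x) \<le> \<bar>u x\<bar> * \<bar>h x\<bar>" by (simp add: abs_mult[symmetric] mult.commute)
          also have "\<dots> \<le> M * \<bar>h x\<bar>" using elim by (rule mult_right_mono) simp
          finally show ?case .
        qed
      qed (use L2_on_mult[OF hL uL] hi in auto)
      finally show ?thesis .
    qed
    moreover have "- (\<integral>x. f x * w2 x * u x \<partial>leb) \<le> (\<integral>x. M * (f x * w2 x) \<partial>leb)"
    proof -
      have "- (\<integral>x. f x * w2 x * u x \<partial>leb) = (\<integral>x. - (f x * w2 x * u x) \<partial>leb)" by simp
      also have "\<dots> \<le> (\<integral>x. M * (f x * w2 x) \<partial>leb)"
      proof (rule integral_mono_AE)
        show "AE x in leb. - (f x * w2 x * u x) \<le> M * (f x * w2 x)" using M(2)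
        proof eventually_elim
          case (elim x)
          have "0 \<le> f x * w2 x" using f(2) by (simp add: w2_def)
          then have "(f x * w2 x) * (- u x) \<le> (f x * w2 x) * M" using elim by (intro mult_left_mono) auto
          then show ?case by (simp add: mult_ac)
        qed
      qed (use L2_on_mult[OF fw2 uL] fi in auto)
      finally show ?thesis .
    qed
    ultimately have "X \<le> M * Z + M * F" unfolding X Z_def F_def by simp
    also have "\<dots> \<le> M * Z + M * Z" using FZ M(1) by simp
    finally show ?thesis by simp
  qed
  have ZXY: "Z \<le> X / (4 * M) + 4 * M * Y"
  proof -
    have "Z \<le> (\<integral>x. (norm (w x *\<^sub>R U x))\<^sup>2 / (4 * M) + 4 * M * (norm (W x))\<^sup>2 \<partial>leb)"
      unfolding Z_def
    proof (rule integral_mono)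
      fix x
      let ?a = "norm (w x *\<^sub>R U x)" and ?b = "norm (W x)"
      have "\<bar>h x\<bar> = 2 * \<bar>(w x *\<^sub>R U x) \<bullet> W x\<bar>" by (simp add: h_def abs_mult)
      also have "\<dots> \<le> 2 * (?a * ?b)" by (intro mult_left_mono Cauchy_Schwarz_ineq2) auto
      also have "\<dots> \<le> ?a\<^sup>2 / (4 * M) + 4 * M * ?b\<^sup>2"
      proof -
        have "0 \<le> (?a - 4 * M * ?b)\<^sup>2" by simp
        then have "(4 * M) * (2 * (?a * ?b)) \<le> ?a\<^sup>2 + (4 * M) * (4 * M * ?b\<^sup>2)"
          by (simp add: power2_eq_square algebra_simps)
        also have "\<dots> = (4 * M) * (?a\<^sup>2 / (4 * M) + 4 * M * ?b\<^sup>2)" using M(1) by (simp add: distrib_left)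
        finally show ?thesis using M(1) by (simp only: mult_le_cancel_left_pos)
      qed
      finally show "\<bar>h x\<bar> \<le> ?a\<^sup>2 / (4 * M) + 4 * M * ?b\<^sup>2" .
    qed (use hi L2_onD(2)[OF Uw] L2_onD(2)[OF WL] in auto)
    also have "\<dots> = X / (4 * M) + 4 * M * Y"
      unfolding X_def Y_def using L2_onD(2)[OF Uw] L2_onD(2)[OF WL] by simp
    finally show ?thesis .
  qed
  have "X / (4 * M) \<le> Z / 2" using XZ M(1) by (simp add: field_simps)
  then have "Z \<le> 8 * M * Y" using ZXY by linarith
  then have "F \<le> 8 * M * Y" using FZ by linarith
  then show ?thesis by (simp add: F_def Y_def W_def w2_def power2_eq_square)
qed

text \<open>
  Both sides are continuous along test functions approximating \<open>w\<close>. The bound \<open>M\<close> may be \<open>0\<close>, so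
  the estimate for test functions is applied with \<open>M + e\<close>.
\<close>

theorem energy_estimate:
  assumes f: "f \<in> borel_measurable leb" "\<And>x. 0 \<le> f x \<and> f x \<le> K"
    and u: "weak_dirichlet_solution S \<Omega> f u"
    and M: "0 \<le> M" "AE x in leb. \<bar>u x\<bar> \<le> M"
    and w: "w \<in> W12A0 S \<Omega>"
  shows "(\<integral>x. f x * (w x)\<^sup>2 \<partial>leb) \<le> 8 * M * (\<integral>x. (norm (A_gradient S \<Omega> w x))\<^sup>2 \<partial>leb)"
proof -
  let ?Y = "\<lambda>w. \<integral>x. (norm (A_gradient S \<Omega> w x))\<^sup>2 \<partial>leb"
  have wW: "w \<in> W12A S \<Omega>" using w by (simp add: W12A0_def)
  obtain \<psi> where \<psi>: "\<And>k. \<psi> k \<in> Lip_compact_support \<Omega>"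
    and lim1: "(\<lambda>k. \<integral>x. (norm (w x - \<psi> k x))\<^sup>2 \<partial>leb) \<longlonglongrightarrow> 0"
    and lim2: "(\<lambda>k. \<integral>x. (norm (A_gradient S \<Omega> w x - A_gradient S \<Omega> (\<psi> k) x))\<^sup>2 \<partial>leb) \<longlonglongrightarrow> 0"
    using W12A0_approx[OF w] by blast
  have g\<psi>L: "A_gradient S \<Omega> (\<psi> k) \<in> L2_on \<Omega>" for k by (rule A_gradient_W12A(1)[OF A_gradient_test(1)[OF \<psi>]])
  have L1: "(\<lambda>k. \<integral>x. f x * (norm (\<psi> k x))\<^sup>2 \<partial>leb) \<longlonglongrightarrow> (\<integral>x. f x * (norm (w x))\<^sup>2 \<partial>leb)"
    by (rule tendsto_integral_weighted_norm_L2[OF f W12A_L2[OF wW] L2_on_test[OF \<psi>] lim1])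
  have "(\<lambda>k. \<integral>x. 1 * (norm (A_gradient S \<Omega> (\<psi> k) x))\<^sup>2 \<partial>leb) \<longlonglongrightarrow> (\<integral>x. 1 * (norm (A_gradient S \<Omega> w x))\<^sup>2 \<partial>leb)"
    by (rule tendsto_integral_weighted_norm_L2[OF _ _ A_gradient_W12A(1)[OF wW] g\<psi>L lim2, of _ 1]) auto
  then have L2: "(\<lambda>k. ?Y (\<psi> k)) \<longlonglongrightarrow> ?Y w" by simp
  have "(\<integral>x. f x * (w x)\<^sup>2 \<partial>leb) \<le> 8 * (M + e) * ?Y w" if e: "0 < e" for e
  proof (rule LIMSEQ_le)
    show "(\<lambda>k. \<integral>x. f x * (\<psi> k x)\<^sup>2 \<partial>leb) \<longlonglongrightarrow> (\<integral>x. f x * (w x)\<^sup>2 \<partial>leb)" using L1 by simp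
    show "(\<lambda>k. 8 * (M + e) * ?Y (\<psi> k)) \<longlonglongrightarrow> 8 * (M + e) * ?Y w" by (intro tendsto_mult_left L2)
    have "AE x in leb. \<bar>u x\<bar> \<le> M + e" using M(2) by eventually_elim (use e in simp)
    then show "\<exists>N. \<forall>n\<ge>N. (\<integral>x. f x * (\<psi> n x)\<^sup>2 \<partial>leb) \<le> 8 * (M + e) * ?Y (\<psi> n)"
      using energy_estimate_test[OF f u _ _ \<psi>, of "M + e"] M(1) e by auto
  qed
  then have ev: "eventually (\<lambda>e. (\<integral>x. f x * (w x)\<^sup>2 \<partial>leb) \<le> 8 * (M + e) * ?Y w) (at_right 0)"
    by (rule eventually_mono[OF eventually_at_right_less])
  have "((\<lambda>e. 8 * (M + e) * ?Y w) \<longlongrightarrow> 8 * (M + 0) * ?Y w) (at_right 0)"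
    by (intro tendsto_intros)
  then have "(\<integral>x. f x * (w x)\<^sup>2 \<partial>leb) \<le> 8 * (M + 0) * ?Y w"
    using ev by (rule tendsto_lowerbound) simp
  then show ?thesis by simp
qed

end

section \<open>The Orlicz-Sobolev inequality\<close>

context bounded_domain
begin

lemma normalized_measure:
  assumes ne: "\<Omega> \<noteq> {}"
  shows "0 < measure lebesgue \<Omega>" "emeasure leb \<Omega> = ennreal (measure lebesgue \<Omega>)"
    "finite_measure (normalized_lebesgue_on \<Omega>)"
    "f \<in> borel_measurable (normalized_lebesgue_on \<Omega>) \<longleftrightarrow> f \<in> borel_measurable leb"
    "(AE x in normalized_lebesgue_on \<Omega>. P x) \<longleftrightarrow> (AE x in leb. P x)"
proof -
  have lm: "\<Omega> \<in> lmeasurable" using open_domain bounded_domain by (simp add: bounded_set_imp_lmeasurable)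
  have em0: "emeasure lebesgue \<Omega> = ennreal (measure lebesgue \<Omega>)" using lm by (rule emeasure_eq_measure2)
  have "emeasure lebesgue \<Omega> \<noteq> 0"
    using open_not_negligible[OF open_domain ne] sets_domain by (auto simp: negligible_iff_null_sets null_sets_def)
  then show pos: "0 < measure lebesgue \<Omega>" unfolding em0 by (simp add: zero_less_measure_iff)
  have "emeasure leb \<Omega> = emeasure lebesgue \<Omega>" using sets_domain by (intro emeasure_restrict_space) auto
  then show em: "emeasure leb \<Omega> = ennreal (measure lebesgue \<Omega>)" using em0 by simp
  have em': "emeasure leb \<Omega> \<noteq> 0" "emeasure leb \<Omega> \<noteq> \<infinity>" using pos em by auto
  then have "emeasure (normalized_lebesgue_on \<Omega>) \<Omega> = 1"
    unfolding normalized_lebesgue_on_def by (rule emeasure_uniform_measure_1)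
  then show "finite_measure (normalized_lebesgue_on \<Omega>)"
    by (intro finite_measureI) (simp add: normalized_lebesgue_on_def)
  show "f \<in> borel_measurable (normalized_lebesgue_on \<Omega>) \<longleftrightarrow> f \<in> borel_measurable leb"
    unfolding normalized_lebesgue_on_def by (rule arg_cong[where f="\<lambda>A. f \<in> A"]) (rule measurable_cong_sets; simp)
  show "(AE x in normalized_lebesgue_on \<Omega>. P x) \<longleftrightarrow> (AE x in leb. P x)"
  proof -
    have "0 < emeasure leb \<Omega>" "emeasure leb \<Omega> < \<infinity>" using pos em by auto
    then show ?thesis unfolding normalized_lebesgue_on_def by (subst AE_uniform_measure) (auto intro!: AE_cong)
  qed
qed

lemma integral_normalized:
  assumes ne: "\<Omega> \<noteq> {}" and h: "integrable leb h" "\<And>x. 0 \<le> h x"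
  shows "(\<integral>\<^sup>+x. ennreal (h x) \<partial>normalized_lebesgue_on \<Omega>) = ennreal ((\<integral>x. h x \<partial>leb) / measure lebesgue \<Omega>)"
    "(\<integral>x. h x \<partial>normalized_lebesgue_on \<Omega>) = (\<integral>x. h x \<partial>leb) / measure lebesgue \<Omega>"
proof -
  note N = normalized_measure[OF ne]
  have \<Omega>: "\<Omega> \<in> sets leb" using sets_domain by (simp add: sets_restrict_space_iff)
  have "(\<integral>\<^sup>+x. ennreal (h x) \<partial>normalized_lebesgue_on \<Omega>) = (\<integral>\<^sup>+x. ennreal (h x) * indicator \<Omega> x \<partial>leb) / emeasure leb \<Omega>"
    unfolding normalized_lebesgue_on_def using h(1) \<Omega> by (intro nn_integral_uniform_measure) auto
  also have "(\<integral>\<^sup>+x. ennreal (h x) * indicator \<Omega> x \<partial>leb) = (\<integral>\<^sup>+x. ennreal (h x) \<partial>leb)"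
    by (intro nn_integral_cong) auto
  also have "\<dots> = ennreal (\<integral>x. h x \<partial>leb)" using h by (intro nn_integral_eq_integral) auto
  also have "\<dots> / emeasure leb \<Omega> = ennreal ((\<integral>x. h x \<partial>leb) / measure lebesgue \<Omega>)"
    unfolding N(2) using N(1) h by (intro divide_ennreal Bochner_Integration.integral_nonneg) auto
  finally show nn: "(\<integral>\<^sup>+x. ennreal (h x) \<partial>normalized_lebesgue_on \<Omega>) = ennreal ((\<integral>x. h x \<partial>leb) / measure lebesgue \<Omega>)" .
  have "h \<in> borel_measurable (normalized_lebesgue_on \<Omega>)" using h(1) by (subst N(4)) auto
  then have "(\<integral>x. h x \<partial>normalized_lebesgue_on \<Omega>) = enn2real (\<integral>\<^sup>+x. ennreal (h x) \<partial>normalized_lebesgue_on \<Omega>)"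
    using h(2) by (intro integral_eq_nn_integral) auto
  then show "(\<integral>x. h x \<partial>normalized_lebesgue_on \<Omega>) = (\<integral>x. h x \<partial>leb) / measure lebesgue \<Omega>"
    unfolding nn using N(1) h by (simp add: Bochner_Integration.integral_nonneg)
qed

end

lemma luxemburg_norm_square_le:
  assumes "0 < N" "(\<integral>\<^sup>+x. \<phi> ((w x)\<^sup>2 / N) \<partial>M) \<le> 1"
  shows "luxemburg_norm M (\<lambda>t. \<phi> (t\<^sup>2)) w \<le> ennreal (sqrt N)"
  unfolding luxemburg_norm_def using assms by (intro Inf_lower) (auto simp: power_divide intro!: exI[of _ "sqrt N"])

context degenerate_domain
begin

text \<open>
  Duality is applied to \<open>g = w\<^sup>2\<close> with \<open>N = 8 C y + e\<close>, where \<open>y\<close> is the normalised energy of \<open>w\<close>; the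
  summand \<open>e > 0\<close> keeps \<open>N\<close> positive when \<open>y = 0\<close>.
\<close>

theorem orlicz_sobolev_inequality_if_solutions_bounded:
  assumes ne: "\<Omega> \<noteq> {}" and \<phi>: "young_function \<phi>" and C: "0 \<le> C"
    and sol: "\<And>f. f \<in> orlicz_space (normalized_lebesgue_on \<Omega>) (convex_conjugate \<phi>) \<Longrightarrow>
      \<exists>u. weak_dirichlet_solution S \<Omega> f u \<and>
        esssup (normalized_lebesgue_on \<Omega>) (\<lambda>x. ennreal \<bar>u x\<bar>) \<le>
          ennreal C * luxemburg_norm (normalized_lebesgue_on \<Omega>) (convex_conjugate \<phi>) f"
    and w: "w \<in> W12A0 S \<Omega>"
  shows "luxemburg_norm (normalized_lebesgue_on \<Omega>) (\<lambda>t. \<phi> (t\<^sup>2)) w \<le>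
    ennreal (sqrt (16 * C)) * ennreal (sqrt (\<integral>x. (norm (A_gradient S \<Omega> w x))\<^sup>2 \<partial>normalized_lebesgue_on \<Omega>))"
proof -
  let ?\<mu> = "normalized_lebesgue_on \<Omega>"
  note N = normalized_measure[OF ne]
  define y where "y = (\<integral>x. (norm (A_gradient S \<Omega> w x))\<^sup>2 \<partial>?\<mu>)"
  have wW: "w \<in> W12A S \<Omega>" using w by (simp add: W12A0_def)
  have wL: "w \<in> L2_on \<Omega>" using wW by (rule W12A_L2)
  have gi: "integrable leb (\<lambda>x. (norm (A_gradient S \<Omega> w x))\<^sup>2)" by (rule L2_onD(2)[OF A_gradient_W12A(1)[OF wW]])
  have y: "y = (\<integral>x. (norm (A_gradient S \<Omega> w x))\<^sup>2 \<partial>leb) / measure lebesgue \<Omega>"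
    unfolding y_def by (rule integral_normalized(2)[OF ne gi]) simp
  have y0: "0 \<le> y" unfolding y_def by (intro Bochner_Integration.integral_nonneg) simp
  have dual: "(\<integral>\<^sup>+x. ennreal (f x * (w x)\<^sup>2) \<partial>?\<mu>) \<le> ennreal (8 * C * y) * luxemburg_norm ?\<mu> (convex_conjugate \<phi>) f"
    if f: "f \<in> borel_measurable ?\<mu>" "\<And>x. 0 \<le> f x \<and> f x \<le> K" "luxemburg_norm ?\<mu> (convex_conjugate \<phi>) f < \<infinity>" for f K
  proof -
    obtain l where l: "0 \<le> l" "luxemburg_norm ?\<mu> (convex_conjugate \<phi>) f = ennreal l"
      using f(3) by (cases "luxemburg_norm ?\<mu> (convex_conjugate \<phi>) f") auto
    have "f \<in> orlicz_space ?\<mu> (convex_conjugate \<phi>)" using f by (simp add: orlicz_space_def)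
    then obtain u where u: "weak_dirichlet_solution S \<Omega> f u"
      and sup: "esssup ?\<mu> (\<lambda>x. ennreal \<bar>u x\<bar>) \<le> ennreal C * ennreal l"
      using sol l(2) by metis
    have "AE x in ?\<mu>. ennreal \<bar>u x\<bar> \<le> ennreal C * ennreal l"
      using esssup_AE[of "\<lambda>x. ennreal \<bar>u x\<bar>" ?\<mu>] by eventually_elim (rule order_trans[OF _ sup])
    then have "AE x in leb. \<bar>u x\<bar> \<le> C * l"
      unfolding N(5) by eventually_elim (use C l in \<open>simp add: ennreal_mult[symmetric] ennreal_le_iff\<close>)
    moreover have fm: "f \<in> borel_measurable leb" using f(1) N(4) by blast
    ultimately have E: "(\<integral>x. f x * (w x)\<^sup>2 \<partial>leb) \<le> 8 * (C * l) * (\<integral>x. (norm (A_gradient S \<Omega> w x))\<^sup>2 \<partial>leb)"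
      using energy_estimate[OF fm f(2) u _ _ w] C l by simp
    have "AE x in leb. \<bar>f x\<bar> \<le> K" using f(2) by (intro AE_I2) (auto simp: abs_le_iff intro: order_trans[of "- _" 0])
    then have fi: "integrable leb (\<lambda>x. f x * (w x)\<^sup>2)"
      using L2_on_inner[OF L2_on_scaleR_bounded[OF fm _ wL] wL] by (simp add: power2_eq_square mult.assoc)
    have "(\<integral>\<^sup>+x. ennreal (f x * (w x)\<^sup>2) \<partial>?\<mu>) = ennreal ((\<integral>x. f x * (w x)\<^sup>2 \<partial>leb) / measure lebesgue \<Omega>)"
      using f(2) by (intro integral_normalized(1)[OF ne fi]) simp
    also have "\<dots> \<le> ennreal (8 * C * y * l)"
      using divide_right_mono[OF E, of "measure lebesgue \<Omega>"] N(1) by (intro ennreal_leI) (simp add: y mult_ac)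
    also have "\<dots> = ennreal (8 * C * y) * ennreal l" using C y0 l by (intro ennreal_mult) auto
    finally show ?thesis using l by simp
  qed
  have bound: "luxemburg_norm ?\<mu> (\<lambda>t. \<phi> (t\<^sup>2)) w \<le> ennreal (sqrt (2 * (8 * C * y + e)))" if e: "0 < e" for e
  proof (rule luxemburg_norm_square_le)
    show pos: "0 < 2 * (8 * C * y + e)" using C y0 e by (simp add: add_nonneg_pos)
    show "(\<integral>\<^sup>+x. \<phi> ((w x)\<^sup>2 / (2 * (8 * C * y + e))) \<partial>?\<mu>) \<le> 1"
    proof (rule nn_integral_young_le_1_if_dual_bound[OF N(3) \<phi>])
      have "w \<in> borel_measurable ?\<mu>" using L2_onD(1)[OF wL] N(4) by blast
      then show "(\<lambda>x. (w x)\<^sup>2) \<in> borel_measurable ?\<mu>" by measurable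
      fix f K assume f: "f \<in> borel_measurable ?\<mu>" "\<And>x. 0 \<le> f x \<and> f x \<le> K"
        "luxemburg_norm ?\<mu> (convex_conjugate \<phi>) f < \<infinity>"
      have "ennreal (8 * C * y) \<le> ennreal (8 * C * y + e)" using e by (intro ennreal_leI) simp
      then show "(\<integral>\<^sup>+x. ennreal (f x * (w x)\<^sup>2) \<partial>?\<mu>)
          \<le> ennreal (8 * C * y + e) * luxemburg_norm ?\<mu> (convex_conjugate \<phi>) f"
        using dual[OF f] by (meson mult_right_mono order_trans zero_le)
    qed (use pos in auto)
  qed
  have "luxemburg_norm ?\<mu> (\<lambda>t. \<phi> (t\<^sup>2)) w \<le> ennreal (sqrt (2 * (8 * C * y + 0)))"
  proof (rule tendsto_lowerbound)
    show "((\<lambda>e. ennreal (sqrt (2 * (8 * C * y + e)))) \<longlongrightarrow> ennreal (sqrt (2 * (8 * C * y + 0)))) (at_right 0)"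
      by (intro tendsto_intros)
    show "eventually (\<lambda>e. luxemburg_norm ?\<mu> (\<lambda>t. \<phi> (t\<^sup>2)) w \<le> ennreal (sqrt (2 * (8 * C * y + e)))) (at_right 0)"
      using bound by (rule eventually_mono[OF eventually_at_right_less])
  qed simp
  also have "\<dots> = ennreal (sqrt (16 * C)) * ennreal (sqrt y)"
    using C y0 by (simp add: ennreal_mult[symmetric] real_sqrt_mult[symmetric] mult_ac)
  finally show ?thesis by (simp add: y_def)
qed

end

theorem theorem2:
  fixes d :: "real ^ 'n \<Rightarrow> real ^ 'n \<Rightarrow> real"
    and x0 :: "real ^ 'n" and r :: real
    and B :: "(real ^ 'n) set"
    and A S :: "real ^ 'n \<Rightarrow> real ^ 'n ^ 'n"
    and \<phi> :: "real \<Rightarrow> ennreal"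
    and C :: real
  assumes "Metric_space UNIV d"
    and "B = Metric_space.mball UNIV d x0 r"
    and "B \<noteq> {}" and "open B" and "connected B" and "bounded B"
    and "A \<in> borel_measurable (lebesgue_on B)" and "bounded (A ` B)"
    and "\<forall>x\<in>B. transpose (A x) = A x \<and> (\<forall>\<xi>. 0 \<le> \<xi> \<bullet> (A x *v \<xi>))"
    and "\<exists>L. L-lipschitz_on B S"
    and "\<forall>x\<in>B. A x = transpose (S x) ** S x"
    and "young_function \<phi>"
    and "\<forall>f \<in> orlicz_space (normalized_lebesgue_on B) (convex_conjugate \<phi>).
           \<exists>u. weak_dirichlet_solution S B f u \<and>
             (\<forall>v. weak_dirichlet_solution S B f v \<longrightarrow> (AE x in lebesgue_on B. v x = u x)) \<and>
             esssup (normalized_lebesgue_on B) (\<lambda>x. ennreal \<bar>u x\<bar>) \<le>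
               ennreal C * luxemburg_norm (normalized_lebesgue_on B) (convex_conjugate \<phi>) f"
  shows "\<exists>C'::real. \<forall>w \<in> W12A0 S B.
           luxemburg_norm (normalized_lebesgue_on B) (\<lambda>t. \<phi> (t\<^sup>2)) w \<le>
             ennreal C' *
             ennreal (sqrt (\<integral>x. (norm (A_gradient S B w x))\<^sup>2 \<partial>normalized_lebesgue_on B))"
proof -
  interpret degenerate_domain B S by unfold_locales fact+
  \<comment> \<open>The constant may be negative, in which case \<open>ennreal C\<close> is \<open>0\<close>.\<close>
  have C: "ennreal C = ennreal (max C 0)" by (cases "0 \<le> C") (auto simp: ennreal_neg)
  show ?thesis
  proof (intro exI[of _ "sqrt (16 * max C 0)"] ballI orlicz_sobolev_inequality_if_solutions_bounded)
    fix f assume "f \<in> orlicz_space (normalized_lebesgue_on B) (convex_conjugate \<phi>)"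
    then show "\<exists>u. weak_dirichlet_solution S B f u \<and>
        esssup (normalized_lebesgue_on B) (\<lambda>x. ennreal \<bar>u x\<bar>) \<le>
          ennreal (max C 0) * luxemburg_norm (normalized_lebesgue_on B) (convex_conjugate \<phi>) f"
      using assms(13) C by metis
  qed (use assms(3,12) in auto)
qed

end
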